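(* Let $G$ be a connected Lie group with Lie algebra $\mathfrak g$. For each $\zeta\in T^*G$, $(J^R)^{-1}\bigl(J^R(\zeta)\bigr)$ and $(J^L)^{-1}\bigl(J^L(\zeta)\bigr)$ are two smooth submanifolds of $T^*G$, diffeomorphic to $G$, which are the orbits through $\zeta$ of the actions $\widehat\Phi^L:G\times T^*G\to T^*G$ and $\widehat\Phi^R:T^*G\times G\to T^*G$, respectively. Their intersection is a smooth isotropic submanifold of the symplectic manifold $(T^*G,\omega_{T^*G})$, which can be written both as $$(J^R)^{-1}\bigl(J^R(\zeta)\bigr)\cap(J^L)^{-1}\bigl(J^L(\zeta)\bigr)=\bigl\{(TL_{g^{-1}})^t(\zeta)\,;\,g\in G_{J^L(\zeta)}\bigr\}$$ and as $$(J^R)^{-1}\bigl(J^R(\zeta)\bigr)\cap(J^L)^{-1}\bigl(J^L(\zeta)\bigr)=\bigl\{(TR_{\gamma^{-1}})^t(\zeta)\,;\,\gamma\in G_{J^R(\zeta)}\bigr\},$$ where $G_{J^L(\zeta)}$ and $G_{J^R(\zeta)}$ are the isotropy groups of $J^L(\zeta)$ and of $J^R(\zeta)$, respectively, for the coadjoint action of $G$ on $\mathfrak g^*$. Moreover, the tangent space at $\zeta$ to $(J^R)^{-1}\bigl(J^R(\zeta)\bigr)\cap(J^L)^{-1}\bigl(J^L(\zeta)\bigr)$ is the kernel (at $\zeta$) of the closed $2$-form induced by $\omega_{T^*G}$ on each of the submanifolds $(J^R)^{-1}\bigl(J^R(\zeta)\bigr)$ and $(J^L)^{-1}\bigl(J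^L(\zeta)\bigr)$.
   Context: $\mathfrak g$ is identified with $T_eG$ and $\mathfrak g^*$ with $T_e^*G$; $\pi_G:T^*G\to G$ is the canonical projection. $L_g(x)=gx$, $R_g(x)=xg$, with tangent maps $TL_g,TR_g$. The superscript $t$ denotes the transpose: for $\zeta\in T^*_xG$, $(TL_{g^{-1}})^t(\zeta)\in T^*_{gx}G$ and $(TR_{g^{-1}})^t(\zeta)\in T^*_{xg}G$. The lifts to $T^*G$ of the actions of $G$ on itself by left and right translations are $\widehat\Phi^L(g,\zeta)=(TL_{g^{-1}})^t(\zeta)$ (a left action) and $\widehat\Phi^R(\zeta,g)=(TR_{g^{-1}})^t(\zeta)$ (a right action). Their momentum maps $J^L,J^R:T^*G\to\mathfrak g^*$ are $J^L(\zeta)=(TR_{\pi_G(\zeta)})^t(\zeta)$ and $J^R(\zeta)=(TL_{\pi_G(\zeta)})^t(\zeta)$. $\omega_{T^*G}=\mathrm d\eta$ is the canonical symplectic form, where $\eta$ is the Liouville form $\langle\eta(\xi),w\rangle=\langle\xi,T\pi_G(w)\rangle$. The coadjoint action is $\mathrm{Ad}^*_g(\xi)=(\mathrm{Ad}_{g^{-1}})^t(\xi)$. *)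

theory Defs
  imports "HOL-Analysis.Analysis" "HOL-Algebra.Group_Action"
begin

section \<open>Model spaces and smooth maps between them\<close>

text \<open>
  Manifolds are modelled on finite-dimensional Euclidean vector spaces. The class
  \<open>euclidean_space\<close> excludes dimension 0; the following class does not.
\<close>

class finite_dim_inner = real_inner +
  assumes finite_dim: "\<exists>B. finite B \<and> (\<forall>x. \<exists>c. x = (\<Sum>b\<in>B. c b *\<^sub>R b))"

instance euclidean_space \<subseteq> finite_dim_inner
proof
  show "\<exists>B. finite B \<and> (\<forall>x::'a. \<exists>c. x = (\<Sum>b\<in>B. c b *\<^sub>R b))"
    by (intro exI[of _ Basis] conjI allI) (auto intro: euclidean_representation[symmetric])
qed

instance prod :: (finite_dim_inner, finite_dim_inner) finite_dim_inner
proof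
  obtain B where B: "finite B" "\<forall>x::'a. \<exists>c. x = (\<Sum>b\<in>B. c b *\<^sub>R b)"
    using finite_dim by blast
  obtain C where C: "finite C" "\<forall>y::'b. \<exists>c. y = (\<Sum>b\<in>C. c b *\<^sub>R b)"
    using finite_dim by blast
  let ?D = "(\<lambda>b. (b, 0::'b)) ` B \<union> (\<lambda>b. (0::'a, b)) ` C"
  have span_iff: "(\<exists>c. z = (\<Sum>b\<in>D. c b *\<^sub>R b)) \<longleftrightarrow> z \<in> span D"
    if "finite D" for D :: "('a \<times> 'b) set" and z
    using span_finite[OF that] by auto
  have "z \<in> span ?D" for z
  proof -
    obtain c where c: "fst z = (\<Sum>b\<in>B. c b *\<^sub>R b)" using B(2) by blast
    obtain d where d: "snd z = (\<Sum>b\<in>C. d b *\<^sub>R b)" using C(2) by blast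
    have "z = (\<Sum>b\<in>B. c b *\<^sub>R (b, 0)) + (\<Sum>b\<in>C. d b *\<^sub>R (0, b))"
      by (simp add: prod_eq_iff fst_sum snd_sum c d)
    then show ?thesis
      by (metis (no_types, lifting) UnI1 UnI2 imageI span_add span_base span_scale span_sum)
  qed
  then show "\<exists>B. finite B \<and> (\<forall>x::'a \<times> 'b. \<exists>c. x = (\<Sum>b\<in>B. c b *\<^sub>R b))"
    using B(1) C(1) span_iff[of ?D] by (intro exI[of _ ?D]) auto
qed

text \<open>
  The following two notions are used on open sets only. As the domain has finite dimension,
  continuity of all directional derivatives of order at most \<open>n\<close> is the usual class \<open>C\<close> to
  the \<open>n\<close>.
\<close>

primrec Ck_on :: "nat \<Rightarrow> ('a::real_normed_vector \<Rightarrow> 'b::real_normed_vector) \<Rightarrow> 'a set \<Rightarrow> bool" where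
  "Ck_on 0 f S \<longleftrightarrow> continuous_on S f"
| "Ck_on (Suc n) f S \<longleftrightarrow>
     (\<forall>x\<in>S. f differentiable (at x)) \<and> (\<forall>v. Ck_on n (\<lambda>x. frechet_derivative f (at x) v) S)"

definition smooth_on ::
    "'a set \<Rightarrow> ('a::finite_dim_inner \<Rightarrow> 'b::finite_dim_inner) \<Rightarrow> bool" where
  "smooth_on S f \<longleftrightarrow> (\<forall>n. Ck_on n f S)"


section \<open>Smooth manifolds\<close>

text \<open>
  A chart is a pair of a domain and a coordinate map, of which only the values on the domain
  matter. A manifold is given by an atlas, which need not be maximal; its underlying set and
  its topology are determined by the atlas.
\<close>

type_synonym ('m, 'e) chart = "'m set \<times> ('m \<Rightarrow> 'e)"
type_synonym ('m, 'e) atlas = "('m, 'e) chart set"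

definition is_chart :: "('m, 'e::finite_dim_inner) chart \<Rightarrow> bool" where
  "is_chart c \<longleftrightarrow> inj_on (snd c) (fst c) \<and> open (snd c ` fst c)"

abbreviation chart_inv :: "('m, 'e) chart \<Rightarrow> 'e \<Rightarrow> 'm" where
  "chart_inv c \<equiv> inv_into (fst c) (snd c)"

definition smooth_transition ::
    "('m, 'e::finite_dim_inner) chart \<Rightarrow> ('m, 'e) chart \<Rightarrow> bool" where
  "smooth_transition c d \<longleftrightarrow>
     open (snd c ` (fst c \<inter> fst d)) \<and> smooth_on (snd c ` (fst c \<inter> fst d)) (snd d \<circ> chart_inv c)"

definition points :: "('m, 'e) atlas \<Rightarrow> 'm set" where
  "points A = (\<Union>c\<in>A. fst c)"

definition manifold_topology :: "('m, 'e::finite_dim_inner) atlas \<Rightarrow> 'm topology" where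
  "manifold_topology A = topology (\<lambda>U. U \<subseteq> points A \<and> (\<forall>c\<in>A. open (snd c ` (U \<inter> fst c))))"

definition smooth_manifold :: "('m, 'e::finite_dim_inner) atlas \<Rightarrow> bool" where
  "smooth_manifold A \<longleftrightarrow>
     (\<forall>c\<in>A. is_chart c) \<and> (\<forall>c\<in>A. \<forall>d\<in>A. smooth_transition c d) \<and>
     Hausdorff_space (manifold_topology A) \<and> second_countable (manifold_topology A)"

definition maximal_atlas :: "('m, 'e::finite_dim_inner) atlas \<Rightarrow> ('m, 'e) atlas" where
  "maximal_atlas A =
     {c. fst c \<subseteq> points A \<and> is_chart c \<and> (\<forall>d\<in>A. smooth_transition c d \<and> smooth_transition d c)}"

definition euclidean_atlas :: "('e, 'e) atlas" where
  "euclidean_atlas = {(UNIV, \<lambda>x. x)}"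

definition prod_atlas :: "('m, 'e) atlas \<Rightarrow> ('n, 'f) atlas \<Rightarrow> ('m \<times> 'n, 'e \<times> 'f) atlas" where
  "prod_atlas A B = {(fst c \<times> fst d, map_prod (snd c) (snd d)) | c d. c \<in> A \<and> d \<in> B}"

text \<open>
  Smoothness on an open subset \<open>W\<close>. Openness of the coordinate domains expresses continuity.
\<close>

definition smooth_map_on ::
    "('m, 'e::finite_dim_inner) atlas \<Rightarrow> ('n, 'f::finite_dim_inner) atlas \<Rightarrow> 'm set \<Rightarrow> ('m \<Rightarrow> 'n) \<Rightarrow> bool" where
  "smooth_map_on A B W f \<longleftrightarrow>
     f ` W \<subseteq> points B \<and>
     (\<forall>c\<in>A. \<forall>d\<in>B. let O' = snd c ` (fst c \<inter> W \<inter> f -` fst d)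
        in open O' \<and> smooth_on O' (snd d \<circ> f \<circ> chart_inv c))"

abbreviation smooth_map ::
    "('m, 'e::finite_dim_inner) atlas \<Rightarrow> ('n, 'f::finite_dim_inner) atlas \<Rightarrow> ('m \<Rightarrow> 'n) \<Rightarrow> bool" where
  "smooth_map A B f \<equiv> smooth_map_on A B (points A) f"


section \<open>Tangent spaces and tangent maps\<close>

text \<open>
  Every point \<open>p\<close> has a preferred chart, through which the tangent space at \<open>p\<close> is identified
  with the model space: the vector \<open>v\<close> of the model space stands for the tangent vector whose
  coordinate expression in the preferred chart at \<open>p\<close> is \<open>v\<close>. The notions below do not depend
  on the choice up to this identification.
\<close>

definition chart_at :: "('m, 'e) atlas \<Rightarrow> 'm \<Rightarrow> ('m, 'e) chart" where
  "chart_at A p = (SOME c. c \<in> A \<and> p \<in> fst c)"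

definition tangent_map ::
    "('m, 'e::finite_dim_inner) atlas \<Rightarrow> ('n, 'f::finite_dim_inner) atlas \<Rightarrow> ('m \<Rightarrow> 'n) \<Rightarrow> 'm \<Rightarrow> 'e \<Rightarrow> 'f" where
  "tangent_map A B f p =
     frechet_derivative (snd (chart_at B (f p)) \<circ> f \<circ> chart_inv (chart_at A p))
       (at (snd (chart_at A p) p))"

definition velocity :: "('m, 'e::finite_dim_inner) atlas \<Rightarrow> (real \<Rightarrow> 'm) \<Rightarrow> real \<Rightarrow> 'e" where
  "velocity A \<gamma> t = vector_derivative (snd (chart_at A (\<gamma> t)) \<circ> \<gamma>) (at t)"

text \<open>
  The tangent vector at \<open>p\<close> with the coordinate expression \<open>v\<close> in the chart \<open>c\<close>.
\<close>

definition from_chart ::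
    "('m, 'e::finite_dim_inner) atlas \<Rightarrow> ('m, 'e) chart \<Rightarrow> 'm \<Rightarrow> 'e \<Rightarrow> 'e" where
  "from_chart A c p = frechet_derivative (snd (chart_at A p) \<circ> chart_inv c) (at (snd c p))"


section \<open>Submanifolds\<close>

definition slice_chart ::
    "('m, 'e::finite_dim_inner) atlas \<Rightarrow> 'm set \<Rightarrow> ('m, 'e) chart \<Rightarrow> 'e set \<Rightarrow> bool" where
  "slice_chart A S c V \<longleftrightarrow>
     c \<in> maximal_atlas A \<and> subspace V \<and> snd c ` (fst c \<inter> S) = snd c ` fst c \<inter> V"

definition smooth_submanifold :: "('m, 'e::finite_dim_inner) atlas \<Rightarrow> 'm set \<Rightarrow> bool" where
  "smooth_submanifold A S \<longleftrightarrow>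
     S \<subseteq> points A \<and> (\<exists>k. \<forall>p\<in>S. \<exists>c V. slice_chart A S c V \<and> p \<in> fst c \<and> dim V = k)"

text \<open>
  A map defined on a submanifold is smooth if and only if it extends locally to smooth maps on
  open sets of the ambient manifold.
\<close>

definition smooth_map_submanifold ::
    "('m, 'e::finite_dim_inner) atlas \<Rightarrow> ('n, 'f::finite_dim_inner) atlas \<Rightarrow> 'm set \<Rightarrow> ('m \<Rightarrow> 'n) \<Rightarrow> bool" where
  "smooth_map_submanifold A B S f \<longleftrightarrow>
     (\<forall>p\<in>S. \<exists>W F. openin (manifold_topology A) W \<and> p \<in> W \<and> smooth_map_on A B W F \<and>
        (\<forall>x\<in>W \<inter> S. F x = f x))"

definition diffeomorphic_to_submanifold ::
    "('m, 'e::finite_dim_inner) atlas \<Rightarrow> ('n, 'f::finite_dim_inner) atlas \<Rightarrow> 'n set \<Rightarrow> bool" where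
  "diffeomorphic_to_submanifold A B S \<longleftrightarrow>
     (\<exists>f. bij_betw f (points A) S \<and> smooth_map A B f \<and>
        smooth_map_submanifold B A S (inv_into (points A) f))"

definition tangent_space :: "('m, 'e::finite_dim_inner) atlas \<Rightarrow> 'm set \<Rightarrow> 'm \<Rightarrow> 'e set" where
  "tangent_space A S p =
     {velocity A \<gamma> 0 | \<gamma>. \<gamma> 0 = p \<and>
        (\<exists>\<epsilon>>0. smooth_map_on euclidean_atlas A {-\<epsilon><..<\<epsilon>} \<gamma> \<and> \<gamma> ` {-\<epsilon><..<\<epsilon>} \<subseteq> S)}"


section \<open>Differential forms\<close>

type_synonym ('m, 'e) form1 = "'m \<Rightarrow> 'e \<Rightarrow> real"
type_synonym ('m, 'e) form2 = "'m \<Rightarrow> 'e \<Rightarrow> 'e \<Rightarrow> real"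

definition ext_deriv :: "('m, 'e::finite_dim_inner) atlas \<Rightarrow> ('m, 'e) form1 \<Rightarrow> ('m, 'e) form2" where
  "ext_deriv A \<theta> p u v =
     (let c = chart_at A p;
          \<theta>c = (\<lambda>w x. \<theta> (chart_inv c x) (from_chart A c (chart_inv c x) w))
      in frechet_derivative (\<theta>c v) (at (snd c p)) u - frechet_derivative (\<theta>c u) (at (snd c p)) v)"

definition induced_form ::
    "('m, 'e::finite_dim_inner) atlas \<Rightarrow> 'm set \<Rightarrow> ('m, 'e) form2 \<Rightarrow> ('m, 'e) form2" where
  "induced_form A S \<omega> p u v =
     (if p \<in> S \<and> u \<in> tangent_space A S p \<and> v \<in> tangent_space A S p then \<omega> p u v else 0)"

definition kernel_form ::
    "('m, 'e::finite_dim_inner) atlas \<Rightarrow> 'm set \<Rightarrow> ('m, 'e) form2 \<Rightarrow> 'm \<Rightarrow> 'e set" where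
  "kernel_form A S \<beta> p = {u \<in> tangent_space A S p. \<forall>v\<in>tangent_space A S p. \<beta> p u v = 0}"

text \<open>
  Closedness of a 2-form \<open>\<beta>\<close> on a submanifold \<open>S\<close>: in the coordinates of \<open>S\<close> given by a slice
  chart with subspace \<open>V\<close>, the components of the exterior derivative vanish. Only the values of
  \<open>\<beta>\<close> on \<open>S\<close> enter, since the derivatives are taken in the directions of \<open>V\<close>.
\<close>

definition closed_form_on ::
    "('m, 'e::finite_dim_inner) atlas \<Rightarrow> 'm set \<Rightarrow> ('m, 'e) form2 \<Rightarrow> bool" where
  "closed_form_on A S \<beta> \<longleftrightarrow>
     (\<forall>c V. slice_chart A S c V \<longrightarrow>
        (let \<beta>c = (\<lambda>x v w. \<beta> (chart_inv c x) (from_chart A c (chart_inv c x) v)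
                                (from_chart A c (chart_inv c x) w))
         in \<forall>x\<in>snd c ` fst c \<inter> V. \<forall>u\<in>V. \<forall>v\<in>V. \<forall>w\<in>V. \<exists>a1 a2 a3.
              ((\<lambda>t. \<beta>c (x + t *\<^sub>R u) v w) has_real_derivative a1) (at 0) \<and>
              ((\<lambda>t. \<beta>c (x + t *\<^sub>R v) w u) has_real_derivative a2) (at 0) \<and>
              ((\<lambda>t. \<beta>c (x + t *\<^sub>R w) u v) has_real_derivative a3) (at 0) \<and>
              a1 + a2 + a3 = 0))"

definition isotropic_submanifold ::
    "('m, 'e::finite_dim_inner) atlas \<Rightarrow> ('m, 'e) form2 \<Rightarrow> 'm set \<Rightarrow> bool" where
  "isotropic_submanifold A \<omega> S \<longleftrightarrow>
     smooth_submanifold A S \<and>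
     (\<forall>p\<in>S. \<forall>u\<in>tangent_space A S p. \<forall>v\<in>tangent_space A S p. \<omega> p u v = 0)"


section \<open>The cotangent bundle\<close>

definition cotangent_bundle :: "('m, 'e::finite_dim_inner) atlas \<Rightarrow> ('m \<times> ('e \<Rightarrow> real)) set" where
  "cotangent_bundle A = {(p, \<alpha>). p \<in> points A \<and> linear \<alpha>}"

abbreviation cotangent_proj :: "'m \<times> ('e \<Rightarrow> real) \<Rightarrow> 'm" where
  "cotangent_proj \<equiv> fst"

text \<open>
  A chart \<open>(D, \<phi>)\<close> induces the chart of the cotangent bundle which maps a covector at \<open>p\<close> to
  \<open>\<phi> p\<close> and its coordinate expression, a linear form on the model space. The latter is
  represented by a vector through the inner product: \<open>adjoint \<lambda> 1\<close> is the vector \<open>y\<close> with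
  \<open>\<lambda> v = v \<bullet> y\<close> for all \<open>v\<close>.
\<close>

definition cotangent_chart ::
    "('m, 'e::finite_dim_inner) atlas \<Rightarrow> ('m, 'e) chart \<Rightarrow> ('m \<times> ('e \<Rightarrow> real), 'e \<times> 'e) chart" where
  "cotangent_chart A c =
     ({\<zeta> \<in> cotangent_bundle A. fst \<zeta> \<in> fst c},
      \<lambda>\<zeta>. (snd c (fst \<zeta>), adjoint (snd \<zeta> \<circ> from_chart A c (fst \<zeta>)) 1))"

definition cotangent_atlas ::
    "('m, 'e::finite_dim_inner) atlas \<Rightarrow> ('m \<times> ('e \<Rightarrow> real), 'e \<times> 'e) atlas" where
  "cotangent_atlas A = cotangent_chart A ` A"

text \<open>
  The transpose of the tangent map of a bijection \<open>f\<close> of the manifold onto itself: it maps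
  covectors at \<open>f y\<close> to covectors at \<open>y\<close>.
\<close>

definition cotangent_transpose ::
    "('m, 'e::finite_dim_inner) atlas \<Rightarrow> ('m \<Rightarrow> 'm) \<Rightarrow> 'm \<times> ('e \<Rightarrow> real) \<Rightarrow> 'm \<times> ('e \<Rightarrow> real)" where
  "cotangent_transpose A f \<zeta> =
     (let y = inv_into (points A) f (fst \<zeta>) in (y, snd \<zeta> \<circ> tangent_map A A f y))"

definition liouville_form ::
    "('m, 'e::finite_dim_inner) atlas \<Rightarrow> ('m \<times> ('e \<Rightarrow> real), 'e \<times> 'e) form1" where
  "liouville_form A \<zeta> w = snd \<zeta> (tangent_map (cotangent_atlas A) A cotangent_proj \<zeta> w)"

definition canonical_form ::
    "('m, 'e::finite_dim_inner) atlas \<Rightarrow> ('m \<times> ('e \<Rightarrow> real), 'e \<times> 'e) form2" where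
  "canonical_form A = ext_deriv (cotangent_atlas A) (liouville_form A)"


section \<open>Lie groups\<close>

definition lie_group :: "('g, 'z) monoid_scheme \<Rightarrow> ('g, 'e::finite_dim_inner) atlas \<Rightarrow> bool" where
  "lie_group G A \<longleftrightarrow>
     group G \<and> smooth_manifold A \<and> points A = carrier G \<and>
     smooth_map (prod_atlas A A) A (\<lambda>(x, y). x \<otimes>\<^bsub>G\<^esub> y) \<and>
     smooth_map A A (\<lambda>x. inv\<^bsub>G\<^esub> x)"

definition left_transl :: "('g, 'z) monoid_scheme \<Rightarrow> 'g \<Rightarrow> 'g \<Rightarrow> 'g" where
  "left_transl G g x = g \<otimes>\<^bsub>G\<^esub> x"

definition right_transl :: "('g, 'z) monoid_scheme \<Rightarrow> 'g \<Rightarrow> 'g \<Rightarrow> 'g" where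
  "right_transl G g x = x \<otimes>\<^bsub>G\<^esub> g"

definition lift_left ::
    "('g, 'z) monoid_scheme \<Rightarrow> ('g, 'e::finite_dim_inner) atlas \<Rightarrow>
     'g \<Rightarrow> 'g \<times> ('e \<Rightarrow> real) \<Rightarrow> 'g \<times> ('e \<Rightarrow> real)" where
  "lift_left G A g \<zeta> = cotangent_transpose A (left_transl G (inv\<^bsub>G\<^esub> g)) \<zeta>"

definition lift_right ::
    "('g, 'z) monoid_scheme \<Rightarrow> ('g, 'e::finite_dim_inner) atlas \<Rightarrow>
     'g \<times> ('e \<Rightarrow> real) \<Rightarrow> 'g \<Rightarrow> 'g \<times> ('e \<Rightarrow> real)" where
  "lift_right G A \<zeta> g = cotangent_transpose A (right_transl G (inv\<^bsub>G\<^esub> g)) \<zeta>"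

text \<open>
  The Lie algebra is the tangent space at the unit element, hence the model space, and its dual
  consists of the linear forms on the model space. For a covector \<open>\<zeta>\<close> at \<open>x\<close>, the transposes
  below are covectors at the unit element, of which only the linear form is retained.
\<close>

definition momentum_left ::
    "('g, 'z) monoid_scheme \<Rightarrow> ('g, 'e::finite_dim_inner) atlas \<Rightarrow> 'g \<times> ('e \<Rightarrow> real) \<Rightarrow> 'e \<Rightarrow> real" where
  "momentum_left G A \<zeta> = snd (cotangent_transpose A (right_transl G (cotangent_proj \<zeta>)) \<zeta>)"

definition momentum_right ::
    "('g, 'z) monoid_scheme \<Rightarrow> ('g, 'e::finite_dim_inner) atlas \<Rightarrow> 'g \<times> ('e \<Rightarrow> real) \<Rightarrow> 'e \<Rightarrow> real" where
  "momentum_right G A \<zeta> = snd (cotangent_transpose A (left_transl G (cotangent_proj \<zeta>)) \<zeta>)"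

definition Ad :: "('g, 'z) monoid_scheme \<Rightarrow> ('g, 'e::finite_dim_inner) atlas \<Rightarrow> 'g \<Rightarrow> 'e \<Rightarrow> 'e" where
  "Ad G A g = tangent_map A A (\<lambda>x. g \<otimes>\<^bsub>G\<^esub> x \<otimes>\<^bsub>G\<^esub> inv\<^bsub>G\<^esub> g) \<one>\<^bsub>G\<^esub>"

definition coadjoint ::
    "('g, 'z) monoid_scheme \<Rightarrow> ('g, 'e::finite_dim_inner) atlas \<Rightarrow> 'g \<Rightarrow> ('e \<Rightarrow> real) \<Rightarrow> 'e \<Rightarrow> real" where
  "coadjoint G A g \<xi> = \<xi> \<circ> Ad G A (inv\<^bsub>G\<^esub> g)"

end

theory Submission
  imports Defs
begin

text \<open>
  Left trivialisation identifies a fibre of the right momentum map with the graph of a left-invariant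
  1-form, that is, with an orbit of the lifted left translations; the opposite group gives the same
  for the left momentum map and right-invariant 1-forms. On such a graph the other momentum map is
  equivariant for the coadjoint action, hence has constant rank, so its level sets, the
  intersections of the fibres, are submanifolds whose tangent space is the kernel of its derivative.

  If a left-invariant and a right-invariant 1-form with coordinate expressions \<open>s\<close> and \<open>t\<close> agree at \<open>g0\<close>,
  then differentiating their invariance along \<open>(g, h) \<mapsto> g \<otimes> inv g0 \<otimes> h\<close> in the other variable yields
  \<open>Ds a \<bullet> b = Dt b \<bullet> a\<close> by the symmetry of the mixed second derivative. So the tangent spaces of the
  two graphs are symplectically orthogonal, and the form induced on one graph pairs the directions \<open>a\<close>
  and \<open>b\<close> to \<open>(Ds a - Dt a) \<bullet> b\<close>: its kernel is the tangent space of the intersection. Closedness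
  holds because cotangent charts are Darboux charts.
\<close>

section \<open>Calculus on finite-dimensional inner product spaces\<close>

text \<open>The intersection cannot be obtained from a regular value: the rank of the left momentum
  map along a left-invariant form may be smaller than the dimension of the group, and it is zero for
  an abelian group. Equivariance supplies injective linear maps between the kernels at different
  points, and constancy of the rank enters only in this form.

  Tangent vectors are vectors of the model space read in a preferred chart that varies with the
  point without any continuity. Derivatives are therefore compared in one fixed chart, and
  \<open>from_chart\<close> translates the result.

  The model class includes dimension 0 and carries no distinguished basis. A chosen orthonormal
  basis \<open>onb\<close> replaces it; expansion over \<open>onb\<close> reduces smoothness of
  families of linear maps to smoothness of finitely many vector-valued functions.\<close>

definition onb :: "'a::finite_dim_inner set" where
  "onb = (SOME B. finite B \<and> pairwise orthogonal B \<and> (\<forall>b\<in>B. norm b = 1) \<and> span B = UNIV)"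

section \<open>Orthonormal bases, finite dimension and completeness\<close>

lemma onb_properties:
  "finite (onb::'a::finite_dim_inner set) \<and> pairwise orthogonal (onb::'a set) \<and>
   (\<forall>b\<in>onb::'a set. norm b = 1) \<and> span (onb::'a set) = UNIV"
proof -
  obtain B :: "'a set" where B: "finite B" "\<forall>x. \<exists>c. x = (\<Sum>b\<in>B. c b *\<^sub>R b)"
    using finite_dim by blast
  have spB: "span B = UNIV"
  proof -
    have "x \<in> span B" for x
    proof -
      obtain c where "x = (\<Sum>b\<in>B. c b *\<^sub>R b)"
        using B(2) by blast
      then show ?thesis
        by (simp add: span_sum span_scale span_base)
    qed
    then show ?thesis
      by blast
  qed
  obtain C where C: "finite C" "span C = span B" "pairwise orthogonal C"
    using basis_orthogonal[OF B(1)] by blast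
  \<comment> \<open>Orthogonalisation may leave the zero vector in \<open>C\<close>; it is discarded
    before the other vectors are normalised, and the span does not change.\<close>
  define D where "D = (\<lambda>x. x /\<^sub>R norm x) ` (C - {0})"
  have "x \<in> span D" if "x \<in> C" for x
  proof (cases "x = 0")
    case False
    then have "x /\<^sub>R norm x \<in> span D"
      using that by (auto simp: D_def intro: span_base)
    from span_scale[OF this, of "norm x"] False show ?thesis by simp
  qed (simp add: span_zero)
  then have "span C \<subseteq> span D"
    by (meson span_minimal subsetI subspace_span)
  then have "span D = UNIV"
    using C(2) spB by auto
  moreover have "pairwise orthogonal D"
    using C(3) by (auto simp: D_def pairwise_def orthogonal_def)
  moreover have "finite D" "\<forall>b\<in>D. norm b = 1"
    using C(1) by (auto simp: D_def)
  ultimately have "\<exists>D::'a set. finite D \<and> pairwise orthogonal D \<and> (\<forall>b\<in>D. norm b = 1) \<and> span D = UNIV"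
    by blast
  then show ?thesis
    unfolding onb_def by (rule someI_ex)
qed

lemma finite_onb [simp]: "finite onb"
  using onb_properties by blast

lemma onb_inner:
  fixes a b :: "'a::finite_dim_inner"
  shows "a \<in> onb \<Longrightarrow> b \<in> onb \<Longrightarrow> a \<bullet> b = (if a = b then 1 else 0)"
  using onb_properties[where 'a = 'a] by (metis norm_eq_1 orthogonal_def pairwise_def)

lemma span_onb: "span onb = UNIV" and norm_onb: "b \<in> onb \<Longrightarrow> norm b = 1"
  using onb_properties by blast+

lemma onb_expand:
  fixes x :: "'a::finite_dim_inner"
  shows "(\<Sum>b\<in>onb. (x \<bullet> b) *\<^sub>R b) = x"
proof -
  obtain c where c: "x = (\<Sum>b\<in>onb. c b *\<^sub>R b)"
  proof -
    have "x \<in> range (\<lambda>u. \<Sum>b\<in>onb. u b *\<^sub>R b)"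
      using span_finite[OF finite_onb] span_onb by (metis UNIV_I)
    then show ?thesis
      using that by blast
  qed
  have "x \<bullet> b = c b" if "b \<in> onb" for b
    unfolding c inner_sum_left using that by (simp add: onb_inner if_distrib cong: if_cong)
  then show ?thesis
    using c by simp
qed

text \<open>Opens the abstract theory of dimension to the model class. Orthogonal nonzero vectors
  are independent; in dimension 0 the basis is empty.\<close>

lemma fd_space: "finite_dimensional_vector_space (*\<^sub>R) (onb::'a::finite_dim_inner set)"
proof -
  have "0 \<notin> (onb::'a set)"
    using norm_onb by force
  then have "independent (onb::'a set)"
    using onb_properties[where 'a = 'a] by (intro pairwise_orthogonal_independent) auto
  then show ?thesis
    using span_onb[where 'a = 'a] unfolding dependent_raw_def span_raw_def by unfold_locales auto
qed

lemma linear_onb_expand: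
  assumes "linear f"
  shows "f x = (\<Sum>b\<in>onb. (x \<bullet> b) *\<^sub>R f b)"
proof -
  have "f x = f (\<Sum>b\<in>onb. (x \<bullet> b) *\<^sub>R b)"
    by (simp add: onb_expand)
  also have "\<dots> = (\<Sum>b\<in>onb. (x \<bullet> b) *\<^sub>R f b)"
    by (simp add: linear_sum[OF assms] linear_scale[OF assms])
  finally show ?thesis .
qed

lemma linear_imp_bounded_linear:
  fixes f :: "'a::finite_dim_inner \<Rightarrow> 'b::real_normed_vector"
  assumes "linear f"
  shows "bounded_linear f"
proof (rule bounded_linear_intro)
  show "f (x + y) = f x + f y" "f (r *\<^sub>R x) = r *\<^sub>R f x" for x y r
    by (simp_all add: linear_add[OF assms] linear_scale[OF assms])
  show "norm (f x) \<le> norm x * (\<Sum>b\<in>onb. norm (f b))" for x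
  proof -
    have "norm (f x) \<le> (\<Sum>b\<in>onb. \<bar>x \<bullet> b\<bar> * norm (f b))"
      by (subst linear_onb_expand[OF assms]) (auto intro!: sum_norm_le)
    also have "\<dots> \<le> (\<Sum>b\<in>onb. norm x * norm (f b))"
      by (intro sum_mono mult_right_mono) (metis Cauchy_Schwarz_ineq2 mult.right_neutral norm_onb, simp)
    finally show ?thesis
      by (simp add: sum_distrib_left)
  qed
qed

lemma linear_inj_imp_surj_fd:
  fixes f :: "'a::finite_dim_inner \<Rightarrow> 'a"
  assumes "linear f" "inj f"
  shows "surj f"
proof -
  interpret finite_dimensional_vector_space "(*\<^sub>R)" "onb::'a set"
    by (rule fd_space)
  show ?thesis
    using linear_inj_imp_surj assms unfolding linear_def by blast
qed

lemma dim_image_eq_fd: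
  fixes f :: "'a::finite_dim_inner \<Rightarrow> 'b::finite_dim_inner"
  assumes "linear f" "inj f"
  shows "dim (f ` S) = dim S"
proof -
  interpret finite_dimensional_vector_space_pair_1 "(*\<^sub>R)" "onb::'a set" "(*\<^sub>R) :: real \<Rightarrow> 'b \<Rightarrow> 'b"
    using fd_space[where 'a = 'a] real_vector.vector_space_axioms
    by (simp add: finite_dimensional_vector_space_pair_1_def)
  show ?thesis
    using dim_image_eq[of f S] assms unfolding linear_def dim_raw_def by (meson inj_on_subset subset_UNIV)
qed

text \<open>For the contraction argument behind the inverse function theorem. Each coordinate of a
  Cauchy sequence converges in the reals, and finitely many coordinates determine a vector.\<close>

lemma complete_UNIV_fd: "complete (UNIV :: 'a::finite_dim_inner set)"
  unfolding complete_def
proof (intro allI impI, elim conjE)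
  fix X :: "nat \<Rightarrow> 'a"
  assume "Cauchy X"
  have "convergent (\<lambda>n. X n \<bullet> b)" for b
    using bounded_linear.Cauchy[OF bounded_linear_inner_left \<open>Cauchy X\<close>]
    by (simp add: Cauchy_convergent_iff)
  then obtain l where "\<And>b. (\<lambda>n. X n \<bullet> b) \<longlonglongrightarrow> l b"
    unfolding convergent_def by metis
  then have "(\<lambda>n. \<Sum>b\<in>onb. (X n \<bullet> b) *\<^sub>R b) \<longlonglongrightarrow> (\<Sum>b\<in>onb. l b *\<^sub>R b)"
    by (intro tendsto_intros)
  then show "\<exists>l\<in>UNIV. X \<longlonglongrightarrow> l"
    by (auto simp: onb_expand)
qed

text \<open>The Riesz representative of a linear form, in the encoding used by the charts of the cotangent bundle.\<close>

abbreviation covec :: "('a::finite_dim_inner \<Rightarrow> real) \<Rightarrow> 'a" where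
  "covec \<alpha> \<equiv> adjoint \<alpha> 1"

text \<open>\<open>adjoint\<close> is defined by a choice, so one adjoint has to be exhibited: the
  vector with the coordinates \<open>\<alpha> b\<close>, scaled by the argument.\<close>

lemma adjoint_works_fd:
  fixes \<alpha> :: "'a::finite_dim_inner \<Rightarrow> real"
  assumes "linear \<alpha>"
  shows "\<alpha> x \<bullet> y = x \<bullet> adjoint \<alpha> y"
proof -
  have "\<forall>x y. \<alpha> x \<bullet> y = x \<bullet> (y *\<^sub>R (\<Sum>b\<in>onb. \<alpha> b *\<^sub>R b))"
    by (subst linear_onb_expand[OF assms]) (simp add: inner_sum_right sum_distrib_left sum_distrib_right ac_simps)
  then have "\<exists>f'. \<forall>x y. \<alpha> x \<bullet> y = x \<bullet> f' y"
    by (intro exI[where x = "\<lambda>y. y *\<^sub>R (\<Sum>b\<in>onb. \<alpha> b *\<^sub>R b)"])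
  then show ?thesis
    unfolding adjoint_def by (rule someI2_ex) blast
qed

lemma inner_covec: "linear \<alpha> \<Longrightarrow> x \<bullet> covec \<alpha> = \<alpha> x"
  using adjoint_works_fd[of \<alpha> x 1] by simp

lemma covec_eqI: "(\<And>v. \<alpha> v = v \<bullet> y) \<Longrightarrow> covec \<alpha> = y"
proof -
  assume *: "\<And>v. \<alpha> v = v \<bullet> y"
  then have "linear \<alpha>"
    by (metis ext bounded_linear.linear bounded_linear_inner_left)
  then show ?thesis
    using * inner_covec by (metis vector_eq_ldot)
qed

text \<open>Replaces the choice hidden in \<open>adjoint\<close> by a finite sum, from which smooth
  dependence of a covector on parameters can be read off.\<close>

lemma covec_onb: "linear \<alpha> \<Longrightarrow> covec \<alpha> = (\<Sum>b\<in>onb. \<alpha> b *\<^sub>R b)"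
  by (rule covec_eqI, subst linear_onb_expand[of \<alpha>])
    (auto simp: inner_sum_right intro!: sum.cong)

subsection \<open>Functions of class \<open>C\<close> to the \<open>n\<close>\<close>

lemma has_derivative_cong_open:
  assumes "open S" "x \<in> S" "\<And>x. x \<in> S \<Longrightarrow> f x = g x"
  shows "(f has_derivative D) (at x) \<longleftrightarrow> (g has_derivative D) (at x)"
  using has_derivative_transform_within_open[of f D x UNIV S g]
    has_derivative_transform_within_open[of g D x UNIV S f] assms by auto

lemma frechet_derivative_cong_open:
  assumes "open S" "x \<in> S" "\<And>x. x \<in> S \<Longrightarrow> f x = g x"
  shows "frechet_derivative f (at x) = frechet_derivative g (at x)"
  unfolding frechet_derivative_def using has_derivative_cong_open[OF assms] by simp

lemma Ck_on_cong:
  assumes "open S" "\<And>x. x \<in> S \<Longrightarrow> f x = g x" "Ck_on n f S"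
  shows "Ck_on n g S"
  using assms(2,3)
proof (induction n arbitrary: f g)
  case 0
  then show ?case
    by (auto cong: continuous_on_cong)
next
  case (Suc n)
  have "g differentiable (at x)" if "x \<in> S" for x
  proof -
    have "f differentiable (at x)"
      using Suc.prems(2) that by simp
    then show ?thesis
      using has_derivative_cong_open[OF assms(1) that, of f g] Suc.prems(1) unfolding differentiable_def by blast
  qed
  moreover have "Ck_on n (\<lambda>x. frechet_derivative g (at x) v) S" for v
  proof (rule Suc.IH[of "\<lambda>x. frechet_derivative f (at x) v"])
    show "frechet_derivative f (at x) v = frechet_derivative g (at x) v" if "x \<in> S" for x
      using frechet_derivative_cong_open[OF assms(1) that, of f g] Suc.prems(1) by simp
  qed (use Suc.prems in auto)
  ultimately show ?case
    by simp
qed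

lemma Ck_on_subset: "Ck_on n f S \<Longrightarrow> T \<subseteq> S \<Longrightarrow> Ck_on n f T"
  by (induction n arbitrary: f) (auto intro: continuous_on_subset)

lemma Ck_on_has_derivative:
  "Ck_on (Suc n) f S \<Longrightarrow> x \<in> S \<Longrightarrow> (f has_derivative frechet_derivative f (at x)) (at x)"
  using frechet_derivative_works by auto

text \<open>\<open>Ck_on\<close> refers to the chosen term \<open>frechet_derivative\<close>; on an
  open set any explicit formula for the derivative serves as well, and the closure properties below
  are proved from such formulas.\<close>

lemma Ck_on_SucI:
  assumes "open S" "\<And>x. x \<in> S \<Longrightarrow> (f has_derivative f' x) (at x)"
    "\<And>v. Ck_on n (\<lambda>x. f' x v) S"
  shows "Ck_on (Suc n) f S"
proof -
  have "Ck_on n (\<lambda>x. frechet_derivative f (at x) v) S" for v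
    using frechet_derivative_at[OF assms(2)]
    by (intro Ck_on_cong[OF assms(1) _ assms(3)[of v]]) (metis)
  then show ?thesis
    using assms(2) by (auto simp: differentiable_def)
qed

lemma Ck_on_Suc_imp_Ck_on: "Ck_on (Suc n) f S \<Longrightarrow> Ck_on n f S"
proof (induction n arbitrary: f)
  case 0
  then show ?case
    by (auto intro!: continuous_at_imp_continuous_on differentiable_imp_continuous_within)
next
  case (Suc n)
  then show ?case by auto
qed

lemma Ck_on_const: "Ck_on n (\<lambda>x. c) S"
  by (induction n arbitrary: c) auto

lemma Ck_on_linear:
  fixes f :: "'a::finite_dim_inner \<Rightarrow> 'b::real_normed_vector"
  assumes "linear f"
  shows "Ck_on n f S"
proof -
  have "Ck_on n f UNIV"
  proof (cases n)
    case 0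
    then show ?thesis
      by (simp add: linear_imp_bounded_linear[OF assms] linear_continuous_on)
  next
    case (Suc m)
    then show ?thesis
      using linear_imp_bounded_linear[OF assms]
      by (auto intro!: Ck_on_SucI[where f' = "\<lambda>_. f"] bounded_linear_imp_has_derivative Ck_on_const
        simp del: Ck_on.simps)
  qed
  then show ?thesis
    by (rule Ck_on_subset) simp
qed

lemma Ck_on_add:
  assumes "open S" "Ck_on n f S" "Ck_on n g S"
  shows "Ck_on n (\<lambda>x. f x + g x) S"
  using assms(2,3)
proof (induction n arbitrary: f g)
  case (Suc n)
  show ?case
  proof (rule Ck_on_SucI[OF assms(1)])
    show "((\<lambda>x. f x + g x) has_derivative
        (\<lambda>v. frechet_derivative f (at x) v + frechet_derivative g (at x) v)) (at x)" if "x \<in> S" for x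
      using Suc.prems that by (intro has_derivative_add Ck_on_has_derivative)
  qed (use Suc in auto)
qed (auto intro: continuous_intros)

lemma Ck_on_sum:
  assumes "open S" "\<And>i. i \<in> I \<Longrightarrow> Ck_on n (f i) S"
  shows "Ck_on n (\<lambda>x. \<Sum>i\<in>I. f i x) S"
  using assms(2)
  by (induction I rule: infinite_finite_induct) (auto intro: Ck_on_const Ck_on_add[OF assms(1)])

lemma Ck_on_bilinear:
  assumes "open S" "bounded_bilinear h" "Ck_on n f S" "Ck_on n g S"
  shows "Ck_on n (\<lambda>x. h (f x) (g x)) S"
  using assms(3,4)
proof (induction n arbitrary: f g)
  case 0
  then show ?case
    by (simp add: bounded_bilinear.continuous_on[OF assms(2)])
next
  case (Suc n)
  show ?case
  proof (rule Ck_on_SucI[OF assms(1)])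
    show "((\<lambda>x. h (f x) (g x)) has_derivative
        (\<lambda>v. h (f x) (frechet_derivative g (at x) v) + h (frechet_derivative f (at x) v) (g x))) (at x)"
      if "x \<in> S" for x
      using Suc.prems that by (intro bounded_bilinear.FDERIV[OF assms(2)] Ck_on_has_derivative)
    have "Ck_on n f S" "Ck_on n g S"
      using Suc.prems Ck_on_Suc_imp_Ck_on by blast+
    then show "Ck_on n (\<lambda>x. h (f x) (frechet_derivative g (at x) v) + h (frechet_derivative f (at x) v) (g x)) S" for v
      using Suc.prems by (intro Ck_on_add assms(1) Suc.IH) simp_all
  qed
qed

text \<open>The derivative of the composition depends on the point twice, through the base point of
  the outer derivative and through its argument. Expansion over \<open>onb\<close> separates the
  two: the argument contributes scalar coefficients, and the induction hypothesis, stated for all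
  \<open>g\<close>, applies to each directional derivative of the outer map.\<close>

lemma Ck_on_compose:
  fixes f :: "'a::real_normed_vector \<Rightarrow> 'b::finite_dim_inner" and g :: "'b \<Rightarrow> 'c::real_normed_vector"
  assumes "open S" "open T" "f ` S \<subseteq> T" "Ck_on n f S" "Ck_on n g T"
  shows "Ck_on n (\<lambda>x. g (f x)) S"
  using assms(4,5)
proof (induction n arbitrary: g)
  case 0
  then show ?case
    using assms(3) continuous_on_compose2 by auto
next
  case (Suc n)
  show ?case
  proof (rule Ck_on_SucI[OF assms(1)])
    fix x assume x: "x \<in> S"
    then have g: "(g has_derivative frechet_derivative g (at (f x))) (at (f x))"
      using Suc.prems assms(3) by (intro Ck_on_has_derivative) auto
    have f: "(f has_derivative frechet_derivative f (at x)) (at x)"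
      using Suc.prems x by (intro Ck_on_has_derivative)
    have "((\<lambda>x. g (f x)) has_derivative
        (\<lambda>v. frechet_derivative g (at (f x)) (frechet_derivative f (at x) v))) (at x)"
      by (rule has_derivative_compose[OF f g])
    moreover have "linear (frechet_derivative g (at (f x)))"
      using g has_derivative_linear by blast
    ultimately show "((\<lambda>x. g (f x)) has_derivative
        (\<lambda>v. \<Sum>b\<in>onb. (frechet_derivative f (at x) v \<bullet> b) *\<^sub>R frechet_derivative g (at (f x)) b)) (at x)"
      by (subst (asm) linear_onb_expand) auto
  next
    fix v
    have "Ck_on n (\<lambda>x. frechet_derivative f (at x) v \<bullet> b) S" for b
      using Suc.prems by (intro Ck_on_bilinear[OF assms(1) bounded_bilinear_inner] Ck_on_const) auto
    moreover have "Ck_on n (\<lambda>x. frechet_derivative g (at (f x)) b) S" for b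
    proof (rule Suc.IH[of "\<lambda>y. frechet_derivative g (at y) b"])
      show "Ck_on n f S"
        using Suc.prems Ck_on_Suc_imp_Ck_on by blast
      show "Ck_on n (\<lambda>y. frechet_derivative g (at y) b) T"
        using Suc.prems by simp
    qed
    ultimately show "Ck_on n (\<lambda>x. \<Sum>b\<in>onb. (frechet_derivative f (at x) v \<bullet> b) *\<^sub>R
        frechet_derivative g (at (f x)) b) S"
      by (intro Ck_on_sum Ck_on_bilinear[OF assms(1) bounded_bilinear_scaleR] assms(1))
  qed
qed

lemma Ck_on_local:
  assumes "\<And>x. x \<in> S \<Longrightarrow> \<exists>U. open U \<and> x \<in> U \<and> Ck_on n f U"
  shows "Ck_on n f S"
  using assms
proof (induction n arbitrary: f)
  case 0
  then have "isCont f x" if "x \<in> S" for x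
    using that by (metis Ck_on.simps(1) continuous_on_eq_continuous_at)
  then show ?case
    by (simp add: continuous_at_imp_continuous_on)
next
  case (Suc n)
  have "Ck_on n (\<lambda>x. frechet_derivative f (at x) v) S" for v
    using Suc by (metis Ck_on.simps(2))
  moreover have "f differentiable (at x)" if "x \<in> S" for x
    using Suc.prems that by (metis Ck_on.simps(2))
  ultimately show ?case
    by simp
qed

subsection \<open>Smooth functions\<close>

named_theorems smooth_intros

lemma smooth_onI: "(\<And>n. Ck_on n f S) \<Longrightarrow> smooth_on S f"
  by (simp add: smooth_on_def)

lemma smooth_onD: "smooth_on S f \<Longrightarrow> Ck_on n f S"
  by (simp add: smooth_on_def)

lemma smooth_on_cong: "open S \<Longrightarrow> (\<And>x. x \<in> S \<Longrightarrow> f x = g x) \<Longrightarrow> smooth_on S f \<Longrightarrow> smooth_on S g"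
  unfolding smooth_on_def using Ck_on_cong by blast

lemma smooth_on_subset: "smooth_on S f \<Longrightarrow> T \<subseteq> S \<Longrightarrow> smooth_on T f"
  unfolding smooth_on_def using Ck_on_subset by blast

lemma smooth_on_local:
  assumes "\<And>x. x \<in> S \<Longrightarrow> \<exists>U. open U \<and> x \<in> U \<and> smooth_on U f"
  shows "smooth_on S f"
  using assms Ck_on_local unfolding smooth_on_def by metis

lemma smooth_on_const [smooth_intros]: "smooth_on S (\<lambda>x. c)"
  by (simp add: smooth_on_def Ck_on_const)

lemma smooth_on_linear: "linear f \<Longrightarrow> smooth_on S f"
  by (simp add: smooth_on_def Ck_on_linear)

lemma smooth_on_ident [smooth_intros]: "smooth_on S (\<lambda>x. x)"
  by (rule smooth_on_linear) (simp add: linear_iff)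

lemma smooth_on_compose:
  "open S \<Longrightarrow> open T \<Longrightarrow> f ` S \<subseteq> T \<Longrightarrow> smooth_on S f \<Longrightarrow> smooth_on T g \<Longrightarrow> smooth_on S (\<lambda>x. g (f x))"
  unfolding smooth_on_def using Ck_on_compose by blast

lemma smooth_on_linear_compose:
  "linear h \<Longrightarrow> open S \<Longrightarrow> smooth_on S f \<Longrightarrow> smooth_on S (\<lambda>x. h (f x))"
  using smooth_on_compose[of S UNIV f h] smooth_on_linear by auto

lemma smooth_on_bilinear:
  "bounded_bilinear h \<Longrightarrow> open S \<Longrightarrow> smooth_on S f \<Longrightarrow> smooth_on S g \<Longrightarrow> smooth_on S (\<lambda>x. h (f x) (g x))"
  unfolding smooth_on_def using Ck_on_bilinear by blast

lemmas smooth_on_inner [smooth_intros] = smooth_on_bilinear[OF bounded_bilinear_inner]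
lemmas smooth_on_scaleR [smooth_intros] = smooth_on_bilinear[OF bounded_bilinear_scaleR]

lemma smooth_on_add [smooth_intros]:
  "open S \<Longrightarrow> smooth_on S f \<Longrightarrow> smooth_on S g \<Longrightarrow> smooth_on S (\<lambda>x. f x + g x)"
  unfolding smooth_on_def using Ck_on_add by blast

lemma smooth_on_diff [smooth_intros]:
  "open S \<Longrightarrow> smooth_on S f \<Longrightarrow> smooth_on S g \<Longrightarrow> smooth_on S (\<lambda>x. f x - g x)"
  using smooth_on_add[of S f "\<lambda>x. - g x"] smooth_on_linear_compose[of uminus S g]
  by (auto simp: linear_iff)

lemma smooth_on_sum [smooth_intros]:
  "open S \<Longrightarrow> (\<And>i. i \<in> I \<Longrightarrow> smooth_on S (f i)) \<Longrightarrow> smooth_on S (\<lambda>x. \<Sum>i\<in>I. f i x)"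
  by (intro smooth_onI Ck_on_sum) (simp_all add: smooth_onD)

lemma smooth_on_Pair [smooth_intros]:
  fixes f :: "'a::finite_dim_inner \<Rightarrow> 'b::finite_dim_inner" and g :: "'a \<Rightarrow> 'c::finite_dim_inner"
  assumes "open S" "smooth_on S f" "smooth_on S g"
  shows "smooth_on S (\<lambda>x. (f x, g x))"
proof -
  have "smooth_on S (\<lambda>x. (f x, 0 :: 'c))" "smooth_on S (\<lambda>x. (0 :: 'b, g x))"
    using smooth_on_linear_compose[OF _ assms(1,2), of "\<lambda>a. (a, 0)"]
      smooth_on_linear_compose[OF _ assms(1,3), of "\<lambda>a. (0, a)"] by (auto simp: linear_iff)
  from smooth_on_add[OF assms(1) this] show ?thesis
    by simp
qed

lemma smooth_on_has_derivative:
  "smooth_on S f \<Longrightarrow> x \<in> S \<Longrightarrow> (f has_derivative frechet_derivative f (at x)) (at x)"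
  unfolding smooth_on_def using Ck_on_has_derivative by blast

lemma smooth_on_imp_continuous_on: "smooth_on S f \<Longrightarrow> continuous_on S f"
  using smooth_onD[of S f 0] by simp

lemma smooth_on_frechet_linear: "smooth_on S f \<Longrightarrow> x \<in> S \<Longrightarrow> linear (frechet_derivative f (at x))"
  using smooth_on_has_derivative has_derivative_linear by blast

lemma smooth_on_frechet_derivative: "smooth_on S f \<Longrightarrow> smooth_on S (\<lambda>x. frechet_derivative f (at x) v)"
  unfolding smooth_on_def using Ck_on.simps(2) by blast

text \<open>Differentiation preserves smoothness for a fixed direction; a direction that moves with
  the point is expanded over \<open>onb\<close>.\<close>

lemma smooth_on_frechet_apply [smooth_intros]:
  assumes "open S" "open T" "f ` S \<subseteq> T" "smooth_on T h" "smooth_on S f" "smooth_on S w"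
  shows "smooth_on S (\<lambda>x. frechet_derivative h (at (f x)) (w x))"
proof (rule smooth_on_cong[OF assms(1)])
  show "smooth_on S (\<lambda>x. \<Sum>b\<in>onb. (w x \<bullet> b) *\<^sub>R frechet_derivative h (at (f x)) b)"
    using smooth_on_compose[OF assms(1-3,5) smooth_on_frechet_derivative[OF assms(4)]] assms
    by (intro smooth_intros)
  show "(\<Sum>b\<in>onb. (w x \<bullet> b) *\<^sub>R frechet_derivative h (at (f x)) b) = frechet_derivative h (at (f x)) (w x)"
    if "x \<in> S" for x
    using linear_onb_expand[OF smooth_on_frechet_linear[OF assms(4)], of "f x" "w x"] that assms(3) by auto
qed

lemma frechet_derivative_compose:
  assumes "smooth_on S f" "smooth_on T g" "x \<in> S" "f x \<in> T"
  shows "frechet_derivative (\<lambda>x. g (f x)) (at x) v = frechet_derivative g (at (f x)) (frechet_derivative f (at x) v)"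
  using has_derivative_compose[OF smooth_on_has_derivative[OF assms(1,3)] smooth_on_has_derivative[OF assms(2,4)]]
    frechet_derivative_at by metis

subsection \<open>Symmetry of second derivatives\<close>

text \<open>Schwarz's theorem by second differences. The second difference of \<open>f\<close> over
  the parallelogram with sides \<open>h u\<close> and \<open>h v\<close> is symmetric in
  \<open>u\<close> and \<open>v\<close>, and it equals \<open>h * h\<close> times the mixed
  derivative, taken in either order, at some point of the parallelogram. Continuity of the mixed
  derivatives transfers the equality to \<open>x\<close>.\<close>

lemma second_derivative_symmetric_real:
  fixes f :: "'a::finite_dim_inner \<Rightarrow> real"
  assumes "open S" "x \<in> S" "smooth_on S f"
  defines "D \<equiv> \<lambda>u v x. frechet_derivative (\<lambda>x. frechet_derivative f (at x) u) (at x) v"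
  shows "D u v x = D v u x"
proof -
  have key: "\<exists>a b. 0 < a \<and> a < h \<and> 0 < b \<and> b < h \<and>
      f (x + h *\<^sub>R u + h *\<^sub>R v) - f (x + h *\<^sub>R u) - f (x + h *\<^sub>R v) + f x = h * h * D u v (x + a *\<^sub>R u + b *\<^sub>R v)"
    if h: "0 < h" and sub: "\<And>a b. 0 \<le> a \<Longrightarrow> a \<le> h \<Longrightarrow> 0 \<le> b \<Longrightarrow> b \<le> h \<Longrightarrow> x + a *\<^sub>R u + b *\<^sub>R v \<in> S"
    for u v h
  proof -
    have line: "((\<lambda>t. g (y + t *\<^sub>R w)) has_real_derivative frechet_derivative g (at (y + t *\<^sub>R w)) w) (at t)"
      if "smooth_on S g" "y + t *\<^sub>R w \<in> S" for g :: "'a \<Rightarrow> real" and y w t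
    proof -
      have lin: "linear (frechet_derivative g (at (y + t *\<^sub>R w)))"
        using that by (rule smooth_on_frechet_linear)
      have "((\<lambda>t. y + t *\<^sub>R w) has_derivative (\<lambda>r. r *\<^sub>R w)) (at t)"
        by (auto intro!: derivative_eq_intros)
      from has_derivative_compose[OF this smooth_on_has_derivative[OF that]]
      show ?thesis
        by (simp add: has_field_derivative_def linear_scale[OF lin] mult_commute_abs)
    qed
    \<comment> \<open>The mean value theorem is applied twice: to the increment in direction
      \<open>v\<close> as a function of the step along \<open>u\<close>, then to the derivative
      along \<open>u\<close> as a function of the step along \<open>v\<close>.\<close>
    let ?p = "\<lambda>a. f (x + h *\<^sub>R v + a *\<^sub>R u) - f (x + a *\<^sub>R u)"
    have "\<exists>a. 0 < a \<and> a < h \<and> ?p h - ?p 0 = (h - 0) *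
        (frechet_derivative f (at (x + h *\<^sub>R v + a *\<^sub>R u)) u - frechet_derivative f (at (x + a *\<^sub>R u)) u)"
      using sub[of _ h] sub[of _ 0] h
      by (intro MVT2 DERIV_diff line assms(3)) (auto simp: ac_simps)
    then obtain a where a: "0 < a" "a < h" and pa: "?p h - ?p 0 = h *
        (frechet_derivative f (at (x + h *\<^sub>R v + a *\<^sub>R u)) u - frechet_derivative f (at (x + a *\<^sub>R u)) u)"
      by auto
    let ?q = "\<lambda>b. frechet_derivative f (at (x + a *\<^sub>R u + b *\<^sub>R v)) u"
    have "\<exists>b. 0 < b \<and> b < h \<and> ?q h - ?q 0 = (h - 0) * D u v (x + a *\<^sub>R u + b *\<^sub>R v)"
      unfolding D_def using sub[of a] a h
      by (intro MVT2 line[of "\<lambda>x. frechet_derivative f (at x) u"] smooth_on_frechet_derivative assms(3)) auto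
    then obtain b where b: "0 < b" "b < h" "?q h - ?q 0 = h * D u v (x + a *\<^sub>R u + b *\<^sub>R v)"
      by auto
    show ?thesis
      using a b pa by (intro exI[of _ a] exI[of _ b]) (simp add: ac_simps)
  qed
  show ?thesis
  proof (rule ccontr)
    define e where "e = \<bar>D u v x - D v u x\<bar> / 2"
    assume "D u v x \<noteq> D v u x"
    then have "e > 0"
      by (simp add: e_def)
    have cont: "isCont (D u v) x" for u v
      unfolding D_def using smooth_on_imp_continuous_on[OF smooth_on_frechet_derivative[OF smooth_on_frechet_derivative[OF assms(3)]]]
        assms(1,2) continuous_on_eq_continuous_at by blast
    have "\<exists>d>0. \<forall>y. dist y x < d \<longrightarrow> y \<in> S \<and> dist (D u v y) (D u v x) < e" for u v
    proof -
      obtain d1 where "d1 > 0" "\<forall>y. dist y x < d1 \<longrightarrow> y \<in> S"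
        using assms(1,2) open_dist by blast
      moreover obtain d2 where "d2 > 0" "\<forall>y. dist y x < d2 \<longrightarrow> dist (D u v y) (D u v x) < e"
        using cont[of u v] \<open>e > 0\<close> unfolding continuous_at_eps_delta by blast
      ultimately show ?thesis
        by (intro exI[of _ "min d1 d2"]) auto
    qed
    then obtain d1 d2 where d: "d1 > 0" "d2 > 0"
        "\<And>y. dist y x < d1 \<Longrightarrow> y \<in> S \<and> dist (D u v y) (D u v x) < e"
        "\<And>y. dist y x < d2 \<Longrightarrow> y \<in> S \<and> dist (D v u y) (D v u x) < e"
      by metis
    \<comment> \<open>Small enough for the whole parallelogram to stay within distance
      \<open>min d1 d2\<close> of \<open>x\<close>; the summand 1 keeps the denominator positive
      when both vectors vanish.\<close>
    define h where "h = min d1 d2 / (2 * (norm u + norm v + 1))"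
    have "h > 0"
      using d by (auto simp: h_def intro!: divide_pos_pos add_nonneg_pos)
    have small: "dist (x + a *\<^sub>R u + b *\<^sub>R v) x < min d1 d2" if "0 \<le> a" "a \<le> h" "0 \<le> b" "b \<le> h" for a b
    proof -
      have "dist (x + a *\<^sub>R u + b *\<^sub>R v) x = norm (a *\<^sub>R u + b *\<^sub>R v)"
        by (simp add: dist_norm)
      also have "\<dots> \<le> a * norm u + b * norm v"
        using that norm_triangle_ineq[of "a *\<^sub>R u" "b *\<^sub>R v"] by simp
      also have "\<dots> \<le> h * norm u + h * norm v"
        using that by (intro add_mono mult_right_mono) auto
      also have "\<dots> < h * (2 * (norm u + norm v + 1))"
        using \<open>h > 0\<close> by (simp add: algebra_simps add_nonneg_pos)
      also have "\<dots> = min d1 d2"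
      proof -
        have "norm u + norm v + 1 > 0"
          by (simp add: add_nonneg_pos)
        then show ?thesis
          by (simp add: h_def)
      qed
      finally show ?thesis .
    qed
    obtain a b where ab: "0 < a" "a < h" "0 < b" "b < h"
      "f (x + h *\<^sub>R u + h *\<^sub>R v) - f (x + h *\<^sub>R u) - f (x + h *\<^sub>R v) + f x = h * h * D u v (x + a *\<^sub>R u + b *\<^sub>R v)"
      using key[of h u v] small d \<open>h > 0\<close> by (metis min_less_iff_conj)
    have "x + b *\<^sub>R v + a *\<^sub>R u \<in> S" if "0 \<le> a" "a \<le> h" "0 \<le> b" "b \<le> h" for a b
      using small[OF that] d by (simp add: ac_simps)
    then obtain a' b' where ab': "0 < a'" "a' < h" "0 < b'" "b' < h"
      "f (x + h *\<^sub>R v + h *\<^sub>R u) - f (x + h *\<^sub>R v) - f (x + h *\<^sub>R u) + f x = h * h * D v u (x + b' *\<^sub>R v + a' *\<^sub>R u)"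
      using key[of h v u] \<open>h > 0\<close> by metis
    have "D u v (x + a *\<^sub>R u + b *\<^sub>R v) = D v u (x + a' *\<^sub>R u + b' *\<^sub>R v)"
    proof -
      have "x + h *\<^sub>R v + h *\<^sub>R u = x + h *\<^sub>R u + h *\<^sub>R v"
        "x + b' *\<^sub>R v + a' *\<^sub>R u = x + a' *\<^sub>R u + b' *\<^sub>R v"
        by simp_all
      then have "h * h * D u v (x + a *\<^sub>R u + b *\<^sub>R v) = h * h * D v u (x + a' *\<^sub>R u + b' *\<^sub>R v)"
        using ab(5) ab'(5) by (metis add.commute diff_add_eq diff_diff_eq)
      then show ?thesis
        using \<open>h > 0\<close> by simp
    qed
    moreover have "dist (D u v (x + a *\<^sub>R u + b *\<^sub>R v)) (D u v x) < e"
      using d(3) small[of a b] ab by auto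
    moreover have "dist (D v u (x + a' *\<^sub>R u + b' *\<^sub>R v)) (D v u x) < e"
      using d(4) small[of a' b'] ab' by auto
    ultimately have "\<bar>D u v x - D v u x\<bar> < 2 * e"
      by (simp add: dist_real_def)
    then show False
      by (simp add: e_def)
  qed
qed

lemma frechet_derivative_linear_compose:
  assumes "linear h" "smooth_on S f" "x \<in> S"
  shows "frechet_derivative (\<lambda>x. h (f x)) (at x) v = h (frechet_derivative f (at x) v)"
proof -
  have "((\<lambda>x. h (f x)) has_derivative (\<lambda>v. h (frechet_derivative f (at x) v))) (at x)"
    using has_derivative_compose[OF smooth_on_has_derivative[OF assms(2,3)]
        bounded_linear_imp_has_derivative[OF linear_imp_bounded_linear[OF assms(1)]]] .
  then show ?thesis
    using frechet_derivative_at by metis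
qed

lemma second_derivative_symmetric:
  fixes f :: "'a::finite_dim_inner \<Rightarrow> 'b::finite_dim_inner"
  assumes "open S" "x \<in> S" "smooth_on S f"
  shows "frechet_derivative (\<lambda>x. frechet_derivative f (at x) u) (at x) v =
    frechet_derivative (\<lambda>x. frechet_derivative f (at x) v) (at x) u"
proof -
  have lin: "linear (\<lambda>y. y \<bullet> w)" for w :: 'b
    by (simp add: bounded_linear.linear bounded_linear_inner_left)
  have *: "frechet_derivative (\<lambda>x. frechet_derivative f (at x) u) (at x) v \<bullet> w =
     frechet_derivative (\<lambda>x. frechet_derivative (\<lambda>x. f x \<bullet> w) (at x) u) (at x) v" for u v w
  proof -
    have "frechet_derivative (\<lambda>x. frechet_derivative (\<lambda>x. f x \<bullet> w) (at x) u) (at x) =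
        frechet_derivative (\<lambda>x. frechet_derivative f (at x) u \<bullet> w) (at x)"
      using frechet_derivative_linear_compose[OF lin assms(3)]
      by (intro frechet_derivative_cong_open[OF assms(1,2)]) auto
    then show ?thesis
      using frechet_derivative_linear_compose[OF lin smooth_on_frechet_derivative[OF assms(3)] assms(2)] by simp
  qed
  have "smooth_on S (\<lambda>x. f x \<bullet> w)" for w
    using smooth_on_linear_compose[OF lin assms(1,3)] .
  then have "frechet_derivative (\<lambda>x. frechet_derivative f (at x) u) (at x) v \<bullet> w =
    frechet_derivative (\<lambda>x. frechet_derivative f (at x) v) (at x) u \<bullet> w" for w
    unfolding * by (rule second_derivative_symmetric_real[OF assms(1,2)])
  then show ?thesis
    by (metis vector_eq_rdot)
qed

subsection \<open>The inverse function theorem\<close>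

text \<open>A product rule at a zero of \<open>r\<close>, where mere continuity of the other factor
  suffices because its increment is multiplied by something that tends to 0. It will be applied to a
  factor whose differentiability is the very thing to be proved.\<close>

lemma has_derivative_scaleR_zero:
  fixes r :: "'a::real_normed_vector \<Rightarrow> real" and c :: "'a \<Rightarrow> 'b::real_normed_vector"
  assumes r: "(r has_derivative r') (at x)" "r x = 0" and c: "isCont c x"
  shows "((\<lambda>y. r y *\<^sub>R c y) has_derivative (\<lambda>v. r' v *\<^sub>R c x)) (at x)"
proof -
  have bl: "bounded_linear r'"
    using r(1) has_derivative_bounded_linear by blast
  obtain K where K: "\<And>v. norm (r' v) \<le> norm v * K"
    using bounded_linear.bounded[OF bl] by blast
  have "((\<lambda>y. (1 / norm (y - x)) *\<^sub>R (r y - (r x + r' (y - x)))) \<longlongrightarrow> 0) (at x)"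
    using r(1) unfolding has_derivative_at2 by blast
  then have "((\<lambda>y. ((1 / norm (y - x)) *\<^sub>R (r y - (r x + r' (y - x)))) *\<^sub>R c y) \<longlongrightarrow> 0 *\<^sub>R c x) (at x)"
    using c unfolding isCont_def by (rule tendsto_scaleR)
  moreover have "((\<lambda>y. ((1 / norm (y - x)) *\<^sub>R r' (y - x)) *\<^sub>R (c y - c x)) \<longlongrightarrow> 0) (at x)"
  proof (rule Lim_null_comparison)
    have "((\<lambda>y. K * norm (c y - c x)) \<longlongrightarrow> K * norm (c x - c x)) (at x)"
      using c unfolding isCont_def by (intro tendsto_intros)
    then show "((\<lambda>y. K * norm (c y - c x)) \<longlongrightarrow> 0) (at x)"
      by simp
    show "\<forall>\<^sub>F y in at x. norm (((1 / norm (y - x)) *\<^sub>R r' (y - x)) *\<^sub>R (c y - c x)) \<le> K * norm (c y - c x)"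
      unfolding eventually_at_filter
    proof (rule always_eventually, intro allI impI)
      fix y assume "y \<noteq> x"
      then have "\<bar>r' (y - x)\<bar> / norm (y - x) \<le> K"
        using K[of "y - x"] by (simp add: field_simps)
      then show "norm (((1 / norm (y - x)) *\<^sub>R r' (y - x)) *\<^sub>R (c y - c x)) \<le> K * norm (c y - c x)"
        using mult_right_mono[of "\<bar>r' (y - x)\<bar> / norm (y - x)" K "norm (c y - c x)"] by simp
    qed
  qed
  ultimately have "((\<lambda>y. ((1 / norm (y - x)) *\<^sub>R (r y - (r x + r' (y - x)))) *\<^sub>R c y +
      ((1 / norm (y - x)) *\<^sub>R r' (y - x)) *\<^sub>R (c y - c x)) \<longlongrightarrow> 0) (at x)"
    using tendsto_add by fastforce
  then have "((\<lambda>y. (1 / norm (y - x)) *\<^sub>R (r y *\<^sub>R c y - (r x *\<^sub>R c x + r' (y - x) *\<^sub>R c x))) \<longlongrightarrow> 0) (at x)"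
  proof (rule Lim_transform_eventually)
    \<comment> \<open>As \<open>r x = 0\<close>, the remainder of the product splits into the
      remainder of \<open>r\<close> times \<open>c y\<close> and the linear part of \<open>r\<close>
      times the increment of \<open>c\<close>; both are small relative to the distance.\<close>
    have eq: "(s *\<^sub>R (a - (r x + b))) *\<^sub>R u + (s *\<^sub>R b) *\<^sub>R (u - w) = s *\<^sub>R (a *\<^sub>R u - (r x *\<^sub>R w + b *\<^sub>R w))"
      for s a b :: real and u w :: 'b
      by (simp add: r(2) algebra_simps)
    show "\<forall>\<^sub>F y in at x. ((1 / norm (y - x)) *\<^sub>R (r y - (r x + r' (y - x)))) *\<^sub>R c y +
      ((1 / norm (y - x)) *\<^sub>R r' (y - x)) *\<^sub>R (c y - c x) =
      (1 / norm (y - x)) *\<^sub>R (r y *\<^sub>R c y - (r x *\<^sub>R c x + r' (y - x) *\<^sub>R c x))"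
      unfolding eq by simp
  qed
  moreover have "bounded_linear (\<lambda>v. r' v *\<^sub>R c x)"
    using bl by (rule bounded_linear_scaleR_const)
  ultimately show ?thesis
    unfolding has_derivative_at2 by blast
qed

text \<open>A bootstrap for \<open>g\<close> and the inverse matrices \<open>B\<close> together: the
  derivative of \<open>g\<close> is \<open>B\<close>, and the derivative of \<open>B\<close> is a
  polynomial expression in \<open>B\<close> and the second derivatives of \<open>f\<close> along
  \<open>g\<close>. Hence both gain one order at a time. The bound \<open>K\<close> makes the
  derivatives of \<open>f\<close> injective, hence invertible, with inverses bounded uniformly; this
  starts the induction with continuity.\<close>

lemma smooth_on_inverse:
  fixes f :: "'a::finite_dim_inner \<Rightarrow> 'a"
  assumes "open U" "open V" and f: "smooth_on U f" and g: "continuous_on V g" "g ` V \<subseteq> U"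
    and fg: "\<And>y. y \<in> V \<Longrightarrow> f (g y) = y"
    and K: "\<And>x v. x \<in> U \<Longrightarrow> norm v \<le> K * norm (frechet_derivative f (at x) v)"
  shows "smooth_on V g"
proof -
  define A where "A y = frechet_derivative f (at (g y))" for y
  define B where "B y = inv_into UNIV (A y)" for y
  have gU: "g y \<in> U" if "y \<in> V" for y
    using that g by auto
  have linA: "linear (A y)" if "y \<in> V" for y
    unfolding A_def using f gU[OF that] by (rule smooth_on_frechet_linear)
  have injA: "inj (A y)" if "y \<in> V" for y
  proof -
    have "v = 0" if "A y v = 0" for v
      using K[OF gU[OF \<open>y \<in> V\<close>], of v] that by (simp add: A_def)
    then show ?thesis
      using linear_injective_0[OF linA[OF that]] by blast
  qed
  have surjA: "surj (A y)" if "y \<in> V" for y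
    using linear_inj_imp_surj_fd[OF linA injA] that by blast
  have BA: "B y (A y v) = v" if "y \<in> V" for y v
    using injA[OF that] by (simp add: B_def)
  have AB: "A y (B y v) = v" if "y \<in> V" for y v
    using surjA[OF that] by (simp add: B_def surj_f_inv_f)
  have linB: "linear (B y)" if "y \<in> V" for y
  proof (rule linearI)
    show "B y (u + v) = B y u + B y v" for u v
      using BA[OF that, of "B y u + B y v"] by (simp add: linear_add[OF linA[OF that]] AB[OF that])
    show "B y (c *\<^sub>R u) = c *\<^sub>R B y u" for c u
      using BA[OF that, of "c *\<^sub>R B y u"] by (simp add: linear_scale[OF linA[OF that]] AB[OF that])
  qed
  have normB: "norm (B y v) \<le> K * norm v" if "y \<in> V" for y v
    using K[OF gU[OF that], of "B y v"] AB[OF that, of v] by (simp add: A_def)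
  have derg: "(g has_derivative B y) (at y)" if "y \<in> V" for y
  proof (rule has_derivative_inverse_basic[OF _ _ _ _ \<open>open V\<close> that])
    show "(f has_derivative A y) (at (g y))"
      unfolding A_def using f gU[OF that] by (rule smooth_on_has_derivative)
    show "bounded_linear (B y)"
      using linB[OF that] by (rule linear_imp_bounded_linear)
    show "B y \<circ> A y = id"
      using BA[OF that] by auto
    show "continuous (at y) g"
      using g(1) \<open>open V\<close> that continuous_on_eq_continuous_at by blast
  qed (use fg in auto)
  have contA: "continuous_on V (\<lambda>y. A y w)" for w
    unfolding A_def using continuous_on_compose2[OF smooth_on_imp_continuous_on[OF smooth_on_frechet_derivative[OF f]] g] .
  have contB: "continuous_on V (\<lambda>y. B y v)" for v
  proof -
    have "((\<lambda>y. B y v) \<longlongrightarrow> B y0 v) (at y0 within V)" if y0: "y0 \<in> V" for y0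
    proof -
      \<comment> \<open>\<open>B y v - w\<close> equals \<open>B y (v - A y w)\<close>, and
        \<open>K\<close> bounds \<open>B y\<close> uniformly in \<open>y\<close>; thus continuity of
        \<open>A\<close> at the fixed vector \<open>w\<close> suffices.\<close>
      define w where "w = B y0 v"
      have "((\<lambda>y. B y v - w) \<longlongrightarrow> 0) (at y0 within V)"
      proof (rule Lim_null_comparison)
        have "((\<lambda>y. A y w) \<longlongrightarrow> A y0 w) (at y0 within V)"
          using contA y0 by (simp add: continuous_on_def)
        then have "((\<lambda>y. K * norm (v - A y w)) \<longlongrightarrow> K * norm (v - A y0 w)) (at y0 within V)"
          by (intro tendsto_intros)
        then show "((\<lambda>y. K * norm (v - A y w)) \<longlongrightarrow> 0) (at y0 within V)"
          by (simp add: w_def AB[OF y0])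
        have "norm (B y v - w) \<le> K * norm (v - A y w)" if "y \<in> V" for y
          using normB[OF that, of "v - A y w"] BA[OF that, of w] by (simp add: linear_diff[OF linB[OF that]])
        then show "\<forall>\<^sub>F y in at y0 within V. norm (B y v - w) \<le> K * norm (v - A y w)"
          by (auto simp: eventually_at_filter)
      qed
      then show ?thesis
        by (simp add: w_def LIM_zero_iff)
    qed
    then show ?thesis
      by (simp add: continuous_on_def)
  qed
  define D2 where "D2 b b' x = frechet_derivative (\<lambda>x. frechet_derivative f (at x) b) (at x) b'" for b b' x
  have D2_smooth: "smooth_on U (D2 b b')" for b b'
    unfolding D2_def by (intro smooth_on_frechet_derivative f)
  have D2_sym: "D2 b b' x = D2 b' b x" if "x \<in> U" for b b' x
    unfolding D2_def using second_derivative_symmetric[OF \<open>open U\<close> that f] .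
  have D2_lin: "linear (\<lambda>b'. D2 b b' x)" if "x \<in> U" for b x
    unfolding D2_def using smooth_on_frechet_linear[OF smooth_on_frechet_derivative[OF f] that] by (simp add: eta_contract_eq)
  \<comment> \<open>Linearity is immediate in the second direction only; symmetry transfers it to
    the first.\<close>
  have D2_expand: "D2 w z x = (\<Sum>b\<in>onb. (w \<bullet> b) *\<^sub>R (\<Sum>b'\<in>onb. (z \<bullet> b') *\<^sub>R D2 b b' x))" if x: "x \<in> U" for w z x
  proof -
    have "D2 w z x = (\<Sum>b\<in>onb. (w \<bullet> b) *\<^sub>R D2 b z x)"
      using linear_onb_expand[OF D2_lin[OF x], of z w] D2_sym[OF x] by simp
    also have "\<dots> = (\<Sum>b\<in>onb. (w \<bullet> b) *\<^sub>R (\<Sum>b'\<in>onb. (z \<bullet> b') *\<^sub>R D2 b b' x))"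
      using linear_onb_expand[OF D2_lin[OF x], of _ z] by (intro sum.cong) auto
    finally show ?thesis .
  qed
  text \<open>The identity \<open>B y' v = w + B y' (v - A y' w)\<close> with \<open>w = B y v\<close> yields the derivative of the
    inverse matrix without Cramer's rule.\<close>
  have derB: "((\<lambda>y. B y v) has_derivative (\<lambda>u. - B y (D2 (B y v) (B y u) (g y)))) (at y)" if y: "y \<in> V" for y v
  proof -
    define w where "w = B y v"
    define k where "k y' = v - A y' w" for y'
    define k' where "k' u = - D2 w (B y u) (g y)" for u
    have k: "(k has_derivative k') (at y)"
    proof -
      have "((\<lambda>x. frechet_derivative f (at x) w) has_derivative (\<lambda>b. D2 w b (g y))) (at (g y))"
        unfolding D2_def using smooth_on_has_derivative[OF smooth_on_frechet_derivative[OF f] gU[OF y]] .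
      from has_derivative_diff[OF has_derivative_const has_derivative_compose[OF derg[OF y] this], of v] show ?thesis
        by (simp add: k_def[abs_def] k'_def[abs_def] A_def)
    qed
    have k0: "k y = 0"
      by (simp add: k_def w_def AB[OF y])
    have "((\<lambda>y'. (k y' \<bullet> b) *\<^sub>R B y' b) has_derivative (\<lambda>u. (k' u \<bullet> b) *\<^sub>R B y b)) (at y)" for b
    proof (rule has_derivative_scaleR_zero)
      show "((\<lambda>y'. k y' \<bullet> b) has_derivative (\<lambda>u. k' u \<bullet> b)) (at y)"
        using k by (rule has_derivative_inner_left)
      show "isCont (\<lambda>y'. B y' b) y"
        using contB \<open>open V\<close> y continuous_on_eq_continuous_at by blast
    qed (simp add: k0)
    then have der: "((\<lambda>y'. w + (\<Sum>b\<in>onb. (k y' \<bullet> b) *\<^sub>R B y' b)) has_derivative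
        (\<lambda>u. 0 + (\<Sum>b\<in>onb. (k' u \<bullet> b) *\<^sub>R B y b))) (at y)"
      by (intro has_derivative_add has_derivative_const has_derivative_sum)
    have sum_k': "(\<Sum>b\<in>onb. (k' u \<bullet> b) *\<^sub>R B y b) = - B y (D2 (B y v) (B y u) (g y))" for u
      using linear_onb_expand[OF linB[OF y], of "k' u"] by (simp add: k'_def w_def linear_neg[OF linB[OF y]])
    have sum_k: "w + (\<Sum>b\<in>onb. (k y' \<bullet> b) *\<^sub>R B y' b) = B y' v" if "y' \<in> V" for y'
    proof -
      have "B y' (k y') = B y' v - w"
        by (simp add: k_def linear_diff[OF linB[OF that]] BA[OF that])
      then show ?thesis
        using linear_onb_expand[OF linB[OF that], of "k y'"] by simp
    qed
    show ?thesis
      using has_derivative_transform_within_open[OF der \<open>open V\<close> y sum_k] unfolding sum_k' add_0 .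
  qed
  have "Ck_on n g V \<and> (\<forall>v. Ck_on n (\<lambda>y. B y v) V)" for n
  proof (induction n)
    case 0
    then show ?case
      using contB g by simp
  next
    case (Suc n)
    have gS: "Ck_on (Suc n) g V"
      using Suc derg by (intro Ck_on_SucI[OF \<open>open V\<close>]) auto
    have inner_Ck: "Ck_on n (\<lambda>y. B y v \<bullet> b) V" for v b
      using Suc by (intro Ck_on_bilinear[OF \<open>open V\<close> bounded_bilinear_inner] Ck_on_const) auto
    have D2_Ck: "Ck_on n (\<lambda>y. D2 b b' (g y)) V" for b b'
      using Suc.IH Ck_on_compose[OF \<open>open V\<close> \<open>open U\<close> g(2) _ smooth_onD[OF D2_smooth]] by blast
    have "Ck_on n (\<lambda>y. \<Sum>b\<in>onb. (B y v \<bullet> b) *\<^sub>R (\<Sum>b'\<in>onb. (B y u \<bullet> b') *\<^sub>R D2 b b' (g y))) V" for u v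
      by (intro Ck_on_sum Ck_on_bilinear[OF \<open>open V\<close> bounded_bilinear_scaleR] \<open>open V\<close> inner_Ck D2_Ck)
    then have D2B: "Ck_on n (\<lambda>y. D2 (B y v) (B y u) (g y)) V" for u v
      by (rule Ck_on_cong[OF \<open>open V\<close>, rotated]) (simp add: D2_expand[OF gU])
    have Ck: "Ck_on n (\<lambda>y. - B y (D2 (B y v) (B y u) (g y))) V" for u v
    proof -
      have "Ck_on n (\<lambda>y. \<Sum>b\<in>onb. (D2 (B y v) (B y u) (g y) \<bullet> (- b)) *\<^sub>R B y b) V"
        using Suc by (intro Ck_on_sum Ck_on_bilinear[OF \<open>open V\<close> bounded_bilinear_scaleR]
            Ck_on_bilinear[OF \<open>open V\<close> bounded_bilinear_inner] \<open>open V\<close> D2B Ck_on_const) auto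
      then show ?thesis
      proof (rule Ck_on_cong[OF \<open>open V\<close>, rotated])
        fix y assume y: "y \<in> V"
        show "(\<Sum>b\<in>onb. (D2 (B y v) (B y u) (g y) \<bullet> - b) *\<^sub>R B y b) = - B y (D2 (B y v) (B y u) (g y))"
          using linear_onb_expand[OF linB[OF y], of "D2 (B y v) (B y u) (g y)"] by (simp add: sum_negf)
      qed
    qed
    have "Ck_on (Suc n) (\<lambda>y. B y v) V" for v
      by (rule Ck_on_SucI[OF \<open>open V\<close> derB Ck])
    with gS show ?case
      by blast
  qed
  then show ?thesis
    by (simp add: smooth_on_def)
qed

text \<open>With the derivative at \<open>x0\<close> normalised to the identity, \<open>f\<close>
  differs from the identity near \<open>x0\<close> by a map with Lipschitz constant 1/2, so
  \<open>f x = y\<close> is a fixed point problem for a contraction. The image is delivered as a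
  ball in order that segments from its centre stay inside it.\<close>

lemma inverse_function_theorem_smooth:
  fixes f :: "'a::finite_dim_inner \<Rightarrow> 'a"
  assumes "open S" "x0 \<in> S" and f: "smooth_on S f" and id: "\<And>v. frechet_derivative f (at x0) v = v"
  obtains U g r where "open U" "U \<subseteq> S" "x0 \<in> U" "r > 0" "f ` U = ball (f x0) r"
    "\<And>x. x \<in> U \<Longrightarrow> g (f x) = x" "smooth_on (ball (f x0) r) g"
    "\<And>x. x \<in> U \<Longrightarrow> inj (frechet_derivative f (at x))"
proof -
  define D where "D x = frechet_derivative f (at x)" for x
  have derD: "(f has_derivative D x) (at x)" and linD: "linear (D x)" if "x \<in> S" for x
    unfolding D_def using smooth_on_has_derivative smooth_on_frechet_linear f that by blast+
  obtain \<delta> where "\<delta> > 0" and \<delta>S: "cball x0 \<delta> \<subseteq> S"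
    and near_id: "\<And>x v. x \<in> cball x0 \<delta> \<Longrightarrow> norm (D x v - v) \<le> norm v / 2"
  proof -
    \<comment> \<open>Summed over the basis vectors, errors below \<open>e\<close> add up to at most
      1/2; the added 1 keeps the fraction meaningful in dimension 0.\<close>
    define e where "e = 1 / (2 * (1 + real (card (onb::'a set))))"
    have "e > 0"
      by (simp add: e_def add_pos_nonneg)
    have "\<forall>\<^sub>F x in nhds x0. norm (D x b - b) < e" for b
    proof -
      have "continuous_on S (\<lambda>x. norm (D x b - b))"
        unfolding D_def by (intro continuous_intros smooth_on_imp_continuous_on smooth_on_frechet_derivative f)
      then have "isCont (\<lambda>x. norm (D x b - b)) x0"
        using assms(1,2) continuous_on_eq_continuous_at by blast
      then have "((\<lambda>x. norm (D x b - b)) \<longlongrightarrow> norm (D x0 b - b)) (nhds x0)"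
        by (simp add: continuous_at tendsto_nhds_iff)
      moreover have "norm (D x0 b - b) < e"
        using id \<open>e > 0\<close> by (simp add: D_def)
      ultimately show ?thesis
        by (rule order_tendstoD)
    qed
    then have "\<forall>\<^sub>F x in nhds x0. x \<in> S \<and> (\<forall>b\<in>onb. norm (D x b - b) < e)"
      using eventually_nhds_in_open[OF assms(1,2)] by (auto intro!: eventually_conj eventually_ball_finite)
    then obtain d where d: "d > 0" "\<And>x. dist x x0 < d \<Longrightarrow> x \<in> S \<and> (\<forall>b\<in>onb. norm (D x b - b) < e)"
      unfolding eventually_nhds_metric by blast
    show ?thesis
    proof
      show "d / 2 > 0" and sub: "cball x0 (d / 2) \<subseteq> S"
        using d by (auto simp: dist_commute)
      fix x v assume "x \<in> cball x0 (d / 2)"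
      then have x: "x \<in> S" "\<forall>b\<in>onb. norm (D x b - b) < e"
        using d by (auto simp: dist_commute)
      have "linear (\<lambda>v. D x v - v)"
        using linD[OF x(1)] by (simp add: linear_compose_sub linear_ident)
      from linear_onb_expand[OF this, of v]
      have "norm (D x v - v) \<le> (\<Sum>b\<in>onb. \<bar>v \<bullet> b\<bar> * norm (D x b - b))"
        by (auto intro!: sum_norm_le)
      also have "\<dots> \<le> (\<Sum>b\<in>(onb::'a set). norm v * e)"
      proof (rule sum_mono)
        fix b :: 'a assume b: "b \<in> onb"
        then have "\<bar>v \<bullet> b\<bar> \<le> norm v"
          using Cauchy_Schwarz_ineq2[of v b] norm_onb[OF b] by simp
        then show "\<bar>v \<bullet> b\<bar> * norm (D x b - b) \<le> norm v * e"
          using x(2) b by (intro mult_mono) (auto intro: less_imp_le)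
      qed
      also have "\<dots> = norm v * (real (card (onb::'a set)) * e)"
        by simp
      also have "\<dots> \<le> norm v * (1 / 2)"
        by (intro mult_left_mono) (auto simp: e_def field_simps)
      finally show "norm (D x v - v) \<le> norm v / 2"
        by simp
    qed
  qed
  have contr: "norm ((f x - x) - (f y - y)) \<le> norm (x - y) / 2" if "x \<in> cball x0 \<delta>" "y \<in> cball x0 \<delta>" for x y
  proof -
    have "norm ((f x - x) - (f y - y)) \<le> 1 / 2 * norm (x - y)"
    proof (rule differentiable_bound[where S = "cball x0 \<delta>" and f' = "\<lambda>x v. D x v - v"])
      show "((\<lambda>x. f x - x) has_derivative (\<lambda>v. D x v - v)) (at x within cball x0 \<delta>)" if "x \<in> cball x0 \<delta>" for x
        using has_derivative_at_withinI[OF derD] \<delta>S that by (intro has_derivative_diff has_derivative_ident) blast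
      show "onorm (\<lambda>v. D x v - v) \<le> 1 / 2" if "x \<in> cball x0 \<delta>" for x
        using near_id[OF that] by (intro onorm_bound) auto
    qed (use that in auto)
    then show ?thesis
      by simp
  qed
  have lip: "norm (x - y) \<le> 2 * norm (f x - f y)" if "x \<in> cball x0 \<delta>" "y \<in> cball x0 \<delta>" for x y
    using contr[OF that] norm_triangle_ineq2[of "x - y" "f x - f y"] norm_minus_commute[of "x - y" "f x - f y"]
    by (simp add: algebra_simps)
  \<comment> \<open>For \<open>y\<close> in this ball the map
    \<open>x \<mapsto> x + (y - f x)\<close> sends the closed ball of radius \<open>\<delta>\<close>
    into the open one: contraction contributes at most \<open>\<delta> / 2\<close>, and the distance
    of \<open>y\<close> from \<open>f x0\<close> strictly less than that.\<close>
  define r where "r = \<delta> / 2"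
  have ex: "\<exists>x\<in>ball x0 \<delta>. f x = y" if y: "y \<in> ball (f x0) r" for y
  proof -
    have into: "x + (y - f x) \<in> ball x0 \<delta>" if x: "x \<in> cball x0 \<delta>" for x
    proof -
      have "norm ((f x - x) - (f x0 - x0)) \<le> \<delta> / 2"
        using contr[OF x, of x0] x \<open>\<delta> > 0\<close> by (simp add: dist_norm norm_minus_commute)
      moreover have "norm (y - f x0) < \<delta> / 2"
        using y by (simp add: r_def dist_norm norm_minus_commute)
      moreover have "x + (y - f x) - x0 = (y - f x0) - ((f x - x) - (f x0 - x0))"
        by simp
      then have "norm (x + (y - f x) - x0) \<le> norm (y - f x0) + norm ((f x - x) - (f x0 - x0))"
        by (metis norm_triangle_ineq4)
      ultimately show ?thesis
        by (simp add: dist_norm norm_minus_commute)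
    qed
    have "\<exists>!x\<in>cball x0 \<delta>. x + (y - f x) = x"
    proof (rule Banach_fix[where c = "1 / 2"])
      show "complete (cball x0 \<delta>)"
        using complete_closed_subset[OF closed_cball _ complete_UNIV_fd] by blast
      show "(\<lambda>x. x + (y - f x)) ` cball x0 \<delta> \<subseteq> cball x0 \<delta>"
        using into by force
      show "dist (u + (y - f u)) (v + (y - f v)) \<le> 1 / 2 * dist u v" if "u \<in> cball x0 \<delta>" "v \<in> cball x0 \<delta>" for u v
        using contr[OF that] by (simp add: dist_norm norm_minus_commute algebra_simps)
    qed (use \<open>\<delta> > 0\<close> in auto)
    then obtain x where "x \<in> cball x0 \<delta>" "x + (y - f x) = x"
      by blast
    with into[of x] show ?thesis
      by (intro bexI[of _ x]) auto
  qed
  define U where "U = ball x0 \<delta> \<inter> f -` ball (f x0) r"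
  have ball_sub: "x \<in> cball x0 \<delta>" if "x \<in> ball x0 \<delta>" for x
    using that by simp
  have "inj_on f (ball x0 \<delta>)"
  proof (rule inj_onI)
    fix x y assume "x \<in> ball x0 \<delta>" "y \<in> ball x0 \<delta>" "f x = f y"
    with lip[OF ball_sub ball_sub, of x y] show "x = y"
      by simp
  qed
  then have injU: "inj_on f U"
    by (rule inj_on_subset) (auto simp: U_def)
  have US: "U \<subseteq> S"
    using \<delta>S by (auto simp: U_def)
  have fU: "f ` U = ball (f x0) r"
  proof (intro equalityI subsetI)
    fix y assume y: "y \<in> ball (f x0) r"
    from ex[OF y] obtain x where "x \<in> ball x0 \<delta>" "f x = y"
      by blast
    with y show "y \<in> f ` U"
      unfolding U_def by blast
  qed (auto simp: U_def)
  define g where "g = inv_into U f"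
  have gU: "g y \<in> U" and fg: "f (g y) = y" if "y \<in> ball (f x0) r" for y
    using that fU by (auto simp: g_def inv_into_into f_inv_into_f)
  have openU: "open U"
    unfolding U_def
    using \<delta>S by (intro continuous_open_preimage continuous_on_subset[OF smooth_on_imp_continuous_on[OF f]]) auto
  have lower: "norm v \<le> 2 * norm (D x v)" if "x \<in> U" for x v
  proof -
    have "norm (D x v - v) \<le> norm v / 2"
      using near_id[of x] that by (auto simp: U_def)
    then show ?thesis
      using norm_triangle_ineq2[of v "D x v"] norm_minus_commute[of v "D x v"] by (simp add: algebra_simps)
  qed
  show ?thesis
  proof
    show "open U" "U \<subseteq> S" "f ` U = ball (f x0) r"
      by fact+
    show "x0 \<in> U" "r > 0"
      using \<open>\<delta> > 0\<close> by (auto simp: U_def r_def)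
    show "g (f x) = x" if "x \<in> U" for x
      using injU that by (simp add: g_def)
    show "inj (frechet_derivative f (at x))" if x: "x \<in> U" for x
    proof -
      have "v = 0" if "D x v = 0" for v
        using lower[OF x, of v] that by simp
      then show ?thesis
        using linear_injective_0[OF linD, of x] x US by (auto simp: D_def)
    qed
    show "smooth_on (ball (f x0) r) g"
    proof (rule smooth_on_inverse[OF openU open_ball smooth_on_subset[OF f US]])
      have "norm (g y - g z) \<le> 2 * norm (y - z)" if "y \<in> ball (f x0) r" "z \<in> ball (f x0) r" for y z
        using lip[of "g y" "g z"] gU[OF that(1)] gU[OF that(2)] fg that by (auto simp: U_def)
      then have "2-lipschitz_on (ball (f x0) r) g"
        by (intro lipschitz_onI) (auto simp: dist_norm)
      then show "continuous_on (ball (f x0) r) g"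
        by (rule lipschitz_on_continuous_on)
    qed (use gU fg lower in \<open>auto simp: D_def\<close>)
  qed
qed

subsection \<open>Level sets of maps of constant rank\<close>

text \<open>The transport maps \<open>P x\<close> express that the rank of \<open>F\<close> is constant: they carry the kernel
  of the derivative at \<open>x0\<close> into the kernel at \<open>x\<close>. The straightening map is
  \<open>\<Phi> x = \<pi> (x - x0) + Q (F x - F x0)\<close>, where \<open>\<pi>\<close> is a projection onto the kernel \<open>N\<close> and \<open>Q\<close>
  inverts the derivative on the complement \<open>ker \<pi>\<close>.\<close>

lemma constant_rank_level_set:
  fixes F :: "'a::finite_dim_inner \<Rightarrow> 'b::finite_dim_inner"
  assumes "open S" "x0 \<in> S" and F: "smooth_on S F"
    and P: "\<And>x. x \<in> S \<Longrightarrow> linear (P x)" "\<And>x. x \<in> S \<Longrightarrow> inj (P x)"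
    and PN: "\<And>x n. x \<in> S \<Longrightarrow> frechet_derivative F (at x0) n = 0 \<Longrightarrow> frechet_derivative F (at x) (P x n) = 0"
  defines "N \<equiv> {n. frechet_derivative F (at x0) n = 0}"
  obtains U V \<Phi> \<Psi> where "open U" "U \<subseteq> S" "x0 \<in> U" "open V" "\<Phi> ` U = V" "smooth_on U \<Phi>" "smooth_on V \<Psi>"
    "\<And>x. x \<in> U \<Longrightarrow> \<Psi> (\<Phi> x) = x" "\<And>v. frechet_derivative \<Phi> (at x0) v = v"
    "\<And>x. x \<in> U \<Longrightarrow> F x = F x0 \<longleftrightarrow> \<Phi> x \<in> N"
proof -
  define D where "D x = frechet_derivative F (at x)" for x
  have linD: "linear (D x)" if "x \<in> S" for x
    unfolding D_def using F that by (rule smooth_on_frechet_linear)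
  note N_iff = N_def[folded D_def]
  have subN: "subspace N"
    unfolding N_iff using linD[OF \<open>x0 \<in> S\<close>] by (rule linear_subspace_kernel)
  obtain \<pi> :: "'a \<Rightarrow> 'a" where \<pi>: "range \<pi> \<subseteq> N" "linear \<pi>" "\<And>n. n \<in> N \<Longrightarrow> \<pi> n = n"
    using linear_exists_left_inverse_on[of "\<lambda>x::'a. x" N] subN linear_ident by auto
  define C where "C = {v. \<pi> v = 0}"
  have subC: "subspace C"
    unfolding C_def using \<pi>(2) by (rule linear_subspace_kernel)
  have NC: "v = 0" if "v \<in> N" "v \<in> C" for v
    using that \<pi>(3) by (simp add: C_def)
  have "inj_on (D x0) C"
  proof -
    have "u = v" if "u \<in> C" "v \<in> C" "D x0 u = D x0 v" for u v
      using NC[of "u - v"] that subspace_diff[OF subC]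
      by (simp add: N_iff linear_diff[OF linD[OF \<open>x0 \<in> S\<close>]])
    then show ?thesis
      by (simp add: inj_on_def)
  qed
  then obtain Q where Q: "range Q \<subseteq> C" "linear Q" "\<And>v. v \<in> C \<Longrightarrow> Q (D x0 v) = v"
    using linear_exists_left_inverse_on[OF linD[OF \<open>x0 \<in> S\<close>] subC] by auto
  define \<Phi> where "\<Phi> x = \<pi> (x - x0) + Q (F x - F x0)" for x
  have smooth\<Phi>: "smooth_on S \<Phi>"
    unfolding \<Phi>_def
    by (intro smooth_on_add smooth_on_linear_compose[OF \<pi>(2)] smooth_on_linear_compose[OF Q(2)]
        smooth_on_diff smooth_on_ident smooth_on_const \<open>open S\<close> F)
  have D\<Phi>: "frechet_derivative \<Phi> (at x) v = \<pi> v + Q (D x v)" if "x \<in> S" for x v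
  proof -
    have "((\<lambda>x. x - x0) has_derivative (\<lambda>v. v)) (at x)" "((\<lambda>x. F x - F x0) has_derivative D x) (at x)"
      using has_derivative_diff[OF has_derivative_ident has_derivative_const, of x0 "at x"]
        has_derivative_diff[OF smooth_on_has_derivative[OF F that] has_derivative_const, of "F x0"]
      by (simp_all add: D_def)
    then have "(\<Phi> has_derivative (\<lambda>v. \<pi> v + Q (D x v))) (at x)"
      unfolding \<Phi>_def[abs_def]
      using bounded_linear.has_derivative[OF linear_imp_bounded_linear[OF \<pi>(2)]]
        bounded_linear.has_derivative[OF linear_imp_bounded_linear[OF Q(2)]] has_derivative_add by blast
    then show ?thesis
      using frechet_derivative_at by metis
  qed
  have "\<pi> v + Q (D x0 v) = v" for v
  proof -
    have "v - \<pi> v \<in> C"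
      using \<pi> by (simp add: C_def linear_diff[OF \<pi>(2)] range_subsetD)
    moreover have "D x0 (v - \<pi> v) = D x0 v"
      using \<pi>(1) by (auto simp: linear_diff[OF linD[OF \<open>x0 \<in> S\<close>]] N_iff)
    ultimately show ?thesis
      using Q(3)[of "v - \<pi> v"] by simp
  qed
  then have D\<Phi>0: "frechet_derivative \<Phi> (at x0) v = v" for v
    using D\<Phi>[OF \<open>x0 \<in> S\<close>] by simp
  obtain U \<Psi> r where U: "open U" "U \<subseteq> S" "x0 \<in> U" and "r > 0" and \<Phi>U: "\<Phi> ` U = ball (\<Phi> x0) r"
    and \<Psi>: "\<And>x. x \<in> U \<Longrightarrow> \<Psi> (\<Phi> x) = x" "smooth_on (ball (\<Phi> x0) r) \<Psi>"
    and inj\<Phi>: "\<And>x. x \<in> U \<Longrightarrow> inj (frechet_derivative \<Phi> (at x))"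
  proof (rule inverse_function_theorem_smooth[OF \<open>open S\<close> \<open>x0 \<in> S\<close> smooth\<Phi> D\<Phi>0], goal_cases)
    case (1 U g r)
    from 1(2-) show thesis by (rule 1(1))
  qed
  have \<Phi>0: "\<Phi> x0 = 0"
    by (simp add: \<Phi>_def linear_0[OF \<pi>(2)] linear_0[OF Q(2)])
  define V where "V = ball (0::'a) r"
  have \<Phi>UV: "\<Phi> ` U = V" and smooth\<Psi>: "smooth_on V \<Psi>" and "open V"
    using \<Phi>U \<Psi>(2) by (simp_all add: V_def \<Phi>0)
  have \<Psi>V: "\<Psi> y \<in> U" "\<Phi> (\<Psi> y) = y" if "y \<in> V" for y
    using that \<Psi>(1) unfolding \<Phi>UV[symmetric] by auto
  have D\<Phi>\<Psi>: "frechet_derivative \<Phi> (at (\<Psi> y)) (frechet_derivative \<Psi> (at y) v) = v" if "y \<in> V" for y v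
  proof -
    have "frechet_derivative (\<lambda>y. \<Phi> (\<Psi> y)) (at y) = frechet_derivative (\<lambda>y. y) (at y)"
      using \<Psi>V by (intro frechet_derivative_cong_open[OF \<open>open V\<close> that]) auto
    then show ?thesis
      using frechet_derivative_compose[OF smooth\<Psi> smooth\<Phi> that, of v] \<Psi>V[OF that] U by (simp add: subset_iff)
  qed
  \<comment> \<open>Let the derivative of \<open>\<Phi>\<close> at \<open>x\<close> send
    \<open>w\<close> to \<open>u\<close> in \<open>N\<close>. Comparing components in
    \<open>N\<close> and \<open>C\<close> gives \<open>Q (D x w) = 0\<close>. On the kernel of
    \<open>D x\<close> the derivative of \<open>\<Phi>\<close> reduces to \<open>\<pi>\<close> and
    is injective, so \<open>\<pi>\<close> after \<open>P x\<close> is injective from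
    \<open>N\<close> to \<open>N\<close>, hence onto. Some vector of the kernel thus has the same
    image as \<open>w\<close>, and injectivity makes it \<open>w\<close> itself.\<close>
  have DF0: "D (\<Psi> y) (frechet_derivative \<Psi> (at y) u) = 0" if y: "y \<in> V" and u: "u \<in> N" for y u
  proof -
    define x where "x = \<Psi> y"
    define w where "w = frechet_derivative \<Psi> (at y) u"
    have xU: "x \<in> U" and xS: "x \<in> S"
      using \<Psi>V y U by (auto simp: x_def)
    have w: "\<pi> w + Q (D x w) = u"
      using D\<Phi>\<Psi>[OF y, of u] D\<Phi>[OF xS] by (simp add: x_def w_def)
    have "Q (D x w) = u - \<pi> w"
      using w by (simp add: algebra_simps)
    moreover have "u - \<pi> w \<in> N"
      using u \<pi>(1) subspace_diff[OF subN] by (simp add: range_subsetD)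
    ultimately have Q0: "Q (D x w) = 0"
      using NC Q(1) by (metis range_subsetD)
    \<comment> \<open>Extends \<open>\<pi>\<close> after \<open>P x\<close> from \<open>N\<close> to
      the whole space by the identity on \<open>C\<close>, so that injectivity of an endomorphism
      yields surjectivity.\<close>
    define R where "R v = \<pi> (P x (\<pi> v)) + (v - \<pi> v)" for v
    have linR: "linear R"
      unfolding R_def
      by (intro linear_compose_add linear_compose_sub linear_ident \<pi>(2)
          linear_compose[OF linear_compose[OF \<pi>(2) P(1)[OF xS]] \<pi>(2), unfolded o_def])
    have "v = 0" if "R v = 0" for v
    proof -
      have \<pi>2: "\<pi> (\<pi> z) = \<pi> z" for z
        using \<pi> by (simp add: range_subsetD)
      have "\<pi> (R v) = \<pi> (P x (\<pi> v))"
        by (simp add: R_def linear_add[OF \<pi>(2)] linear_diff[OF \<pi>(2)] \<pi>2)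
      then have a: "\<pi> (P x (\<pi> v)) = 0"
        using that linear_0[OF \<pi>(2)] by simp
      then have b: "v = \<pi> v"
        using that by (simp add: R_def)
      have "\<pi> v \<in> N"
        using \<pi>(1) by auto
      then have "D x (P x (\<pi> v)) = 0"
        using PN[OF xS, of "\<pi> v"] by (simp add: N_def D_def)
      then have "frechet_derivative \<Phi> (at x) (P x (\<pi> v)) = 0"
        using a by (simp add: D\<Phi>[OF xS] linear_0[OF Q(2)])
      then have "P x (\<pi> v) = 0"
        using inj\<Phi>[OF xU] smooth_on_frechet_linear[OF smooth\<Phi> xS] by (simp add: linear_injective_0)
      then have "\<pi> v = 0"
        using P(2)[OF xS] linear_injective_0[OF P(1)[OF xS]] by blast
      then show ?thesis
        using b by simp
    qed
    then have "inj R"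
      by (simp add: linear_injective_0[OF linR])
    then have "surj R"
      by (rule linear_inj_imp_surj_fd[OF linR])
    from surjD[OF this, of "\<pi> w"] obtain v where v: "R v = \<pi> w"
      by auto
    then have vN: "v - \<pi> v = \<pi> w - \<pi> (P x (\<pi> v))"
      by (simp add: R_def algebra_simps)
    then have "v - \<pi> v \<in> N"
      using \<pi>(1) subspace_diff[OF subN] by (simp add: range_subsetD)
    moreover have "v - \<pi> v \<in> C"
      using \<pi> by (simp add: C_def linear_diff[OF \<pi>(2)] range_subsetD)
    ultimately have "v - \<pi> v = 0"
      by (rule NC)
    then have \<pi>P: "\<pi> (P x (\<pi> v)) = \<pi> w"
      using vN by simp
    have "\<pi> v \<in> N"
      using \<pi>(1) by auto
    then have DP: "D x (P x (\<pi> v)) = 0"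
      using PN[OF xS, of "\<pi> v"] by (simp add: N_def D_def)
    then have "frechet_derivative \<Phi> (at x) (P x (\<pi> v)) = frechet_derivative \<Phi> (at x) w"
      using \<pi>P Q0 by (simp add: D\<Phi>[OF xS] linear_0[OF Q(2)])
    then have "P x (\<pi> v) = w"
      using inj\<Phi>[OF xU] by (simp add: inj_eq)
    then show ?thesis
      using DP by (simp add: x_def w_def)
  qed
  have level: "F x = F x0 \<longleftrightarrow> \<Phi> x \<in> N" if x: "x \<in> U" for x
  proof
    assume "F x = F x0"
    then show "\<Phi> x \<in> N"
      using \<pi>(1) by (auto simp: \<Phi>_def linear_0[OF Q(2)])
  next
    assume N: "\<Phi> x \<in> N"
    define y where "y = \<Phi> x"
    have yV: "y \<in> V" "y \<in> N"
      using x N \<Phi>UV by (auto simp: y_def)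
    have tV: "t *\<^sub>R y \<in> V" if "t \<in> {0..1}" for t
    proof -
      have "\<bar>t\<bar> * norm y \<le> 1 * norm y"
        using that by (intro mult_right_mono) auto
      then show ?thesis
        using yV by (simp add: V_def)
    qed
    \<comment> \<open>\<open>F\<close> after \<open>\<Psi>\<close> has zero derivative along the
      segment from 0 to \<open>y\<close>, which lies in the ball \<open>V\<close> and points in a
      direction of \<open>N\<close>.\<close>
    have "F (\<Psi> (1 *\<^sub>R y)) = F (\<Psi> (0 *\<^sub>R y))"
    proof (rule has_derivative_zero_unique[where f = "\<lambda>t. F (\<Psi> (t *\<^sub>R y))" and s = "{0..1::real}"])
      fix t :: real assume t: "t \<in> {0..1}"
      have \<Psi>t: "\<Psi> (t *\<^sub>R y) \<in> S"
        using \<Psi>V(1)[OF tV[OF t]] U by auto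
      have "((\<lambda>t. t *\<^sub>R y) has_derivative (\<lambda>s. s *\<^sub>R y)) (at t)"
        by (auto intro!: derivative_eq_intros)
      from has_derivative_compose[OF has_derivative_compose[OF this smooth_on_has_derivative[OF smooth\<Psi> tV[OF t]]]
          smooth_on_has_derivative[OF F \<Psi>t]]
      have "((\<lambda>t. F (\<Psi> (t *\<^sub>R y))) has_derivative
          (\<lambda>s. D (\<Psi> (t *\<^sub>R y)) (frechet_derivative \<Psi> (at (t *\<^sub>R y)) (s *\<^sub>R y)))) (at t)"
        by (simp add: D_def)
      moreover have "D (\<Psi> (t *\<^sub>R y)) (frechet_derivative \<Psi> (at (t *\<^sub>R y)) (s *\<^sub>R y)) = 0" for s
        using DF0[OF tV[OF t]] yV subspace_scale[OF subN] by blast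
      ultimately show "((\<lambda>t. F (\<Psi> (t *\<^sub>R y))) has_derivative (\<lambda>h. 0)) (at t within {0..1})"
        by (simp add: has_derivative_at_withinI)
    qed auto
    moreover have "\<Psi> 0 = x0"
      using \<Psi>(1)[OF \<open>x0 \<in> U\<close>] \<Phi>0 by simp
    moreover have "\<Psi> y = x"
      using \<Psi>(1)[OF x] by (simp add: y_def)
    ultimately show "F x = F x0"
      by simp
  qed
  show ?thesis
    by (rule that[OF U \<open>open V\<close> \<Phi>UV smooth_on_subset[OF smooth\<Phi> U(2)] smooth\<Psi> \<Psi>(1) D\<Phi>0 level])
qed

section \<open>Maps between manifolds in charts\<close>

text \<open>A local notion for one pair of arbitrary charts, so that composition only shrinks
  \<open>U\<close>. A change of coordinates is the case of the identity map, and the tangent map is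
  \<open>chart_deriv\<close> for the preferred charts.\<close>

definition smooth_in_charts ::
    "('m, 'e::finite_dim_inner) chart \<Rightarrow> ('n, 'f::finite_dim_inner) chart \<Rightarrow> ('m \<Rightarrow> 'n) \<Rightarrow> 'm \<Rightarrow> bool" where
  "smooth_in_charts c d f p \<longleftrightarrow> p \<in> fst c \<and>
     (\<exists>U. open U \<and> snd c p \<in> U \<and> U \<subseteq> snd c ` fst c \<and> (\<forall>x\<in>U. f (chart_inv c x) \<in> fst d) \<and>
        smooth_on U (snd d \<circ> f \<circ> chart_inv c))"

definition chart_deriv ::
    "('m, 'e::finite_dim_inner) chart \<Rightarrow> ('n, 'f::finite_dim_inner) chart \<Rightarrow> ('m \<Rightarrow> 'n) \<Rightarrow> 'm \<Rightarrow> 'e \<Rightarrow> 'f" where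
  "chart_deriv c d f p = frechet_derivative (snd d \<circ> f \<circ> chart_inv c) (at (snd c p))"

lemma is_chart_inj: "is_chart c \<Longrightarrow> inj_on (snd c) (fst c)"
  and is_chart_open: "is_chart c \<Longrightarrow> open (snd c ` fst c)"
  by (simp_all add: is_chart_def)

lemma chart_inv_chart: "is_chart c \<Longrightarrow> p \<in> fst c \<Longrightarrow> chart_inv c (snd c p) = p"
  by (simp add: is_chart_inj)

lemma smooth_in_chartsE:
  assumes "smooth_in_charts c d f p" "is_chart c"
  obtains U where "open U" "snd c p \<in> U" "U \<subseteq> snd c ` fst c" "p \<in> fst c" "f p \<in> fst d"
    "\<And>x. x \<in> U \<Longrightarrow> f (chart_inv c x) \<in> fst d" "smooth_on U (snd d \<circ> f \<circ> chart_inv c)"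
  using assms chart_inv_chart[OF assms(2)] unfolding smooth_in_charts_def by metis

lemma smooth_in_charts_mem:
  assumes "smooth_in_charts c d f p" "is_chart c"
  shows "p \<in> fst c" "f p \<in> fst d"
  by (rule smooth_in_chartsE[OF assms]; assumption)+

lemma smooth_in_chartsI:
  assumes "p \<in> fst c" "open U" "snd c p \<in> U" "U \<subseteq> snd c ` fst c"
    "\<And>x. x \<in> U \<Longrightarrow> f (chart_inv c x) \<in> fst d" "\<And>x. x \<in> U \<Longrightarrow> snd d (f (chart_inv c x)) = h x" "smooth_on U h"
  shows "smooth_in_charts c d f p" "chart_deriv c d f p = frechet_derivative h (at (snd c p))"
proof -
  have "smooth_on U (snd d \<circ> f \<circ> chart_inv c)"
    by (rule smooth_on_cong[OF assms(2) _ assms(7)]) (simp add: assms(6))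
  then show "smooth_in_charts c d f p"
    using assms(1-5) unfolding smooth_in_charts_def by blast
  show "chart_deriv c d f p = frechet_derivative h (at (snd c p))"
    unfolding chart_deriv_def by (rule frechet_derivative_cong_open[OF assms(2,3)]) (simp add: assms(6))
qed

lemma chart_deriv_linear:
  assumes "smooth_in_charts c d f p" "is_chart c"
  shows "linear (chart_deriv c d f p)"
  using assms by (auto elim!: smooth_in_chartsE simp: chart_deriv_def intro: smooth_on_frechet_linear)

lemma chart_deriv_cong:
  assumes "is_chart c" "p \<in> fst c" "\<And>x. x \<in> fst c \<Longrightarrow> f x = g x"
  shows "chart_deriv c d f p = chart_deriv c d g p"
  unfolding chart_deriv_def using assms inv_into_into[of _ "snd c" "fst c"]
  by (intro frechet_derivative_cong_open[OF is_chart_open[OF assms(1)]]) auto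

lemma smooth_in_charts_cong:
  assumes "is_chart c" "\<And>x. x \<in> fst c \<Longrightarrow> f x = g x" "smooth_in_charts c d f p"
  shows "smooth_in_charts c d g p"
proof -
  obtain U where U: "open U" "snd c p \<in> U" "U \<subseteq> snd c ` fst c" "p \<in> fst c"
    "\<And>x. x \<in> U \<Longrightarrow> f (chart_inv c x) \<in> fst d" "smooth_on U (snd d \<circ> f \<circ> chart_inv c)"
    using smooth_in_chartsE[OF assms(3,1)] by metis
  have *: "f (chart_inv c x) = g (chart_inv c x)" if "x \<in> U" for x
    using assms(2) U(3) that by (meson inv_into_into subsetD)
  show ?thesis
    by (rule smooth_in_chartsI(1)[OF U(4,1-3) _ _ U(6)]) (use * U(5) in auto)
qed

lemma smooth_in_charts_compose:
  assumes c: "is_chart c" and d: "is_chart d"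
    and f: "smooth_in_charts c d f p" and g: "smooth_in_charts d e g (f p)"
  shows "smooth_in_charts c e (\<lambda>x. g (f x)) p"
    "chart_deriv c e (\<lambda>x. g (f x)) p v = chart_deriv d e g (f p) (chart_deriv c d f p v)"
proof -
  let ?f = "snd d \<circ> f \<circ> chart_inv c" and ?g = "snd e \<circ> g \<circ> chart_inv d"
  obtain U where U: "open U" "snd c p \<in> U" "U \<subseteq> snd c ` fst c" "p \<in> fst c"
    "\<And>x. x \<in> U \<Longrightarrow> f (chart_inv c x) \<in> fst d" "smooth_on U ?f"
    using smooth_in_chartsE[OF f c] by metis
  obtain W where W: "open W" "snd d (f p) \<in> W"
    "\<And>x. x \<in> W \<Longrightarrow> g (chart_inv d x) \<in> fst e" "smooth_on W ?g"
    using smooth_in_chartsE[OF g d] by metis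
  define U' where "U' = U \<inter> ?f -` W"
  have oU': "open U'"
    unfolding U'_def using smooth_on_imp_continuous_on[OF U(6)] U(1) W(1) by (rule continuous_open_preimage)
  have fp: "?f (snd c p) = snd d (f p)"
    using chart_inv_chart[OF c U(4)] by simp
  have pU': "snd c p \<in> U'"
    using U W fp by (simp add: U'_def)
  have fd: "chart_inv d (?f x) = f (chart_inv c x)" if "x \<in> U'" for x
    using chart_inv_chart[OF d U(5)] that by (simp add: U'_def)
  have sm: "smooth_on U' (\<lambda>x. ?g (?f x))"
    by (rule smooth_on_compose[OF oU' W(1) _ smooth_on_subset[OF U(6)] W(4)]) (auto simp: U'_def)
  have mem: "g (f (chart_inv c x)) \<in> fst e" if "x \<in> U'" for x
    using W(3)[of "?f x"] fd[OF that] that by (simp add: U'_def)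
  have eq: "snd e (g (f (chart_inv c x))) = ?g (?f x)" if "x \<in> U'" for x
    using fd[OF that] by simp
  have "U' \<subseteq> snd c ` fst c"
    using U(3) by (auto simp: U'_def)
  note * = smooth_in_chartsI[where f = "\<lambda>x. g (f x)", OF U(4) oU' pU' this mem eq sm]
  show "smooth_in_charts c e (\<lambda>x. g (f x)) p"
    by (rule *(1))
  show "chart_deriv c e (\<lambda>x. g (f x)) p v = chart_deriv d e g (f p) (chart_deriv c d f p v)"
  proof -
    have "?f (snd c p) \<in> W"
      unfolding fp by (rule W(2))
    note frechet_derivative_compose[OF U(6) W(4) U(2) this, of v, unfolded fp]
    moreover have "chart_deriv c e (\<lambda>x. g (f x)) p v = frechet_derivative (\<lambda>x. ?g (?f x)) (at (snd c p)) v"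
      by (rule fun_cong[OF *(2)])
    ultimately show ?thesis
      by (simp only: chart_deriv_def)
  qed
qed

lemma smooth_in_charts_transition:
  assumes "is_chart c" "smooth_transition c d" "p \<in> fst c" "p \<in> fst d"
  shows "smooth_in_charts c d (\<lambda>x. x) p"
proof (rule smooth_in_chartsI(1)[OF assms(3)])
  show "open (snd c ` (fst c \<inter> fst d))" "smooth_on (snd c ` (fst c \<inter> fst d)) (snd d \<circ> chart_inv c)"
    using assms(2) by (simp_all add: smooth_transition_def)
qed (use assms chart_inv_chart[OF assms(1)] in auto)

lemma chart_deriv_self:
  assumes "is_chart c" "p \<in> fst c"
  shows "smooth_in_charts c c (\<lambda>x. x) p" "chart_deriv c c (\<lambda>x. x) p v = v"
proof -
  note * = smooth_in_chartsI[OF assms(2) is_chart_open[OF assms(1)], of "\<lambda>x. x" c "\<lambda>x. x"]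
  show "smooth_in_charts c c (\<lambda>x. x) p"
    by (rule *(1)) (use assms in \<open>auto simp: f_inv_into_f inv_into_into smooth_on_ident\<close>)
  have "chart_deriv c c (\<lambda>x. x) p = frechet_derivative (\<lambda>x. x) (at (snd c p))"
    by (rule *(2)) (use assms in \<open>auto simp: f_inv_into_f inv_into_into smooth_on_ident\<close>)
  then show "chart_deriv c c (\<lambda>x. x) p v = v"
    using frechet_derivative_at[OF has_derivative_ident] by metis
qed

subsection \<open>Atlases\<close>

definition smooth_atlas :: "('m, 'e::finite_dim_inner) atlas \<Rightarrow> bool" where
  "smooth_atlas A \<longleftrightarrow> (\<forall>c\<in>A. is_chart c) \<and> (\<forall>c\<in>A. \<forall>d\<in>A. smooth_transition c d)"

lemma smooth_manifold_imp_atlas: "smooth_manifold A \<Longrightarrow> smooth_atlas A"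
  by (simp add: smooth_manifold_def smooth_atlas_def)

lemma chart_at:
  assumes "p \<in> points A"
  shows "chart_at A p \<in> A" "p \<in> fst (chart_at A p)"
proof -
  have "\<exists>c. c \<in> A \<and> p \<in> fst c"
    using assms unfolding points_def by blast
  from someI_ex[OF this] show "chart_at A p \<in> A" "p \<in> fst (chart_at A p)"
    unfolding chart_at_def by blast+
qed

lemma atlas_subset_maximal: "smooth_atlas A \<Longrightarrow> c \<in> A \<Longrightarrow> c \<in> maximal_atlas A"
  by (auto simp: smooth_atlas_def maximal_atlas_def points_def)

lemma maximal_chart: "c \<in> maximal_atlas A \<Longrightarrow> is_chart c"
  and maximal_points: "c \<in> maximal_atlas A \<Longrightarrow> p \<in> fst c \<Longrightarrow> p \<in> points A"
  by (auto simp: maximal_atlas_def)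

lemma chart_at_maximal: "smooth_atlas A \<Longrightarrow> p \<in> points A \<Longrightarrow> chart_at A p \<in> maximal_atlas A"
  by (simp add: atlas_subset_maximal chart_at)

text \<open>Charts of the maximal atlas are by definition compatible with charts of \<open>A\<close>
  only; the change between two of them factors through the preferred chart at
  \<open>p\<close>.\<close>

lemma smooth_in_charts_id:
  assumes A: "smooth_atlas A" and c: "c \<in> maximal_atlas A" "p \<in> fst c" and d: "d \<in> maximal_atlas A" "p \<in> fst d"
  shows "smooth_in_charts c d (\<lambda>x. x) p"
proof -
  have p: "p \<in> points A"
    using c by (auto simp: maximal_atlas_def)
  have e: "is_chart (chart_at A p)" "smooth_transition c (chart_at A p)" "smooth_transition (chart_at A p) d"
    using chart_at[OF p] c d A by (auto simp: maximal_atlas_def smooth_atlas_def)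
  show ?thesis
    using smooth_in_charts_compose(1)[OF maximal_chart[OF c(1)] e(1)
        smooth_in_charts_transition[OF maximal_chart[OF c(1)] e(2) c(2) chart_at(2)[OF p]]
        smooth_in_charts_transition[OF e(1,3) chart_at(2)[OF p] d(2)]] .
qed

lemma chart_deriv_id_inverse:
  assumes A: "smooth_atlas A" and c: "c \<in> maximal_atlas A" "p \<in> fst c" and d: "d \<in> maximal_atlas A" "p \<in> fst d"
  shows "chart_deriv d c (\<lambda>x. x) p (chart_deriv c d (\<lambda>x. x) p v) = v"
  using smooth_in_charts_compose(2)[OF maximal_chart[OF c(1)] maximal_chart[OF d(1)]
      smooth_in_charts_id[OF A c d] smooth_in_charts_id[OF A d c], of v]
    chart_deriv_self(2)[OF maximal_chart[OF c(1)] c(2)] by simp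

lemma from_chart_eq: "from_chart A c p = chart_deriv c (chart_at A p) (\<lambda>x. x) p"
  by (simp add: from_chart_def chart_deriv_def o_def)

lemma from_chart_linear:
  assumes "smooth_atlas A" "c \<in> maximal_atlas A" "p \<in> fst c"
  shows "linear (from_chart A c p)"
  unfolding from_chart_eq using assms maximal_points[OF assms(2,3)]
  by (intro chart_deriv_linear smooth_in_charts_id[OF assms(1)] chart_at_maximal chart_at maximal_chart)

lemma from_chart_chart_at: "smooth_atlas A \<Longrightarrow> p \<in> points A \<Longrightarrow> from_chart A (chart_at A p) p v = v"
  unfolding from_chart_eq by (intro chart_deriv_self(2) chart_at maximal_chart[OF chart_at_maximal])

lemma from_chart_transition:
  assumes "smooth_atlas A" "c \<in> maximal_atlas A" "p \<in> fst c" "d \<in> maximal_atlas A" "p \<in> fst d"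
  shows "from_chart A d p (chart_deriv c d (\<lambda>x. x) p v) = from_chart A c p v"
proof -
  have p: "p \<in> points A"
    by (rule maximal_points[OF assms(2,3)])
  show ?thesis
    unfolding from_chart_eq
    using smooth_in_charts_compose(2)[OF maximal_chart[OF assms(2)] maximal_chart[OF assms(4)]
        smooth_in_charts_id[OF assms] smooth_in_charts_id[OF assms(1,4,5) chart_at_maximal[OF assms(1) p] chart_at(2)[OF p]], of v]
    by simp
qed

text \<open>The differential of the chart \<open>c\<close> at \<open>p\<close>, inverse to
  \<open>from_chart A c p\<close>.\<close>

definition into_chart :: "('m, 'e::finite_dim_inner) atlas \<Rightarrow> ('m, 'e) chart \<Rightarrow> 'm \<Rightarrow> 'e \<Rightarrow> 'e" where
  "into_chart A c p = chart_deriv (chart_at A p) c (\<lambda>x. x) p"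

lemma into_chart_linear:
  assumes "smooth_atlas A" "c \<in> maximal_atlas A" "p \<in> fst c"
  shows "linear (into_chart A c p)"
  unfolding into_chart_def using assms maximal_points[OF assms(2,3)]
  by (intro chart_deriv_linear smooth_in_charts_id[OF assms(1)] chart_at_maximal chart_at maximal_chart[OF chart_at_maximal])

lemma into_from_chart:
  assumes "smooth_atlas A" "c \<in> maximal_atlas A" "p \<in> fst c"
  shows "into_chart A c p (from_chart A c p v) = v" "from_chart A c p (into_chart A c p v) = v"
  unfolding into_chart_def from_chart_eq using assms maximal_points[OF assms(2,3)]
  by (intro chart_deriv_id_inverse[OF assms(1)] chart_at_maximal chart_at; simp)+

subsection \<open>Smoothness at a point\<close>

definition smooth_at ::
    "('m, 'e::finite_dim_inner) atlas \<Rightarrow> ('n, 'f::finite_dim_inner) atlas \<Rightarrow> ('m \<Rightarrow> 'n) \<Rightarrow> 'm \<Rightarrow> bool" where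
  "smooth_at A B f p \<longleftrightarrow> p \<in> points A \<and> f p \<in> points B \<and> smooth_in_charts (chart_at A p) (chart_at B (f p)) f p"

lemma tangent_map_eq: "tangent_map A B f p = chart_deriv (chart_at A p) (chart_at B (f p)) f p"
  by (simp add: tangent_map_def chart_deriv_def)

lemma tangent_map_linear: "smooth_atlas A \<Longrightarrow> smooth_at A B f p \<Longrightarrow> linear (tangent_map A B f p)"
  unfolding tangent_map_eq smooth_at_def
  by (metis chart_deriv_linear chart_at_maximal maximal_chart)

lemma smooth_at_charts:
  assumes A: "smooth_atlas A" and B: "smooth_atlas B" and f: "smooth_at A B f p"
    and c: "c \<in> maximal_atlas A" "p \<in> fst c" and d: "d \<in> maximal_atlas B" "f p \<in> fst d"
  shows "smooth_in_charts c d f p"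
    "from_chart B d (f p) (chart_deriv c d f p v) = tangent_map A B f p (from_chart A c p v)"
proof -
  have p: "p \<in> points A" "f p \<in> points B"
    using f by (simp_all add: smooth_at_def)
  let ?c = "chart_at A p" and ?d = "chart_at B (f p)"
  have c': "?c \<in> maximal_atlas A" "p \<in> fst ?c" and d': "?d \<in> maximal_atlas B" "f p \<in> fst ?d"
    by (rule chart_at_maximal[OF A p(1)] chart_at(2)[OF p(1)] chart_at_maximal[OF B p(2)] chart_at(2)[OF p(2)])+
  note ch = maximal_chart[OF c(1)] maximal_chart[OF d(1)] maximal_chart[OF c'(1)] maximal_chart[OF d'(1)]
  have f': "smooth_in_charts ?c ?d f p"
    using f by (simp add: smooth_at_def)
  note cf = smooth_in_charts_compose[OF ch(1,3) smooth_in_charts_id[OF A c c'] f']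
  show *: "smooth_in_charts c d f p"
    using smooth_in_charts_compose(1)[OF ch(1,4) cf(1) smooth_in_charts_id[OF B d' d]] .
  show "from_chart B d (f p) (chart_deriv c d f p v) = tangent_map A B f p (from_chart A c p v)"
    unfolding from_chart_eq tangent_map_eq
    using smooth_in_charts_compose(2)[OF ch(1,2) * smooth_in_charts_id[OF B d d'], of v] cf(2)[of v] by simp
qed

lemma smooth_atI:
  assumes A: "smooth_atlas A" and B: "smooth_atlas B"
    and c: "c \<in> maximal_atlas A" and d: "d \<in> maximal_atlas B" and f: "smooth_in_charts c d f p"
  shows "smooth_at A B f p"
proof -
  note ch = maximal_chart[OF c(1)] maximal_chart[OF d(1)]
  note mem = smooth_in_charts_mem[OF f ch(1)]
  have p: "p \<in> points A" "f p \<in> points B"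
    by (rule maximal_points[OF c mem(1)] maximal_points[OF d mem(2)])+
  let ?c = "chart_at A p" and ?d = "chart_at B (f p)"
  have c': "?c \<in> maximal_atlas A" "p \<in> fst ?c" and d': "?d \<in> maximal_atlas B" "f p \<in> fst ?d"
    by (rule chart_at_maximal[OF A p(1)] chart_at(2)[OF p(1)] chart_at_maximal[OF B p(2)] chart_at(2)[OF p(2)])+
  have f': "smooth_in_charts ?c d f p"
    using smooth_in_charts_compose(1)[OF maximal_chart[OF c'(1)] ch(1) smooth_in_charts_id[OF A c' c mem(1)] f] .
  have "smooth_in_charts ?c ?d f p"
    using smooth_in_charts_compose(1)[OF maximal_chart[OF c'(1)] ch(2) f' smooth_in_charts_id[OF B d mem(2) d']] .
  then show ?thesis
    using p by (simp add: smooth_at_def)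
qed

lemma smooth_at_compose:
  assumes "smooth_atlas A" "smooth_atlas B" "smooth_at A B f p" "smooth_at B C g (f p)"
  shows "smooth_at A C (\<lambda>x. g (f x)) p"
    "tangent_map A C (\<lambda>x. g (f x)) p v = tangent_map B C g (f p) (tangent_map A B f p v)"
proof -
  have ch: "is_chart (chart_at A p)" "is_chart (chart_at B (f p))"
    using assms by (auto simp: smooth_at_def intro!: maximal_chart chart_at_maximal)
  have fg: "smooth_in_charts (chart_at A p) (chart_at B (f p)) f p"
    "smooth_in_charts (chart_at B (f p)) (chart_at C (g (f p))) g (f p)"
    using assms by (simp_all add: smooth_at_def)
  note * = smooth_in_charts_compose[OF ch fg]
  show "smooth_at A C (\<lambda>x. g (f x)) p"
    using assms *(1) by (simp add: smooth_at_def)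
  show "tangent_map A C (\<lambda>x. g (f x)) p v = tangent_map B C g (f p) (tangent_map A B f p v)"
    unfolding tangent_map_eq by (rule *(2))
qed

lemma smooth_at_cong:
  assumes "smooth_atlas A" "\<And>x. x \<in> points A \<Longrightarrow> f x = g x" "smooth_at A B f p"
  shows "smooth_at A B g p" "tangent_map A B f p = tangent_map A B g p"
proof -
  have p: "p \<in> points A"
    using assms(3) by (simp add: smooth_at_def)
  have c: "is_chart (chart_at A p)" "\<And>x. x \<in> fst (chart_at A p) \<Longrightarrow> f x = g x"
    using chart_at[OF p] assms by (auto simp: smooth_atlas_def points_def)
  show "smooth_at A B g p"
    using assms(3) smooth_in_charts_cong[OF c(1), of f g, OF c(2)] unfolding smooth_at_def assms(2)[OF p] by blast
  show "tangent_map A B f p = tangent_map A B g p"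
    unfolding tangent_map_eq using chart_deriv_cong[OF c(1) chart_at(2)[OF p], of f g, OF c(2)] assms(2)[OF p] by simp
qed

lemma smooth_at_id:
  assumes "smooth_atlas A" "p \<in> points A"
  shows "smooth_at A A (\<lambda>x. x) p" "tangent_map A A (\<lambda>x. x) p v = v"
  using assms chart_deriv_self[OF maximal_chart[OF chart_at_maximal[OF assms]] chart_at(2)[OF assms(2)]]
  by (simp_all add: smooth_at_def tangent_map_eq)

lemma smooth_at_const:
  assumes "smooth_atlas A" "p \<in> points A" "q \<in> points B"
  shows "smooth_at A B (\<lambda>x. q) p"
proof -
  have "is_chart (chart_at A p)"
    by (rule maximal_chart[OF chart_at_maximal[OF assms(1,2)]])
  then have "smooth_in_charts (chart_at A p) (chart_at B q) (\<lambda>x. q) p"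
    by (intro smooth_in_chartsI(1)[where U = "snd (chart_at A p) ` fst (chart_at A p)" and
          h = "\<lambda>x. snd (chart_at B q) q"])
      (simp_all add: chart_at[OF assms(2)] chart_at[OF assms(3)] is_chart_open smooth_on_const)
  then show ?thesis
    using assms by (simp add: smooth_at_def)
qed

lemma smooth_map_on_imp_smooth_at:
  assumes "smooth_atlas A" "smooth_map_on A B W f" "p \<in> W" "p \<in> points A"
  shows "smooth_at A B f p"
proof -
  have fp: "f p \<in> points B"
    using assms by (auto simp: smooth_map_on_def)
  let ?c = "chart_at A p" and ?d = "chart_at B (f p)"
  have c: "is_chart ?c"
    by (rule maximal_chart[OF chart_at_maximal[OF assms(1,4)]])
  let ?O = "snd ?c ` (fst ?c \<inter> W \<inter> f -` fst ?d)"
  have "open ?O" "smooth_on ?O (snd ?d \<circ> f \<circ> chart_inv ?c)"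
    using assms(2) chart_at[OF fp] chart_at[OF assms(4)] by (auto simp: smooth_map_on_def Let_def)
  then have "smooth_in_charts ?c ?d f p"
    using chart_at[OF fp] chart_at[OF assms(4)] assms(3) chart_inv_chart[OF c]
    by (intro smooth_in_chartsI(1)[where U = ?O]) auto
  then show ?thesis
    using fp assms(4) by (simp add: smooth_at_def)
qed

text \<open>The openness demanded by \<open>smooth_map_on\<close> comes from the neighbourhoods in
  \<open>smooth_in_charts\<close>, which already contain the continuity of \<open>f\<close>.\<close>

lemma smooth_map_onI:
  assumes A: "smooth_atlas A" and B: "smooth_atlas B"
    and W: "\<And>c. c \<in> A \<Longrightarrow> open (snd c ` (fst c \<inter> W))" and f: "\<And>p. p \<in> W \<Longrightarrow> smooth_at A B f p"
  shows "smooth_map_on A B W f"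
  unfolding smooth_map_on_def Let_def
proof (intro conjI ballI)
  show "f ` W \<subseteq> points B"
    using f by (auto simp: smooth_at_def)
  fix c d assume cd: "c \<in> A" "d \<in> B"
  let ?O = "snd c ` (fst c \<inter> W \<inter> f -` fst d)"
  have c: "is_chart c"
    using A cd by (simp add: smooth_atlas_def)
  have *: "\<exists>U. open U \<and> x \<in> U \<and> U \<subseteq> ?O \<and> smooth_on U (snd d \<circ> f \<circ> chart_inv c)" if x: "x \<in> ?O" for x
  proof -
    obtain p where p: "p \<in> fst c" "p \<in> W" "f p \<in> fst d" "x = snd c p"
      using x by auto
    have "smooth_in_charts c d f p"
      by (rule smooth_at_charts(1)[OF A B f[OF p(2)] atlas_subset_maximal[OF A cd(1)] p(1)
          atlas_subset_maximal[OF B cd(2)] p(3)])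
    then obtain U where U: "open U" "snd c p \<in> U" "U \<subseteq> snd c ` fst c"
        "\<And>x. x \<in> U \<Longrightarrow> f (chart_inv c x) \<in> fst d" "smooth_on U (snd d \<circ> f \<circ> chart_inv c)"
      using smooth_in_chartsE[OF _ c] by metis
    have "U \<inter> snd c ` (fst c \<inter> W) \<subseteq> ?O"
    proof (intro subsetI, elim IntE imageE)
      fix x q assume q: "x \<in> U" "x = snd c q" "q \<in> fst c" "q \<in> W"
      then have "f q \<in> fst d"
        using U(4)[OF q(1)] chart_inv_chart[OF c] by simp
      with q show "x \<in> ?O"
        by auto
    qed
    then show ?thesis
      using U W[OF cd(1)] p smooth_on_subset[OF U(5)]
      by (intro exI[of _ "U \<inter> snd c ` (fst c \<inter> W)"]) auto
  qed
  show "open ?O"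
    using * by (subst open_subopen) blast
  show "smooth_on ?O (snd d \<circ> f \<circ> chart_inv c)"
    using * by (intro smooth_on_local) blast
qed

lemma smooth_mapI:
  assumes "smooth_atlas A" "smooth_atlas B" "\<And>p. p \<in> points A \<Longrightarrow> smooth_at A B f p"
  shows "smooth_map A B f"
proof (rule smooth_map_onI[OF assms(1,2) _ assms(3)])
  fix c assume "c \<in> A"
  then have "fst c \<inter> points A = fst c" "is_chart c"
    using assms(1) by (auto simp: points_def smooth_atlas_def)
  then show "open (snd c ` (fst c \<inter> points A))"
    by (simp add: is_chart_open)
qed

subsection \<open>Euclidean spaces and products\<close>

lemma euclidean_atlas: "smooth_atlas (euclidean_atlas :: ('e::finite_dim_inner, 'e) atlas)"
  by (simp add: smooth_atlas_def euclidean_atlas_def is_chart_def smooth_transition_def o_def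
      inv_into_def smooth_on_ident)

lemma points_euclidean [simp]: "points euclidean_atlas = UNIV"
  by (simp add: points_def euclidean_atlas_def)

lemma euclidean_chart: "(UNIV, \<lambda>x. x) \<in> maximal_atlas (euclidean_atlas :: ('e::finite_dim_inner, 'e) atlas)"
  by (rule atlas_subset_maximal[OF euclidean_atlas]) (simp add: euclidean_atlas_def)

lemma chart_inv_euclidean [simp]: "chart_inv (UNIV, \<lambda>x. x) = (\<lambda>x. x)"
  by (auto simp: inv_into_def)

lemma chart_at_euclidean [simp]: "chart_at euclidean_atlas p = (UNIV, \<lambda>x. x)"
  by (auto simp: chart_at_def euclidean_atlas_def)

definition prod_chart :: "('m, 'e) chart \<Rightarrow> ('n, 'f) chart \<Rightarrow> ('m \<times> 'n, 'e \<times> 'f) chart" where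
  "prod_chart c d = (fst c \<times> fst d, map_prod (snd c) (snd d))"

lemma prod_chart_simps [simp]: "fst (prod_chart c d) = fst c \<times> fst d" "snd (prod_chart c d) (x, y) = (snd c x, snd d y)"
  by (simp_all add: prod_chart_def)

lemma prod_chart_image: "snd (prod_chart c d) ` (S \<times> T) = (snd c ` S) \<times> (snd d ` T)"
  by (force simp: prod_chart_def)

lemma is_chart_prod:
  assumes "is_chart c" "is_chart d"
  shows "is_chart (prod_chart c d)"
  unfolding is_chart_def
proof
  show "inj_on (snd (prod_chart c d)) (fst (prod_chart c d))"
    using assms by (auto simp: is_chart_def inj_on_def)
  show "open (snd (prod_chart c d) ` fst (prod_chart c d))"
    using assms by (simp add: prod_chart_image is_chart_def open_Times)
qed

lemma chart_inv_prod:
  assumes "is_chart c" "is_chart d" "x \<in> snd c ` fst c" "y \<in> snd d ` fst d"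
  shows "chart_inv (prod_chart c d) (x, y) = (chart_inv c x, chart_inv d y)"
proof -
  have "chart_inv (prod_chart c d) (snd (prod_chart c d) (chart_inv c x, chart_inv d y)) = (chart_inv c x, chart_inv d y)"
    by (rule chart_inv_chart[OF is_chart_prod[OF assms(1,2)]]) (use assms in \<open>simp add: inv_into_into\<close>)
  then show ?thesis
    using assms by (simp add: f_inv_into_f)
qed

lemma chart_inv_prod_chart:
  assumes "is_chart c" "is_chart d" "a \<in> fst c" "b \<in> fst d"
  shows "inv_into (fst c \<times> fst d) (snd (prod_chart c d)) (snd c a, snd d b) = (a, b)"
  using chart_inv_prod[OF assms(1,2), of "snd c a" "snd d b"] assms by (simp add: chart_inv_chart)

lemma smooth_in_charts_Pair:
  assumes c: "is_chart c" and f: "smooth_in_charts c d f p" and g: "smooth_in_charts c e g p"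
  shows "smooth_in_charts c (prod_chart d e) (\<lambda>x. (f x, g x)) p"
proof -
  obtain U where U: "open U" "snd c p \<in> U" "U \<subseteq> snd c ` fst c" "p \<in> fst c"
    "\<And>x. x \<in> U \<Longrightarrow> f (chart_inv c x) \<in> fst d" "smooth_on U (snd d \<circ> f \<circ> chart_inv c)"
    using smooth_in_chartsE[OF f c] by metis
  obtain W where W: "open W" "snd c p \<in> W"
    "\<And>x. x \<in> W \<Longrightarrow> g (chart_inv c x) \<in> fst e" "smooth_on W (snd e \<circ> g \<circ> chart_inv c)"
    using smooth_in_chartsE[OF g c] by metis
  show ?thesis
    by (rule smooth_in_chartsI(1)[where U = "U \<inter> W" and
          h = "\<lambda>x. ((snd d \<circ> f \<circ> chart_inv c) x, (snd e \<circ> g \<circ> chart_inv c) x)"])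
      (use U W smooth_on_subset[OF U(6), of "U \<inter> W"] smooth_on_subset[OF W(4), of "U \<inter> W"] in
        \<open>auto simp: o_def intro!: smooth_on_Pair\<close>)
qed

lemma smooth_in_charts_fst:
  assumes "is_chart c" "is_chart d" "p \<in> fst c \<times> fst d"
  shows "smooth_in_charts (prod_chart c d) c fst p" "smooth_in_charts (prod_chart c d) d snd p"
proof -
  let ?U = "(snd c ` fst c) \<times> (snd d ` fst d)"
  have U: "open ?U" "snd (prod_chart c d) p \<in> ?U" "?U \<subseteq> snd (prod_chart c d) ` fst (prod_chart c d)"
    using assms by (auto simp: is_chart_open open_Times prod_chart_image)
  show "smooth_in_charts (prod_chart c d) c fst p"
    by (rule smooth_in_chartsI(1)[OF _ U, where h = fst])
      (use assms in \<open>auto simp: chart_inv_prod_chart intro!: smooth_on_linear linear_fst\<close>)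
  show "smooth_in_charts (prod_chart c d) d snd p"
    by (rule smooth_in_chartsI(1)[OF _ U, where h = snd])
      (use assms in \<open>auto simp: chart_inv_prod_chart intro!: smooth_on_linear linear_snd\<close>)
qed

lemma smooth_transitionI:
  assumes "is_chart c" "\<And>p. p \<in> fst c \<Longrightarrow> p \<in> fst d \<Longrightarrow> smooth_in_charts c d (\<lambda>x. x) p"
  shows "smooth_transition c d"
proof -
  have *: "\<exists>U. open U \<and> x \<in> U \<and> U \<subseteq> snd c ` (fst c \<inter> fst d) \<and> smooth_on U (snd d \<circ> chart_inv c)"
    if x: "x \<in> snd c ` (fst c \<inter> fst d)" for x
  proof -
    obtain p where p: "p \<in> fst c" "p \<in> fst d" "x = snd c p"
      using x by auto
    obtain U where U: "open U" "snd c p \<in> U" "U \<subseteq> snd c ` fst c"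
        "\<And>x. x \<in> U \<Longrightarrow> chart_inv c x \<in> fst d" "smooth_on U (snd d \<circ> (\<lambda>x. x) \<circ> chart_inv c)"
      using smooth_in_chartsE[OF assms(2)[OF p(1,2)] assms(1)] by metis
    have "U \<subseteq> snd c ` (fst c \<inter> fst d)"
    proof
      fix y assume "y \<in> U"
      then show "y \<in> snd c ` (fst c \<inter> fst d)"
        using U(3,4) by (intro image_eqI[of _ _ "chart_inv c y"]) (auto simp: f_inv_into_f inv_into_into)
    qed
    then show ?thesis
      using U p by (auto simp: o_def)
  qed
  then show ?thesis
    unfolding smooth_transition_def by (meson open_subopen smooth_on_local)
qed

lemma prod_atlas_iff: "e \<in> prod_atlas A B \<longleftrightarrow> (\<exists>c d. e = prod_chart c d \<and> c \<in> A \<and> d \<in> B)"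
  by (auto simp: prod_atlas_def prod_chart_def)

lemma points_prod [simp]: "points (prod_atlas A B) = points A \<times> points B"
proof -
  have "(x, y) \<in> points (prod_atlas A B) \<longleftrightarrow> (\<exists>c d. c \<in> A \<and> d \<in> B \<and> (x, y) \<in> fst (prod_chart c d))" for x y
    unfolding points_def UN_iff Bex_def prod_atlas_iff by blast
  then have "(x, y) \<in> points (prod_atlas A B) \<longleftrightarrow> (x, y) \<in> points A \<times> points B" for x y
    unfolding points_def prod_chart_simps(1) by blast
  then show ?thesis
    by (simp only: set_eq_iff split_paired_All simp_thms)
qed

lemma smooth_atlas_prod:
  assumes A: "smooth_atlas A" and B: "smooth_atlas B"
  shows "smooth_atlas (prod_atlas A B)"
  unfolding smooth_atlas_def
proof (intro conjI ballI)
  fix e assume "e \<in> prod_atlas A B"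
  then obtain c d where e: "e = prod_chart c d" "c \<in> A" "d \<in> B"
    by (auto simp: prod_atlas_iff)
  then have cd: "is_chart c" "is_chart d"
    using A B by (auto simp: smooth_atlas_def)
  then show ech: "is_chart e"
    by (simp add: e is_chart_prod)
  fix e' assume "e' \<in> prod_atlas A B"
  then obtain c' d' where e': "e' = prod_chart c' d'" "c' \<in> A" "d' \<in> B"
    by (auto simp: prod_atlas_iff)
  show "smooth_transition e e'"
  proof (rule smooth_transitionI[OF ech])
    fix p assume p: "p \<in> fst e" "p \<in> fst e'"
    have "smooth_in_charts c c' (\<lambda>x. x) (fst p)" "smooth_in_charts d d' (\<lambda>x. x) (snd p)"
      using p e e' A B by (auto intro!: smooth_in_charts_id atlas_subset_maximal)
    then have "smooth_in_charts e c' (\<lambda>x. fst x) p" "smooth_in_charts e d' (\<lambda>x. snd x) p"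
      using smooth_in_charts_fst[OF cd, of p] p ech cd
        smooth_in_charts_compose(1)[OF ech cd(1), of fst p c' "\<lambda>x. x"]
        smooth_in_charts_compose(1)[OF ech cd(2), of snd p d' "\<lambda>x. x"]
      by (auto simp: e)
    from smooth_in_charts_Pair[OF ech this] show "smooth_in_charts e e' (\<lambda>x. x) p"
      by (simp add: e')
  qed
qed

lemma prod_chart_maximal:
  assumes A: "smooth_atlas A" and B: "smooth_atlas B" and c: "c \<in> A" and d: "d \<in> B"
  shows "prod_chart c d \<in> maximal_atlas (prod_atlas A B)"
  by (rule atlas_subset_maximal[OF smooth_atlas_prod[OF A B]]) (use c d in \<open>unfold prod_atlas_iff, blast\<close>)

lemma smooth_at_Pair:
  assumes "smooth_atlas A" "smooth_atlas B" "smooth_atlas C" "smooth_at A B f p" "smooth_at A C g p"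
  shows "smooth_at A (prod_atlas B C) (\<lambda>x. (f x, g x)) p"
proof -
  have p: "p \<in> points A" "f p \<in> points B" "g p \<in> points C"
    and *: "smooth_in_charts (chart_at A p) (chart_at B (f p)) f p" "smooth_in_charts (chart_at A p) (chart_at C (g p)) g p"
    using assms by (simp_all add: smooth_at_def)
  show ?thesis
    using p by (intro smooth_atI[OF assms(1) smooth_atlas_prod[OF assms(2,3)] chart_at_maximal[OF assms(1)]
        prod_chart_maximal[OF assms(2,3)] smooth_in_charts_Pair[OF maximal_chart[OF chart_at_maximal[OF assms(1)]] *]] chart_at)
qed

lemma smooth_at_fst:
  assumes A: "smooth_atlas A" and B: "smooth_atlas B" and p: "p \<in> points A \<times> points B"
  shows "smooth_at (prod_atlas A B) A fst p" "smooth_at (prod_atlas A B) B snd p"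
proof -
  have p: "fst p \<in> points A" "snd p \<in> points B"
    using assms(3) by auto
  have c: "is_chart (chart_at A (fst p))" "is_chart (chart_at B (snd p))"
    by (rule maximal_chart[OF chart_at_maximal[OF A p(1)]] maximal_chart[OF chart_at_maximal[OF B p(2)]])+
  have "p \<in> fst (chart_at A (fst p)) \<times> fst (chart_at B (snd p))"
    using p chart_at by (metis SigmaI prod.collapse)
  note * = smooth_in_charts_fst[OF c this]
  show "smooth_at (prod_atlas A B) A fst p"
    by (rule smooth_atI[OF smooth_atlas_prod[OF A B] A prod_chart_maximal[OF A B] chart_at_maximal[OF A] *(1)])
      (use p chart_at in auto)
  show "smooth_at (prod_atlas A B) B snd p"
    by (rule smooth_atI[OF smooth_atlas_prod[OF A B] B prod_chart_maximal[OF A B] chart_at_maximal[OF B] *(2)])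
      (use p chart_at in auto)
qed

subsection \<open>Submanifolds\<close>

text \<open>The source of all slice charts: a chart followed by a diffeomorphism \<open>h\<close>
  between open sets of the model space. The change of coordinates back to \<open>c\<close> is the
  inverse \<open>k\<close>, whose derivative identifies tangent vectors in the new chart.\<close>

lemma maximal_atlas_restrict:
  fixes A :: "('m, 'e::finite_dim_inner) atlas"
  assumes A: "smooth_atlas A" and c: "c \<in> maximal_atlas A"
    and U: "open U" "U \<subseteq> snd c ` fst c" and V: "open V" "h ` U = V"
    and h: "smooth_on U h" and k: "smooth_on V k" "\<And>x. x \<in> U \<Longrightarrow> k (h x) = x"
  defines "c' \<equiv> (fst c \<inter> snd c -` U, \<lambda>p. h (snd c p))"
  shows "c' \<in> maximal_atlas A"
    "\<And>p. p \<in> fst c' \<Longrightarrow> chart_deriv c' c (\<lambda>x. x) p = frechet_derivative k (at (h (snd c p)))"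
proof -
  note ch = maximal_chart[OF c]
  have c'_simps: "fst c' = fst c \<inter> snd c -` U" "snd c' p = h (snd c p)" for p
    by (simp_all add: c'_def)
  have image: "snd c ` (fst c \<inter> snd c -` U) = U"
    using U(2) by auto
  have inj: "inj_on (snd c') (fst c')"
  proof (rule inj_onI)
    fix p q assume *: "p \<in> fst c'" "q \<in> fst c'" "snd c' p = snd c' q"
    then have "snd c p = snd c q"
      using k(2) by (metis IntE c'_simps vimageD)
    with * show "p = q"
      using is_chart_inj[OF ch] by (auto simp: c'_simps inj_on_def)
  qed
  have image': "snd c' ` fst c' = V"
  proof -
    have "snd c' ` fst c' = h ` snd c ` (fst c \<inter> snd c -` U)"
      by (simp add: c'_def image_image)
    then show ?thesis
      unfolding image V(2) .
  qed
  have ch': "is_chart c'"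
    using inj V(1) by (simp add: is_chart_def image')
  have inv': "chart_inv c' y = chart_inv c (k y)" and kU: "k y \<in> U" if y: "y \<in> V" for y
  proof -
    obtain x where x: "x \<in> U" "y = h x"
      using y V(2) by auto
    then obtain p where p: "p \<in> fst c" "x = snd c p"
      using U(2) by auto
    have "p \<in> fst c'" "snd c' p = y"
      using x p by (simp_all add: c'_simps)
    then show "chart_inv c' y = chart_inv c (k y)"
      using chart_inv_chart[OF ch'] chart_inv_chart[OF ch p(1)] x p k(2) by metis
    show "k y \<in> U"
      using x k(2) by simp
  qed
  have c'c: "smooth_in_charts c' c (\<lambda>x. x) p" "chart_deriv c' c (\<lambda>x. x) p = frechet_derivative k (at (snd c' p))"
    if p: "p \<in> fst c'" for p
  proof -
    have 1: "snd c' p \<in> V" "V \<subseteq> snd c' ` fst c'"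
      using p image' by auto
    have 2: "chart_inv c' x \<in> fst c" "snd c (chart_inv c' x) = k x" if "x \<in> V" for x
      using kU[OF that] U(2) by (auto simp: inv'[OF that] inv_into_into f_inv_into_f subset_iff)
    note * = smooth_in_chartsI[of p c' V "\<lambda>x. x" c k, OF p V(1) 1 2 k(1)]
    show "smooth_in_charts c' c (\<lambda>x. x) p" "chart_deriv c' c (\<lambda>x. x) p = frechet_derivative k (at (snd c' p))"
      by (rule *; assumption)+
  qed
  have cc': "smooth_in_charts c c' (\<lambda>x. x) p" if p: "p \<in> fst c'" for p
  proof -
    have p': "p \<in> fst c" "snd c p \<in> U"
      using p by (simp_all add: c'_simps)
    have 2: "chart_inv c x \<in> fst c'" "snd c' (chart_inv c x) = h x" if "x \<in> U" for x
      using that U(2) by (auto simp: c'_simps inv_into_into f_inv_into_f subset_iff)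
    show ?thesis
      by (rule smooth_in_chartsI(1)[where f = "\<lambda>x. x", OF p'(1) U(1) p'(2) U(2) 2 h])
  qed
  have "smooth_transition c' d \<and> smooth_transition d c'" if d: "d \<in> A" for d
  proof
    note chd = maximal_chart[OF atlas_subset_maximal[OF A d]]
    have sub: "p \<in> fst c" if "p \<in> fst c'" for p
      using that by (simp add: c'_simps)
    show "smooth_transition c' d"
    proof (rule smooth_transitionI[OF ch'])
      fix p assume p: "p \<in> fst c'" "p \<in> fst d"
      show "smooth_in_charts c' d (\<lambda>x. x) p"
        using smooth_in_charts_compose(1)[OF ch' ch c'c(1)[OF p(1)]
            smooth_in_charts_id[OF A c sub[OF p(1)] atlas_subset_maximal[OF A d] p(2)]] .
    qed
    show "smooth_transition d c'"
    proof (rule smooth_transitionI[OF chd])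
      fix p assume p: "p \<in> fst d" "p \<in> fst c'"
      show "smooth_in_charts d c' (\<lambda>x. x) p"
        using smooth_in_charts_compose(1)[OF chd ch
            smooth_in_charts_id[OF A atlas_subset_maximal[OF A d] p(1) c sub[OF p(2)]] cc'[OF p(2)]] .
    qed
  qed
  then show "c' \<in> maximal_atlas A"
    using ch' c by (auto simp: maximal_atlas_def c'_simps)
  show "\<And>p. p \<in> fst c' \<Longrightarrow> chart_deriv c' c (\<lambda>x. x) p = frechet_derivative k (at (h (snd c p)))"
    using c'c(2) by (simp add: c'_simps)
qed

lemma from_chart_euclidean: "from_chart euclidean_atlas (UNIV, \<lambda>x. x) p v = v"
  using from_chart_chart_at[OF euclidean_atlas, of p v] by simp

lemma velocity_eq:
  assumes A: "smooth_atlas A" and \<gamma>: "smooth_at euclidean_atlas A \<gamma> t"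
    and c: "c \<in> maximal_atlas A" "\<gamma> t \<in> fst c"
  shows "velocity A \<gamma> t = from_chart A c (\<gamma> t) (chart_deriv (UNIV, \<lambda>x. x) c \<gamma> t 1)"
proof -
  have "velocity A \<gamma> t = tangent_map euclidean_atlas A \<gamma> t 1"
  proof -
    let ?d = "chart_at A (\<gamma> t)"
    have d: "?d \<in> maximal_atlas A" "\<gamma> t \<in> fst ?d"
      using \<gamma> chart_at_maximal[OF A] chart_at(2) by (auto simp: smooth_at_def)
    have "smooth_in_charts (UNIV, \<lambda>x. x) ?d \<gamma> t"
      using smooth_at_charts(1)[OF euclidean_atlas A \<gamma> euclidean_chart _ d] by simp
    then obtain U where "t \<in> U" "smooth_on U (snd ?d \<circ> \<gamma>)"
      by (auto simp: smooth_in_charts_def o_def)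
    then have D: "((snd ?d \<circ> \<gamma>) has_derivative frechet_derivative (snd ?d \<circ> \<gamma>) (at t)) (at t)"
      by (metis smooth_on_has_derivative)
    have "vector_derivative (snd ?d \<circ> \<gamma>) (at t) = frechet_derivative (snd ?d \<circ> \<gamma>) (at t) 1"
      using frechet_derivative_eq_vector_derivative[OF differentiableI[OF D]] by simp
    then show ?thesis
      by (simp add: velocity_def tangent_map_def o_def)
  qed
  then show ?thesis
    using smooth_at_charts(2)[OF euclidean_atlas A \<gamma> euclidean_chart _ c] by (simp add: from_chart_euclidean)
qed

text \<open>A straight line in a slice chart through \<open>p\<close> with direction in
  \<open>V\<close> is, for small times, the image of a curve in \<open>S\<close>.\<close>

lemma slice_chart_tangent:
  assumes A: "smooth_atlas A" and c: "slice_chart A S c V" and p: "p \<in> fst c" "p \<in> S" and v: "v \<in> V"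
  shows "from_chart A c p v \<in> tangent_space A S p"
proof -
  have cm: "c \<in> maximal_atlas A" and V: "subspace V" and slice: "snd c ` (fst c \<inter> S) = snd c ` fst c \<inter> V"
    using c by (auto simp: slice_chart_def)
  note ch = maximal_chart[OF cm]
  let ?l = "\<lambda>t::real. snd c p + t *\<^sub>R v"
  define \<gamma> where "\<gamma> t = chart_inv c (?l t)" for t
  have "open (?l -` (snd c ` fst c))"
    by (intro open_vimage is_chart_open[OF ch] continuous_intros)
  moreover have "0 \<in> ?l -` (snd c ` fst c)"
    using p by simp
  ultimately obtain \<epsilon> where \<epsilon>: "\<epsilon> > 0" "ball 0 \<epsilon> \<subseteq> ?l -` (snd c ` fst c)"
    using open_contains_ball by blast
  have l: "?l t \<in> snd c ` fst c" if "t \<in> {-\<epsilon><..<\<epsilon>}" for t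
    using \<epsilon>(2) that by (auto simp: subset_iff abs_less_iff)
  have \<gamma>0: "\<gamma> 0 = p"
    using chart_inv_chart[OF ch p(1)] by (simp add: \<gamma>_def)
  have \<gamma>S: "\<gamma> t \<in> S" if t: "t \<in> {-\<epsilon><..<\<epsilon>}" for t
  proof -
    have "snd c p \<in> V"
      using p slice by blast
    then have "?l t \<in> V"
      using V v by (simp add: subspace_add subspace_scale)
    then obtain q where "q \<in> fst c" "q \<in> S" "?l t = snd c q"
      using l[OF t] slice by blast
    then show ?thesis
      using chart_inv_chart[OF ch] by (simp add: \<gamma>_def)
  qed
  have sm: "smooth_in_charts (UNIV, \<lambda>x. x) c \<gamma> t"
    and der: "chart_deriv (UNIV, \<lambda>x. x) c \<gamma> t = frechet_derivative ?l (at t)" if t: "t \<in> {-\<epsilon><..<\<epsilon>}" for t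
  proof -
    have "smooth_on {-\<epsilon><..<\<epsilon>} ?l"
      by (intro smooth_intros) auto
    then show "smooth_in_charts (UNIV, \<lambda>x. x) c \<gamma> t"
      "chart_deriv (UNIV, \<lambda>x. x) c \<gamma> t = frechet_derivative ?l (at t)"
      using smooth_in_chartsI[of t "(UNIV, \<lambda>x. x)" "{-\<epsilon><..<\<epsilon>}" \<gamma> c ?l] l t
      by (auto simp: \<gamma>_def inv_into_into f_inv_into_f)
  qed
  have sm_at: "smooth_at euclidean_atlas A \<gamma> t" if "t \<in> {-\<epsilon><..<\<epsilon>}" for t
    by (rule smooth_atI[OF euclidean_atlas A euclidean_chart cm sm[OF that]])
  have "smooth_map_on euclidean_atlas A {-\<epsilon><..<\<epsilon>} \<gamma>"
    by (rule smooth_map_onI[OF euclidean_atlas A _ sm_at]) (auto simp: euclidean_atlas_def)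
  moreover have "velocity A \<gamma> 0 = from_chart A c p v"
  proof -
    have "(?l has_derivative (\<lambda>s. s *\<^sub>R v)) (at 0)"
      by (auto intro!: derivative_eq_intros)
    then have "frechet_derivative ?l (at 0) 1 = v"
      using frechet_derivative_at by (metis scaleR_one)
    then show ?thesis
      using velocity_eq[OF A sm_at cm, of 0] der[of 0] \<epsilon>(1) p \<gamma>0 by simp
  qed
  ultimately show ?thesis
    unfolding tangent_space_def using \<gamma>0 \<gamma>S \<epsilon>(1)
    by (intro CollectI exI[of _ \<gamma>] conjI exI[of _ \<epsilon>]) auto
qed

lemma tangent_space_mono: "S \<subseteq> S' \<Longrightarrow> tangent_space A S p \<subseteq> tangent_space A S' p"
  unfolding tangent_space_def by blast

text \<open>Reduces a tangent vector to first-order data of a curve in the coordinates of any chart,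
  the form in which an equation for \<open>S\<close> can be differentiated.\<close>

lemma tangent_spaceE:
  assumes A: "smooth_atlas A" and u: "u \<in> tangent_space A S p" and c: "c \<in> maximal_atlas A" "p \<in> fst c"
  obtains x x' \<epsilon> where "(x has_derivative (\<lambda>t. t *\<^sub>R x')) (at 0)" "x 0 = snd c p" "u = from_chart A c p x'" "\<epsilon> > 0"
    "\<And>t. \<bar>t\<bar> < \<epsilon> \<Longrightarrow> x t \<in> snd c ` (fst c \<inter> S)"
proof -
  obtain \<gamma> \<epsilon> where \<gamma>: "u = velocity A \<gamma> 0" "\<gamma> 0 = p" "\<epsilon> > 0"
    "smooth_map_on euclidean_atlas A {-\<epsilon><..<\<epsilon>} \<gamma>" "\<gamma> ` {-\<epsilon><..<\<epsilon>} \<subseteq> S"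
    using u by (auto simp: tangent_space_def)
  have sm: "smooth_at euclidean_atlas A \<gamma> 0"
    by (rule smooth_map_on_imp_smooth_at[OF euclidean_atlas \<gamma>(4)]) (use \<gamma>(3) in auto)
  have ch0: "is_chart ((UNIV, \<lambda>x. x) :: (real, real) chart)"
    by (rule maximal_chart[OF euclidean_chart])
  have sc: "smooth_in_charts (UNIV, \<lambda>x. x) c \<gamma> 0"
    using smooth_at_charts(1)[OF euclidean_atlas A sm euclidean_chart _ c(1)] c(2) \<gamma>(2) by simp
  then obtain U where U: "open U" "0 \<in> U" "\<And>t. t \<in> U \<Longrightarrow> \<gamma> t \<in> fst c" "smooth_on U (\<lambda>t. snd c (\<gamma> t))"
    by (auto simp: smooth_in_charts_def o_def)
  obtain \<delta> where \<delta>: "\<delta> > 0" "ball 0 \<delta> \<subseteq> U"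
    using U open_contains_ball by blast
  let ?D = "frechet_derivative (\<lambda>t. snd c (\<gamma> t)) (at 0)"
  have D: "((\<lambda>t. snd c (\<gamma> t)) has_derivative ?D) (at 0)"
    using smooth_on_has_derivative U by blast
  have lin: "?D = (\<lambda>t. t *\<^sub>R ?D 1)"
  proof
    show "?D t = t *\<^sub>R ?D 1" for t
      using linear_scale[OF has_derivative_linear[OF D], of t 1] by simp
  qed
  have D': "((\<lambda>t. snd c (\<gamma> t)) has_derivative (\<lambda>t. t *\<^sub>R ?D 1)) (at 0)"
    using D by (subst (asm) lin)
  have u_eq: "u = from_chart A c p (?D 1)"
    using velocity_eq[OF A sm c(1)] c(2) \<gamma>(1,2) by (simp add: chart_deriv_def o_def)
  have mem: "snd c (\<gamma> t) \<in> snd c ` (fst c \<inter> S)" if "\<bar>t\<bar> < min \<epsilon> \<delta>" for t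
    using that U(3)[of t] \<delta>(2) \<gamma>(5) by (auto simp: subset_iff abs_less_iff image_subset_iff)
  show ?thesis
    by (rule that[OF D' _ u_eq, of "min \<epsilon> \<delta>"]) (use \<gamma>(2,3) \<delta>(1) mem in auto)
qed

section \<open>The cotangent bundle\<close>

lemma covec_linear:
  assumes "linear \<alpha>" "linear l"
  shows "v \<bullet> covec (\<alpha> \<circ> l) = \<alpha> (l v)"
  using inner_covec[OF linear_compose[OF assms(2,1)], of v] by simp

lemma cotangent_chart_simps:
  "fst (cotangent_chart A c) = {\<zeta> \<in> cotangent_bundle A. fst \<zeta> \<in> fst c}"
  "snd (cotangent_chart A c) \<zeta> = (snd c (fst \<zeta>), covec (snd \<zeta> \<circ> from_chart A c (fst \<zeta>)))"
  by (simp_all add: cotangent_chart_def)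

lemma cotangent_bundle_iff: "\<zeta> \<in> cotangent_bundle A \<longleftrightarrow> fst \<zeta> \<in> points A \<and> linear (snd \<zeta>)"
  by (cases \<zeta>) (simp add: cotangent_bundle_def)

lemma inner_cotangent_chart:
  assumes "smooth_atlas A" "c \<in> A" "\<zeta> \<in> fst (cotangent_chart A c)"
  shows "v \<bullet> snd (snd (cotangent_chart A c) \<zeta>) = snd \<zeta> (from_chart A c (fst \<zeta>) v)"
  using assms from_chart_linear[OF assms(1) atlas_subset_maximal[OF assms(1,2)]]
  by (simp add: cotangent_chart_simps cotangent_bundle_iff covec_linear)

lemma cotangent_chart_inverse:
  fixes A :: "('m, 'e::finite_dim_inner) atlas" and y :: 'e
  assumes A: "smooth_atlas A" and c: "c \<in> A" and p: "p \<in> fst c"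
  defines "\<xi> \<equiv> (p, \<lambda>v. into_chart A c p v \<bullet> y)"
  shows "\<xi> \<in> fst (cotangent_chart A c)" "snd (cotangent_chart A c) \<xi> = (snd c p, y)"
proof -
  have cm: "c \<in> maximal_atlas A"
    using A c by (rule atlas_subset_maximal)
  have lin: "linear (\<lambda>v. into_chart A c p v \<bullet> y)"
    using linear_compose[OF into_chart_linear[OF A cm p], of "\<lambda>v. v \<bullet> y"]
    by (simp add: o_def bounded_linear.linear bounded_linear_inner_left)
  then show "\<xi> \<in> fst (cotangent_chart A c)"
    using p maximal_points[OF cm p] by (simp add: \<xi>_def cotangent_chart_simps cotangent_bundle_iff)
  have "covec ((\<lambda>v. into_chart A c p v \<bullet> y) \<circ> from_chart A c p) = y"
    by (rule covec_eqI) (simp add: into_from_chart[OF A cm p])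
  then show "snd (cotangent_chart A c) \<xi> = (snd c p, y)"
    by (simp add: \<xi>_def cotangent_chart_simps)
qed

lemma cotangent_chart_image:
  fixes A :: "('m, 'e::finite_dim_inner) atlas"
  assumes "smooth_atlas A" "c \<in> A"
  shows "snd (cotangent_chart A c) ` fst (cotangent_chart A c) = snd c ` fst c \<times> UNIV"
proof (intro equalityI subsetI)
  fix z assume "z \<in> snd c ` fst c \<times> (UNIV :: 'e set)"
  then obtain p where "p \<in> fst c" "z = (snd c p, snd z)"
    by auto
  then show "z \<in> snd (cotangent_chart A c) ` fst (cotangent_chart A c)"
    using cotangent_chart_inverse[OF assms, of p "snd z"] by (metis rev_image_eqI)
qed (auto simp: cotangent_chart_simps)

lemma is_chart_cotangent:
  fixes A :: "('m, 'e::finite_dim_inner) atlas"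
  assumes A: "smooth_atlas A" and c: "c \<in> A"
  shows "is_chart (cotangent_chart A c)"
  unfolding is_chart_def
proof
  have cm: "c \<in> maximal_atlas A"
    using A c by (rule atlas_subset_maximal)
  show "inj_on (snd (cotangent_chart A c)) (fst (cotangent_chart A c))"
  proof (rule inj_onI)
    fix \<zeta> \<xi> assume *: "\<zeta> \<in> fst (cotangent_chart A c)" "\<xi> \<in> fst (cotangent_chart A c)"
      "snd (cotangent_chart A c) \<zeta> = snd (cotangent_chart A c) \<xi>"
    then have p: "fst \<zeta> \<in> fst c" "fst \<xi> = fst \<zeta>"
      using is_chart_inj[OF maximal_chart[OF cm]] by (auto simp: cotangent_chart_simps inj_on_def)
    have "snd \<zeta> (from_chart A c (fst \<zeta>) v) = snd \<xi> (from_chart A c (fst \<zeta>) v)" for v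
      using inner_cotangent_chart[OF A c *(1), of v] inner_cotangent_chart[OF A c *(2), of v] *(3) p by simp
    from this[of "into_chart A c (fst \<zeta>) _"] have "snd \<zeta> v = snd \<xi> v" for v
      by (simp add: into_from_chart[OF A cm p(1)])
    then show "\<zeta> = \<xi>"
      using p by (auto simp: prod_eq_iff)
  qed
  show "open (snd (cotangent_chart A c) ` fst (cotangent_chart A c))"
    using is_chart_open[OF maximal_chart[OF cm]] by (simp add: cotangent_chart_image[OF A c] open_Times)
qed

lemma chart_inv_cotangent:
  assumes A: "smooth_atlas A" and c: "c \<in> A" and x: "x \<in> snd c ` fst c"
  shows "chart_inv (cotangent_chart A c) (x, y) =
    (chart_inv c x, \<lambda>v. into_chart A c (chart_inv c x) v \<bullet> y)"
proof -
  have p: "chart_inv c x \<in> fst c"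
    using x by (rule inv_into_into)
  show ?thesis
    using chart_inv_chart[OF is_chart_cotangent[OF A c] cotangent_chart_inverse(1)[OF A c p, of y]]
      cotangent_chart_inverse(2)[OF A c p, of y] x by (simp add: f_inv_into_f)
qed

text \<open>Covector coordinates transform by the transposed derivative of the inverse transition
  \<open>\<psi>'\<close> of the base. Written as a sum over \<open>onb\<close> by
  \<open>covec_onb\<close>, this is smooth jointly in the point and the covector.\<close>

lemma smooth_in_charts_cotangent:
  fixes A :: "('m, 'e::finite_dim_inner) atlas"
  assumes A: "smooth_atlas A" and c: "c \<in> A" and d: "d \<in> A" and \<zeta>: "\<zeta> \<in> cotangent_bundle A" "fst \<zeta> \<in> fst c" "fst \<zeta> \<in> fst d"
  shows "smooth_in_charts (cotangent_chart A c) (cotangent_chart A d) (\<lambda>\<xi>. \<xi>) \<zeta>"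
proof -
  have cm: "c \<in> maximal_atlas A" and dm: "d \<in> maximal_atlas A"
    using A c d by (auto intro: atlas_subset_maximal)
  note ch = maximal_chart[OF cm] and dh = maximal_chart[OF dm]
  define U where "U = snd c ` (fst c \<inter> fst d)"
  define \<psi> where "\<psi> = snd d \<circ> chart_inv c"
  define \<psi>' where "\<psi>' = snd c \<circ> chart_inv d"
  have tr: "smooth_transition c d" "smooth_transition d c"
    using A c d by (auto simp: smooth_atlas_def)
  then have U: "open U" "smooth_on U \<psi>" and U': "open (snd d ` (fst d \<inter> fst c))" "smooth_on (snd d ` (fst d \<inter> fst c)) \<psi>'"
    by (simp_all add: U_def \<psi>_def \<psi>'_def smooth_transition_def)
  have \<psi>U: "\<psi> ` U \<subseteq> snd d ` (fst d \<inter> fst c)"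
    using chart_inv_chart[OF ch] by (auto simp: U_def \<psi>_def)
  define h where "h z = (\<psi> (fst z), \<Sum>b\<in>onb. (frechet_derivative \<psi>' (at (\<psi> (fst z))) b \<bullet> snd z) *\<^sub>R b)" for z
  define W where "W = U \<times> (UNIV :: 'e set)"
  have oW: "open W"
    using U by (simp add: W_def open_Times)
  have 1: "smooth_on (W) (\<lambda>z. \<psi> (fst z))"
    by (rule smooth_on_compose[OF oW U(1) _ smooth_on_linear[OF linear_fst] U(2)]) (auto simp: W_def)
  have "smooth_on (W) h"
    unfolding h_def
    by (intro smooth_on_Pair smooth_on_sum smooth_on_scaleR smooth_on_inner smooth_on_const
        smooth_on_frechet_apply[OF oW U'(1) _ U'(2) 1] smooth_on_linear[OF linear_snd] 1 oW)
      (use \<psi>U in \<open>auto simp: W_def\<close>)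
  moreover have "chart_inv (cotangent_chart A c) z \<in> fst (cotangent_chart A d) \<and>
      snd (cotangent_chart A d) (chart_inv (cotangent_chart A c) z) = h z" if z: "z \<in> W" for z
  proof -
    obtain p y where p: "p \<in> fst c" "p \<in> fst d" and z_eq: "z = (snd c p, y)"
      using z by (auto simp: U_def W_def)
    have inv: "chart_inv c (snd c p) = p"
      using p ch by (simp add: chart_inv_chart)
    have ci: "chart_inv (cotangent_chart A c) z = (p, \<lambda>v. into_chart A c p v \<bullet> y)"
      using chart_inv_cotangent[OF A c, of "snd c p" y] p(1) by (simp add: z_eq inv)
    have lin: "linear (\<lambda>v. into_chart A c p v \<bullet> y)"
      using cotangent_chart_inverse(1)[OF A c p(1)] by (simp add: cotangent_chart_simps cotangent_bundle_iff)
    have deriv: "frechet_derivative \<psi>' (at (\<psi> (snd c p))) v = into_chart A c p (from_chart A d p v)" for v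
    proof -
      have "frechet_derivative \<psi>' (at (\<psi> (snd c p))) v = chart_deriv d c (\<lambda>x. x) p v"
        by (simp add: chart_deriv_def \<psi>'_def \<psi>_def inv o_def)
      also have "\<dots> = into_chart A c p (from_chart A c p (chart_deriv d c (\<lambda>x. x) p v))"
        by (simp add: into_from_chart[OF A cm p(1)])
      finally show ?thesis
        by (simp add: from_chart_transition[OF A dm p(2) cm p(1)])
    qed
    have "covec ((\<lambda>v. into_chart A c p v \<bullet> y) \<circ> from_chart A d p) =
        (\<Sum>b\<in>onb. (into_chart A c p (from_chart A d p b) \<bullet> y) *\<^sub>R b)"
      using covec_onb[OF linear_compose[OF from_chart_linear[OF A dm p(2)] lin]] by simp
    then have "snd (cotangent_chart A d) (p, \<lambda>v. into_chart A c p v \<bullet> y) = h z"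
      unfolding h_def z_eq fst_conv snd_conv deriv by (simp add: cotangent_chart_simps \<psi>_def inv)
    moreover have "(p, \<lambda>v. into_chart A c p v \<bullet> y) \<in> fst (cotangent_chart A d)"
      using lin p maximal_points[OF dm p(2)] by (simp add: cotangent_chart_simps cotangent_bundle_iff)
    ultimately show ?thesis
      by (simp add: ci)
  qed
  moreover have "snd (cotangent_chart A c) \<zeta> \<in> W" "\<zeta> \<in> fst (cotangent_chart A c)"
    using \<zeta> by (auto simp: cotangent_chart_simps U_def W_def)
  moreover have "W \<subseteq> snd (cotangent_chart A c) ` fst (cotangent_chart A c)"
    unfolding cotangent_chart_image[OF A c] by (auto simp: U_def W_def)
  ultimately show ?thesis
    using oW by (intro smooth_in_chartsI(1)[where U = "W" and h = h]) auto
qed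

lemma smooth_atlas_cotangent:
  assumes A: "smooth_atlas A"
  shows "smooth_atlas (cotangent_atlas A)"
  unfolding smooth_atlas_def cotangent_atlas_def
  using is_chart_cotangent[OF A] smooth_in_charts_cotangent[OF A]
  by (auto intro!: smooth_transitionI simp: cotangent_chart_simps)

lemma points_cotangent [simp]: "points (cotangent_atlas A) = cotangent_bundle A"
proof -
  have "\<zeta> \<in> points (cotangent_atlas A) \<longleftrightarrow> (\<exists>c\<in>A. \<zeta> \<in> cotangent_bundle A \<and> fst \<zeta> \<in> fst c)" for \<zeta>
    by (simp add: points_def cotangent_atlas_def cotangent_chart_simps)
  moreover have "(\<exists>c\<in>A. \<zeta> \<in> cotangent_bundle A \<and> fst \<zeta> \<in> fst c) \<longleftrightarrow> \<zeta> \<in> cotangent_bundle A" for \<zeta>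
    unfolding cotangent_bundle_iff points_def by blast
  ultimately show ?thesis
    by (simp only: set_eq_iff simp_thms)
qed

lemma cotangent_chart_maximal:
  "smooth_atlas A \<Longrightarrow> c \<in> A \<Longrightarrow> cotangent_chart A c \<in> maximal_atlas (cotangent_atlas A)"
  by (rule atlas_subset_maximal[OF smooth_atlas_cotangent]) (auto simp: cotangent_atlas_def)

lemma smooth_in_charts_proj:
  fixes A :: "('m, 'e::finite_dim_inner) atlas"
  assumes A: "smooth_atlas A" and c: "c \<in> A" and \<zeta>: "\<zeta> \<in> fst (cotangent_chart A c)"
  shows "smooth_in_charts (cotangent_chart A c) c fst \<zeta>" "chart_deriv (cotangent_chart A c) c fst \<zeta> w = fst w"
proof -
  have ch: "is_chart c"
    using A c by (simp add: smooth_atlas_def)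
  have *: "fst (chart_inv (cotangent_chart A c) z) \<in> fst c" "snd c (fst (chart_inv (cotangent_chart A c) z)) = fst z"
    if "z \<in> snd c ` fst c \<times> UNIV" for z
    using that chart_inv_cotangent[OF A c, of "fst z" "snd z"] by (auto simp: inv_into_into f_inv_into_f)
  note I = smooth_in_chartsI[of \<zeta> "cotangent_chart A c" "snd c ` fst c \<times> UNIV" fst c fst, OF \<zeta> _ _ _ * smooth_on_linear[OF linear_fst]]
  have U: "open (snd c ` fst c \<times> (UNIV :: 'e set))" "snd (cotangent_chart A c) \<zeta> \<in> snd c ` fst c \<times> UNIV"
    "snd c ` fst c \<times> UNIV \<subseteq> snd (cotangent_chart A c) ` fst (cotangent_chart A c)"
    using imageI[OF \<zeta>, of "snd (cotangent_chart A c)"] is_chart_open[OF ch]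
    unfolding cotangent_chart_image[OF A c] by (auto simp: open_Times)
  show "smooth_in_charts (cotangent_chart A c) c fst \<zeta>"
    by (rule I(1)[OF U])
  have "chart_deriv (cotangent_chart A c) c fst \<zeta> = frechet_derivative fst (at (snd (cotangent_chart A c) \<zeta>))"
    by (rule I(2)[OF U])
  then show "chart_deriv (cotangent_chart A c) c fst \<zeta> w = fst w"
    using frechet_derivative_at[OF bounded_linear_imp_has_derivative[OF bounded_linear_fst]] by metis
qed

lemma smooth_at_proj:
  assumes A: "smooth_atlas A" and \<zeta>: "\<zeta> \<in> cotangent_bundle A"
  shows "smooth_at (cotangent_atlas A) A fst \<zeta>"
proof -
  have p: "fst \<zeta> \<in> points A"
    using \<zeta> by (simp add: cotangent_bundle_iff)
  have "\<zeta> \<in> fst (cotangent_chart A (chart_at A (fst \<zeta>)))"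
    using \<zeta> chart_at[OF p] by (simp add: cotangent_chart_simps)
  then show ?thesis
    by (intro smooth_atI[OF smooth_atlas_cotangent[OF A] A cotangent_chart_maximal[OF A]
          chart_at_maximal[OF A p] smooth_in_charts_proj(1)[OF A]] chart_at p)
qed

subsection \<open>The canonical 2-form in charts\<close>

text \<open>The coordinate formula y dx: in a cotangent chart the projection is \<open>fst\<close>,
  and the second coordinate is the vector representing the covector.\<close>

lemma liouville_form_chart:
  assumes A: "smooth_atlas A" and c: "c \<in> A" and \<zeta>: "\<zeta> \<in> fst (cotangent_chart A c)"
  shows "liouville_form A \<zeta> (from_chart (cotangent_atlas A) (cotangent_chart A c) \<zeta> w) =
    snd (snd (cotangent_chart A c) \<zeta>) \<bullet> fst w"
proof -
  have \<zeta>': "\<zeta> \<in> cotangent_bundle A" "fst \<zeta> \<in> fst c"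
    using \<zeta> by (auto simp: cotangent_chart_simps)
  show ?thesis
    unfolding liouville_form_def
      smooth_at_charts(2)[OF smooth_atlas_cotangent[OF A] A smooth_at_proj[OF A \<zeta>'(1)]
        cotangent_chart_maximal[OF A c] \<zeta> atlas_subset_maximal[OF A c] \<zeta>'(2), symmetric]
      smooth_in_charts_proj(2)[OF A c \<zeta>]
    using inner_cotangent_chart[OF A c \<zeta>, of "fst w"] by (simp add: inner_commute)
qed

text \<open>The constant form dy wedge dx, that is, the exterior derivative of y dx with the sign
  convention of \<open>ext_deriv\<close>.\<close>

definition standard_form :: "'e::real_inner \<times> 'e \<Rightarrow> 'e \<times> 'e \<Rightarrow> real" where
  "standard_form u v = snd u \<bullet> fst v - snd v \<bullet> fst u"

lemma canonical_form_chart_at: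
  assumes A: "smooth_atlas A" and \<zeta>: "\<zeta> \<in> cotangent_bundle A"
  shows "canonical_form A \<zeta> u v = standard_form u v"
proof -
  let ?T = "cotangent_atlas A"
  have \<zeta>T: "\<zeta> \<in> points ?T"
    using \<zeta> by simp
  obtain d where d: "d \<in> A" "chart_at ?T \<zeta> = cotangent_chart A d"
    using chart_at(1)[OF \<zeta>T] by (auto simp: cotangent_atlas_def)
  let ?c = "cotangent_chart A d"
  have \<zeta>c: "\<zeta> \<in> fst ?c"
    using chart_at(2)[OF \<zeta>T] d by simp
  have "frechet_derivative (\<lambda>x. liouville_form A (chart_inv ?c x) (from_chart ?T ?c (chart_inv ?c x) v)) (at (snd ?c \<zeta>)) u
      = snd u \<bullet> fst v" for u v
  proof -
    have "frechet_derivative (\<lambda>x. liouville_form A (chart_inv ?c x) (from_chart ?T ?c (chart_inv ?c x) v)) (at (snd ?c \<zeta>))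
        = frechet_derivative (\<lambda>x. snd x \<bullet> fst v) (at (snd ?c \<zeta>))"
    proof (rule frechet_derivative_cong_open[OF is_chart_open[OF is_chart_cotangent[OF A d(1)]]])
      show "liouville_form A (chart_inv ?c x) (from_chart ?T ?c (chart_inv ?c x) v) = snd x \<bullet> fst v"
        if x: "x \<in> snd ?c ` fst ?c" for x
        unfolding liouville_form_chart[OF A d(1) inv_into_into[OF x]] f_inv_into_f[OF x] ..
    qed (use \<zeta>c in auto)
    moreover have "((\<lambda>x. snd x \<bullet> fst v) has_derivative (\<lambda>u. snd u \<bullet> fst v)) (at (snd ?c \<zeta>))"
      by (auto intro!: derivative_eq_intros)
    ultimately show ?thesis
      using frechet_derivative_at by metis
  qed
  then show ?thesis
    by (simp add: canonical_form_def ext_deriv_def d Let_def standard_form_def)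
qed

text \<open>\<open>ext_deriv\<close> computes in the preferred chart, so independence of the chart
  needs an argument. The transition \<open>\<tau>\<close> between two cotangent charts preserves y
  dx; differentiating this identity and antisymmetrising removes the second derivative of
  \<open>\<tau>\<close> by its symmetry.\<close>

lemma canonical_form_chart:
  assumes A: "smooth_atlas A" and c: "c \<in> A" and \<zeta>: "\<zeta> \<in> fst (cotangent_chart A c)"
  shows "canonical_form A \<zeta> (from_chart (cotangent_atlas A) (cotangent_chart A c) \<zeta> u)
    (from_chart (cotangent_atlas A) (cotangent_chart A c) \<zeta> v) = standard_form u v"
proof -
  let ?T = "cotangent_atlas A" and ?c = "cotangent_chart A c"
  have T: "smooth_atlas ?T"
    by (rule smooth_atlas_cotangent[OF A])
  have \<zeta>': "\<zeta> \<in> cotangent_bundle A" and \<zeta>T: "\<zeta> \<in> points ?T"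
    using \<zeta> by (simp_all add: cotangent_chart_simps)
  obtain d where d: "d \<in> A" "chart_at ?T \<zeta> = cotangent_chart A d"
    using chart_at(1)[OF \<zeta>T] by (auto simp: cotangent_atlas_def)
  let ?d = "cotangent_chart A d"
  have cm: "?c \<in> maximal_atlas ?T" and dm: "?d \<in> maximal_atlas ?T"
    using cotangent_chart_maximal[OF A] c d by auto
  note ch = maximal_chart[OF cm]
  have \<zeta>d: "\<zeta> \<in> fst ?d"
    using chart_at(2)[OF \<zeta>T] d by simp
  define \<tau> where "\<tau> = snd ?d \<circ> (\<lambda>x. x) \<circ> chart_inv ?c"
  obtain U where U: "open U" "snd ?c \<zeta> \<in> U" "U \<subseteq> snd ?c ` fst ?c" "\<And>x. x \<in> U \<Longrightarrow> chart_inv ?c x \<in> fst ?d"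
    "smooth_on U \<tau>"
    using smooth_in_chartsE[OF smooth_in_charts_id[OF T cm \<zeta> dm \<zeta>d] ch] unfolding \<tau>_def by metis
  let ?D = "\<lambda>w x. frechet_derivative \<tau> (at x) w"
  have liouville: "snd (\<tau> x) \<bullet> fst (?D w x) = snd x \<bullet> fst w" if x: "x \<in> U" for x w
  proof -
    define \<xi> where "\<xi> = chart_inv ?c x"
    have \<xi>: "\<xi> \<in> fst ?c" "\<xi> \<in> fst ?d" "snd ?c \<xi> = x"
      using U(4)[OF x] subsetD[OF U(3) x] by (simp_all add: \<xi>_def inv_into_into f_inv_into_f)
    have "?D w x = chart_deriv ?c ?d (\<lambda>x. x) \<xi> w"
      by (simp add: chart_deriv_def \<tau>_def \<xi>(3))
    moreover have "\<tau> x = snd ?d \<xi>"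
      by (simp add: \<tau>_def \<xi>_def)
    ultimately show ?thesis
      using liouville_form_chart[OF A c \<xi>(1), of w] liouville_form_chart[OF A d(1) \<xi>(2), of "?D w x"]
        from_chart_transition[OF T cm \<xi>(1) dm \<xi>(2), of w] \<xi>(3) by simp
  qed
  let ?x = "snd ?c \<zeta>"
  have deriv: "snd (\<tau> ?x) \<bullet> fst (frechet_derivative (?D w) (at ?x) u) + snd (?D u ?x) \<bullet> fst (?D w ?x) = snd u \<bullet> fst w" for u w
  proof -
    have "(\<tau> has_derivative (\<lambda>u. ?D u ?x)) (at ?x)"
      using smooth_on_has_derivative[OF U(5,2)] .
    moreover have "(?D w has_derivative (\<lambda>u. frechet_derivative (?D w) (at ?x) u)) (at ?x)"
      using smooth_on_has_derivative[OF smooth_on_frechet_derivative[OF U(5)] U(2)] .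
    ultimately have "((\<lambda>x. snd (\<tau> x) \<bullet> fst (?D w x)) has_derivative
        (\<lambda>u. snd (\<tau> ?x) \<bullet> fst (frechet_derivative (?D w) (at ?x) u) + snd (?D u ?x) \<bullet> fst (?D w ?x))) (at ?x)"
      by (intro has_derivative_inner has_derivative_fst has_derivative_snd)
    moreover have "((\<lambda>x. snd x \<bullet> fst w) has_derivative (\<lambda>u. snd u \<bullet> fst w)) (at ?x)"
      by (auto intro!: derivative_eq_intros)
    then have "((\<lambda>x. snd (\<tau> x) \<bullet> fst (?D w x)) has_derivative (\<lambda>u. snd u \<bullet> fst w)) (at ?x)"
      using has_derivative_cong_open[OF U(1,2), of "\<lambda>x. snd (\<tau> x) \<bullet> fst (?D w x)" "\<lambda>x. snd x \<bullet> fst w"]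
        liouville by blast
    ultimately show ?thesis
      using has_derivative_unique by (metis (no_types, lifting))
  qed
  have "standard_form (?D u ?x) (?D v ?x) = standard_form u v"
    using deriv[of v u] deriv[of u v] second_derivative_symmetric[OF U(1,2,5), of u v]
    by (simp add: standard_form_def)
  moreover have "from_chart ?T ?c \<zeta> w = ?D w ?x" for w
    unfolding from_chart_eq d(2) by (simp add: chart_deriv_def \<tau>_def)
  ultimately show ?thesis
    by (simp add: canonical_form_chart_at[OF A \<zeta>'])
qed

text \<open>In a slice chart the components are those of a constant form pulled back along the
  transition \<open>\<Psi>\<close> to a cotangent chart. Each of the three derivatives gives two
  terms with a second derivative of \<open>\<Psi>\<close>; the six terms of the cyclic sum cancel in
  pairs, since the second derivative is symmetric and the form antisymmetric.\<close>

lemma induced_canonical_form_closed: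
  assumes A: "smooth_atlas A"
  shows "closed_form_on (cotangent_atlas A) S (induced_form (cotangent_atlas A) S (canonical_form A))"
  unfolding closed_form_on_def
proof (intro allI impI, unfold Let_def, intro ballI)
  let ?T = "cotangent_atlas A"
  fix c V x0 u v w
  assume c: "slice_chart ?T S c V" and x0: "x0 \<in> snd c ` fst c \<inter> V" and uvw: "u \<in> V" "v \<in> V" "w \<in> V"
  have T: "smooth_atlas ?T"
    by (rule smooth_atlas_cotangent[OF A])
  have cm: "c \<in> maximal_atlas ?T" and V: "subspace V" and slice: "snd c ` (fst c \<inter> S) = snd c ` fst c \<inter> V"
    using c by (auto simp: slice_chart_def)
  note ch = maximal_chart[OF cm]
  define \<beta> where "\<beta> x v w = induced_form ?T S (canonical_form A) (chart_inv c x)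
    (from_chart ?T c (chart_inv c x) v) (from_chart ?T c (chart_inv c x) w)" for x v w
  define \<zeta> where "\<zeta> = chart_inv c x0"
  have \<zeta>: "\<zeta> \<in> fst c" "snd c \<zeta> = x0"
    using x0 by (auto simp: \<zeta>_def inv_into_into f_inv_into_f)
  have \<zeta>T: "\<zeta> \<in> points ?T"
    by (rule maximal_points[OF cm \<zeta>(1)])
  obtain d where d: "d \<in> A" "\<zeta> \<in> fst (cotangent_chart A d)"
    using chart_at[OF \<zeta>T] by (auto simp: cotangent_atlas_def)
  let ?d = "cotangent_chart A d"
  have dm: "?d \<in> maximal_atlas ?T"
    by (rule cotangent_chart_maximal[OF A d(1)])
  define \<Psi> where "\<Psi> = snd ?d \<circ> (\<lambda>x. x) \<circ> chart_inv c"
  obtain U where U: "open U" "x0 \<in> U" "U \<subseteq> snd c ` fst c" "\<And>x. x \<in> U \<Longrightarrow> chart_inv c x \<in> fst ?d"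
    "smooth_on U \<Psi>"
    using smooth_in_chartsE[OF smooth_in_charts_id[OF T cm \<zeta>(1) dm d(2)] ch] \<zeta>(2) unfolding \<Psi>_def by metis
  let ?D = "\<lambda>w x. frechet_derivative \<Psi> (at x) w"
  \<comment> \<open>Off \<open>S\<close> and on vectors not tangent to \<open>S\<close> the induced
    form is 0 by convention, so the formula is restricted to points and directions of
    \<open>V\<close>. This suffices, as the lines of differentiation stay in
    \<open>V\<close>.\<close>
  have \<beta>_eq: "\<beta> x v w = standard_form (?D v x) (?D w x)" if x: "x \<in> U" "x \<in> V" and vw: "v \<in> V" "w \<in> V" for x v w
  proof -
    define \<xi> where "\<xi> = chart_inv c x"
    have \<xi>: "\<xi> \<in> fst c" "snd c \<xi> = x" "\<xi> \<in> fst ?d"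
      using U(4)[OF x(1)] subsetD[OF U(3) x(1)] by (simp_all add: \<xi>_def inv_into_into f_inv_into_f)
    have "x \<in> snd c ` (fst c \<inter> S)"
      using slice x U(3) by blast
    then have \<xi>S: "\<xi> \<in> S"
      using is_chart_inj[OF ch] \<xi> by (auto simp: inj_on_def)
    have D: "from_chart ?T c \<xi> z = from_chart ?T ?d \<xi> (?D z x)" for z
      using from_chart_transition[OF T cm \<xi>(1) dm \<xi>(3), of z] \<xi>(2) by (simp add: chart_deriv_def \<Psi>_def)
    have "\<beta> x v w = canonical_form A \<xi> (from_chart ?T c \<xi> v) (from_chart ?T c \<xi> w)"
      using slice_chart_tangent[OF T c \<xi>(1) \<xi>S] vw \<xi>S by (simp add: \<beta>_def induced_form_def \<xi>_def[symmetric])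
    then show ?thesis
      using canonical_form_chart[OF A d(1) \<xi>(3)] by (simp add: D)
  qed
  let ?D2 = "\<lambda>v u. frechet_derivative (?D v) (at x0) u"
  have der: "((\<lambda>t. \<beta> (x0 + t *\<^sub>R u) v w) has_real_derivative
      standard_form (?D v x0) (?D2 w u) + standard_form (?D2 v u) (?D w x0)) (at 0)"
    if vw: "u \<in> V" "v \<in> V" "w \<in> V" for u v w
  proof -
    let ?l = "\<lambda>t::real. x0 + t *\<^sub>R u"
    have l: "(?l has_derivative (\<lambda>t. t *\<^sub>R u)) (at 0)"
      by (auto intro!: derivative_eq_intros)
    have Dl: "((\<lambda>t. ?D z (?l t)) has_derivative (\<lambda>t. t *\<^sub>R ?D2 z u)) (at 0)" for z
    proof -
      have sm: "smooth_on U (?D z)"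
        by (rule smooth_on_frechet_derivative[OF U(5)])
      have "((\<lambda>t. ?D z (?l t)) has_derivative (\<lambda>t. ?D2 z (t *\<^sub>R u))) (at 0)"
        using has_derivative_compose[OF l, of "?D z" "?D2 z"] smooth_on_has_derivative[OF sm U(2)] by simp
      then show ?thesis
        by (simp add: linear_scale[OF smooth_on_frechet_linear[OF sm U(2)]])
    qed
    have "((\<lambda>t. standard_form (?D v (?l t)) (?D w (?l t))) has_derivative
        (\<lambda>t. t * (standard_form (?D v x0) (?D2 w u) + standard_form (?D2 v u) (?D w x0)))) (at 0)"
      unfolding standard_form_def
      by (rule derivative_eq_intros Dl refl)+ (simp add: algebra_simps)
    moreover have "open (?l -` U)" "0 \<in> ?l -` U"
      using U by (auto intro!: open_vimage continuous_intros)
    moreover have "standard_form (?D v (?l t)) (?D w (?l t)) = \<beta> (?l t) v w" if "t \<in> ?l -` U" for t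
      using \<beta>_eq[of "?l t" v w] that vw x0 V by (simp add: subspace_add subspace_scale)
    ultimately have "((\<lambda>t. \<beta> (?l t) v w) has_derivative
        (\<lambda>t. t * (standard_form (?D v x0) (?D2 w u) + standard_form (?D2 v u) (?D w x0)))) (at 0)"
      by (rule has_derivative_transform_within_open)
    then show ?thesis
      by (simp add: has_field_derivative_def mult_commute_abs)
  qed
  have sym: "?D2 a b = ?D2 b a" for a b
    by (rule second_derivative_symmetric[OF U(1,2,5)])
  have "standard_form (?D v x0) (?D2 w u) + standard_form (?D2 v u) (?D w x0) +
      (standard_form (?D w x0) (?D2 u v) + standard_form (?D2 w v) (?D u x0)) +
      (standard_form (?D u x0) (?D2 v w) + standard_form (?D2 u w) (?D v x0)) = 0"
    unfolding sym[of v u] sym[of w v] sym[of w u] by (simp add: standard_form_def)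
  with der[OF uvw] der[OF uvw(2,3,1)] der[OF uvw(3,1,2)]
  show "\<exists>a1 a2 a3.
      ((\<lambda>t. \<beta> (x0 + t *\<^sub>R u) v w) has_real_derivative a1) (at 0) \<and>
      ((\<lambda>t. \<beta> (x0 + t *\<^sub>R v) w u) has_real_derivative a2) (at 0) \<and>
      ((\<lambda>t. \<beta> (x0 + t *\<^sub>R w) u v) has_real_derivative a3) (at 0) \<and> a1 + a2 + a3 = 0"
    by blast
qed

subsection \<open>Graphs of 1-forms\<close>

text \<open>The map \<open>\<Phi>\<close> straightens a subset of the base, the shear \<open>y - s x\<close> flattens the graph of the
  1-form with coordinate expression \<open>s\<close>.\<close>

lemma graph_chart:
  fixes A :: "('m, 'e::finite_dim_inner) atlas" and \<Phi> \<Psi> s :: "'e \<Rightarrow> 'e"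
  assumes A: "smooth_atlas A" and c: "c \<in> A"
    and U: "open U" "U \<subseteq> snd c ` fst c" and V: "open V" "\<Phi> ` U = V"
    and \<Phi>: "smooth_on U \<Phi>" and \<Psi>: "smooth_on V \<Psi>" "\<And>x. x \<in> U \<Longrightarrow> \<Psi> (\<Phi> x) = x"
    and s: "smooth_on U s"
  obtains c' where "c' \<in> maximal_atlas (cotangent_atlas A)"
    "fst c' = {\<xi> \<in> fst (cotangent_chart A c). snd c (fst \<xi>) \<in> U}"
    "\<And>\<xi>. snd c' \<xi> = (\<Phi> (fst (snd (cotangent_chart A c) \<xi>)),
        snd (snd (cotangent_chart A c) \<xi>) - s (fst (snd (cotangent_chart A c) \<xi>)))"
    "\<And>\<xi> u. \<xi> \<in> fst c' \<Longrightarrow> from_chart (cotangent_atlas A) c' \<xi> (u, 0) =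
       from_chart (cotangent_atlas A) (cotangent_chart A c) \<xi>
         (frechet_derivative \<Psi> (at (\<Phi> (snd c (fst \<xi>)))) u,
          frechet_derivative s (at (snd c (fst \<xi>))) (frechet_derivative \<Psi> (at (\<Phi> (snd c (fst \<xi>)))) u))"
proof -
  let ?c = "cotangent_chart A c" and ?T = "cotangent_atlas A"
  have T: "smooth_atlas ?T" and cm: "?c \<in> maximal_atlas ?T"
    using smooth_atlas_cotangent[OF A] cotangent_chart_maximal[OF A c] by auto
  define U' where "U' = U \<times> (UNIV :: 'e set)"
  define V' where "V' = V \<times> (UNIV :: 'e set)"
  define h where "h z = (\<Phi> (fst z), snd z - s (fst z))" for z :: "'e \<times> 'e"
  define k where "k z = (\<Psi> (fst z), snd z + s (\<Psi> (fst z)))" for z :: "'e \<times> 'e"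
  have o: "open U'" "open V'"
    using U V by (auto simp: U'_def V'_def open_Times)
  have sub: "U' \<subseteq> snd ?c ` fst ?c"
    using U(2) by (auto simp: U'_def cotangent_chart_image[OF A c])
  have \<Psi>V: "\<Psi> y \<in> U" "\<Phi> (\<Psi> y) = y" if "y \<in> V" for y
    using that \<Psi>(2) unfolding V(2)[symmetric] by auto
  have fst': "smooth_on W (fst :: 'e \<times> 'e \<Rightarrow> 'e)" and snd': "smooth_on W (snd :: 'e \<times> 'e \<Rightarrow> 'e)" for W
    by (auto intro: smooth_on_linear linear_fst linear_snd)
  have sh: "smooth_on U' h"
    unfolding h_def
    by (intro smooth_on_Pair smooth_on_diff snd' o(1)
        smooth_on_compose[OF o(1) U(1) _ fst' \<Phi>] smooth_on_compose[OF o(1) U(1) _ fst' s]) (auto simp: U'_def)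
  have s\<Psi>: "smooth_on V (\<lambda>y. s (\<Psi> y))"
    by (rule smooth_on_compose[OF V(1) U(1) _ \<Psi>(1) s]) (use \<Psi>V in auto)
  have sk: "smooth_on V' k"
    unfolding k_def
    by (intro smooth_on_Pair smooth_on_add snd' o(2)
        smooth_on_compose[OF o(2) V(1) _ fst' \<Psi>(1)] smooth_on_compose[OF o(2) V(1) _ fst' s\<Psi>]) (auto simp: V'_def)
  have kh: "k (h z) = z" if "z \<in> U'" for z
    using that \<Psi>(2) by (auto simp: U'_def k_def h_def)
  have hU': "h ` U' = V'"
  proof (intro equalityI subsetI)
    fix z assume "z \<in> V'"
    then have "k z \<in> U'" "h (k z) = z"
      using \<Psi>V by (auto simp: V'_def U'_def k_def h_def)
    then show "z \<in> h ` U'"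
      by (metis image_eqI)
  qed (use V(2) in \<open>auto simp: U'_def V'_def h_def\<close>)
  define c' where "c' = (fst ?c \<inter> snd ?c -` U', \<lambda>\<xi>. h (snd ?c \<xi>))"
  have restrict1: "c' \<in> maximal_atlas ?T"
    unfolding c'_def by (rule maximal_atlas_restrict(1)[OF T cm o(1) sub o(2) hU' sh sk]) (rule kh)
  have restrict2: "chart_deriv c' ?c (\<lambda>x. x) \<xi> = frechet_derivative k (at (h (snd ?c \<xi>)))" if "\<xi> \<in> fst c'" for \<xi>
    using that unfolding c'_def
    by (intro maximal_atlas_restrict(2)[OF T cm o(1) sub o(2) hU' sh sk]) (rule kh)
  have dom: "fst c' = {\<xi> \<in> fst ?c. snd c (fst \<xi>) \<in> U}"
    by (auto simp: c'_def U'_def cotangent_chart_simps)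
  show ?thesis
  proof (rule that[OF restrict1 dom])
    show "snd c' \<xi> = (\<Phi> (fst (snd ?c \<xi>)), snd (snd ?c \<xi>) - s (fst (snd ?c \<xi>)))" for \<xi>
      by (simp add: c'_def h_def)
    fix \<xi> u assume \<xi>: "\<xi> \<in> fst c'"
    let ?x = "snd c (fst \<xi>)"
    have \<xi>c: "\<xi> \<in> fst ?c" and x: "?x \<in> U"
      using \<xi> by (auto simp: dom)
    define w where "w = frechet_derivative \<Psi> (at (\<Phi> ?x)) u"
    have y: "\<Phi> ?x \<in> V"
      using x V(2) by auto
    let ?z = "h (snd ?c \<xi>)"
    have z: "fst ?z = \<Phi> ?x"
      by (simp add: h_def cotangent_chart_simps)
    have d\<Psi>: "(\<Psi> has_derivative frechet_derivative \<Psi> (at (fst ?z))) (at (fst ?z))"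
      unfolding z by (rule smooth_on_has_derivative[OF \<Psi>(1) y])
    have ds: "(s has_derivative frechet_derivative s (at ?x)) (at (\<Psi> (fst ?z)))"
      using smooth_on_has_derivative[OF s x] \<Psi>(2)[OF x] by (simp add: z)
    have d\<Psi>f: "((\<lambda>z. \<Psi> (fst z)) has_derivative (\<lambda>v. frechet_derivative \<Psi> (at (fst ?z)) (fst v))) (at ?z)"
      using has_derivative_compose[OF has_derivative_fst[OF has_derivative_ident] d\<Psi>] .
    have "(k has_derivative (\<lambda>v. (frechet_derivative \<Psi> (at (fst ?z)) (fst v),
        snd v + frechet_derivative s (at ?x) (frechet_derivative \<Psi> (at (fst ?z)) (fst v))))) (at ?z)"
      unfolding k_def[abs_def]
      by (intro has_derivative_Pair has_derivative_add d\<Psi>f has_derivative_snd[OF has_derivative_ident]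
          has_derivative_compose[OF d\<Psi>f ds])
    then have "frechet_derivative k (at ?z) = (\<lambda>v. (frechet_derivative \<Psi> (at (fst ?z)) (fst v),
        snd v + frechet_derivative s (at ?x) (frechet_derivative \<Psi> (at (fst ?z)) (fst v))))"
      by (rule frechet_derivative_at[symmetric])
    then have "frechet_derivative k (at ?z) (u, 0) = (w, frechet_derivative s (at ?x) w)"
      by (simp add: w_def z)
    moreover have "from_chart ?T ?c \<xi> (chart_deriv c' ?c (\<lambda>x. x) \<xi> (u, 0)) = from_chart ?T c' \<xi> (u, 0)"
      by (rule from_chart_transition[OF T restrict1 \<xi> cm \<xi>c])
    ultimately show "from_chart ?T c' \<xi> (u, 0) = from_chart ?T ?c \<xi> (frechet_derivative \<Psi> (at (\<Phi> ?x)) u,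
        frechet_derivative s (at ?x) (frechet_derivative \<Psi> (at (\<Phi> ?x)) u))"
      by (simp add: restrict2[OF \<xi>] w_def)
  qed
qed

subsection \<open>Coordinate expressions of maps of two variables\<close>

text \<open>A single joint coordinate expression \<open>H\<close> yields the partial derivatives at
  all nearby pairs of points. They thereby depend smoothly on the other variable, and mixed second
  derivatives become available.\<close>

lemma two_variable_chart:
  fixes A :: "('m, 'e::finite_dim_inner) atlas" and B :: "('n, 'f::finite_dim_inner) atlas"
  assumes A: "smooth_atlas A" and B: "smooth_atlas B" and f: "smooth_at (prod_atlas A A) B (\<lambda>z. f (fst z) (snd z)) (a, a')"
    and c: "c \<in> A" "a \<in> fst c" and c': "c' \<in> A" "a' \<in> fst c'" and d: "d \<in> maximal_atlas B" "f a a' \<in> fst d"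
  obtains U H where "open U" "(snd c a, snd c' a') \<in> U" "smooth_on U H"
    "\<And>p q. p \<in> fst c \<Longrightarrow> q \<in> fst c' \<Longrightarrow> (snd c p, snd c' q) \<in> U \<Longrightarrow>
       smooth_in_charts c' d (f p) q \<and> smooth_in_charts c d (\<lambda>p. f p q) p \<and>
       (\<forall>v. chart_deriv c' d (f p) q v = frechet_derivative H (at (snd c p, snd c' q)) (0, v)) \<and>
       (\<forall>v. chart_deriv c d (\<lambda>p. f p q) p v = frechet_derivative H (at (snd c p, snd c' q)) (v, 0))"
proof -
  let ?e = "prod_chart c c'" and ?f = "\<lambda>z. f (fst z) (snd z)"
  have ch: "is_chart c" "is_chart c'"
    using A c c' by (auto simp: smooth_atlas_def)
  have eh: "is_chart ?e"
    by (rule is_chart_prod[OF ch])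
  have sf: "smooth_in_charts ?e d ?f (a, a')"
    using smooth_at_charts(1)[OF smooth_atlas_prod[OF A A] B f prod_chart_maximal[OF A A c(1) c'(1)] _ d(1)] c c' d
    by simp
  obtain U where U: "open U" "(snd c a, snd c' a') \<in> U" "U \<subseteq> snd ?e ` fst ?e"
    "\<And>x. x \<in> U \<Longrightarrow> ?f (chart_inv ?e x) \<in> fst d" "smooth_on U (snd d \<circ> ?f \<circ> chart_inv ?e)"
    using sf[unfolded smooth_in_charts_def] unfolding prod_chart_simps(2) by blast
  define H where "H = snd d \<circ> ?f \<circ> chart_inv ?e"
  have inv: "chart_inv ?e (x, y) = (chart_inv c x, chart_inv c' y)"
    and mem: "x \<in> snd c ` fst c" "y \<in> snd c' ` fst c'" if "(x, y) \<in> U" for x y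
  proof -
    have "(x, y) \<in> (snd c ` fst c) \<times> (snd c' ` fst c')"
      using U(3) that by (auto simp: prod_chart_image)
    then show "x \<in> snd c ` fst c" "y \<in> snd c' ` fst c'"
      by auto
    then show "chart_inv ?e (x, y) = (chart_inv c x, chart_inv c' y)"
      using chart_inv_prod[OF ch] by blast
  qed
  have "smooth_in_charts c' d (f p) q \<and> smooth_in_charts c d (\<lambda>p. f p q) p \<and>
       (\<forall>v. chart_deriv c' d (f p) q v = frechet_derivative H (at (snd c p, snd c' q)) (0, v)) \<and>
       (\<forall>v. chart_deriv c d (\<lambda>p. f p q) p v = frechet_derivative H (at (snd c p, snd c' q)) (v, 0))"
    if pq: "p \<in> fst c" "q \<in> fst c'" "(snd c p, snd c' q) \<in> U" for p q
  proof -
    have p: "chart_inv c (snd c p) = p" and q: "chart_inv c' (snd c' q) = q"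
      by (rule chart_inv_chart[OF ch(1) pq(1)], rule chart_inv_chart[OF ch(2) pq(2)])
    let ?U1 = "(\<lambda>y. (snd c p, y)) -` U" and ?U2 = "(\<lambda>x. (x, snd c' q)) -` U"
    have o: "open ?U1" "open ?U2"
      using U(1) by (auto intro!: open_vimage continuous_intros)
    have s1: "smooth_on ?U1 (\<lambda>y. (snd c p, y))" and s2: "smooth_on ?U2 (\<lambda>x. (x, snd c' q))"
      by (intro smooth_on_Pair smooth_on_const smooth_on_ident o)+
    have HU: "smooth_on U H"
      using U(5) by (simp add: H_def)
    have s1': "smooth_on ?U1 (\<lambda>y. H (snd c p, y))"
      by (rule smooth_on_compose[OF o(1) U(1) _ s1 HU]) auto
    have s2': "smooth_on ?U2 (\<lambda>x. H (x, snd c' q))"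
      by (rule smooth_on_compose[OF o(2) U(1) _ s2 HU]) auto
    have e1: "f p (chart_inv c' y) \<in> fst d" "snd d (f p (chart_inv c' y)) = H (snd c p, y)" if "y \<in> ?U1" for y
      using inv[of "snd c p" y] U(4)[of "(snd c p, y)"] that p by (auto simp: H_def)
    have e2: "f (chart_inv c x) q \<in> fst d" "snd d (f (chart_inv c x) q) = H (x, snd c' q)" if "x \<in> ?U2" for x
      using inv[of x "snd c' q"] U(4)[of "(x, snd c' q)"] that q by (auto simp: H_def)
    have sub: "?U1 \<subseteq> snd c' ` fst c'" "?U2 \<subseteq> snd c ` fst c"
      using mem by auto
    have r1: "smooth_in_charts c' d (f p) q"
        "chart_deriv c' d (f p) q = frechet_derivative (\<lambda>y. H (snd c p, y)) (at (snd c' q))"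
      by (rule smooth_in_chartsI[OF pq(2) o(1) _ sub(1) e1 s1']; use pq(3) in simp)+
    have r2: "smooth_in_charts c d (\<lambda>p. f p q) p"
        "chart_deriv c d (\<lambda>p. f p q) p = frechet_derivative (\<lambda>x. H (x, snd c' q)) (at (snd c p))"
      by (rule smooth_in_chartsI[OF pq(1) o(2) _ sub(2) e2 s2']; use pq(3) in simp)+
    have D1: "frechet_derivative (\<lambda>y. (snd c p, y)) (at (snd c' q)) = (\<lambda>v. (0, v))"
      by (rule frechet_derivative_at[symmetric]) (auto intro!: derivative_eq_intros)
    have D2: "frechet_derivative (\<lambda>x. (x, snd c' q)) (at (snd c p)) = (\<lambda>v. (v, 0))"
      by (rule frechet_derivative_at[symmetric]) (auto intro!: derivative_eq_intros)
    have "frechet_derivative (\<lambda>y. H (snd c p, y)) (at (snd c' q)) v = frechet_derivative H (at (snd c p, snd c' q)) (0, v)"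
      "frechet_derivative (\<lambda>x. H (x, snd c' q)) (at (snd c p)) v = frechet_derivative H (at (snd c p, snd c' q)) (v, 0)" for v
      using frechet_derivative_compose[OF s1 HU, of "snd c' q" v] frechet_derivative_compose[OF s2 HU, of "snd c p" v] pq(3)
      by (simp_all add: D1 D2)
    then show ?thesis
      using r1 r2 by simp
  qed
  moreover have "smooth_on U H"
    using U(5) by (simp add: H_def)
  ultimately show ?thesis
    using that[OF U(1,2)] by blast
qed

section \<open>Lie groups\<close>

locale lie =
  fixes G :: "('g, 'z) monoid_scheme" (structure) and A :: "('g, 'e::finite_dim_inner) atlas"
  assumes lie_group: "lie_group G A"
begin

lemma atlas: "smooth_atlas A" and points_carrier [simp]: "points A = carrier G"
  using lie_group smooth_manifold_imp_atlas by (auto simp: lie_group_def)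

sublocale group G
  using lie_group by (simp add: lie_group_def)

lemma smooth_at_mult:
  assumes "smooth_atlas B" "smooth_at B A f p" "smooth_at B A g p"
  shows "smooth_at B A (\<lambda>x. f x \<otimes> g x) p"
proof -
  have fg: "f p \<in> carrier G" "g p \<in> carrier G"
    using assms by (auto simp: smooth_at_def)
  have "smooth_map (prod_atlas A A) A (\<lambda>(x, y). x \<otimes> y)"
    using lie_group by (simp add: lie_group_def)
  then have "smooth_at (prod_atlas A A) A (\<lambda>(x, y). x \<otimes> y) (f p, g p)"
    using fg by (intro smooth_map_on_imp_smooth_at[OF smooth_atlas_prod[OF atlas atlas]]) auto
  from smooth_at_compose(1)[OF assms(1) smooth_atlas_prod[OF atlas atlas] smooth_at_Pair[OF assms(1) atlas atlas assms(2,3)] this]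
  show ?thesis
    by simp
qed

lemma smooth_at_inv:
  assumes "smooth_atlas B" "smooth_at B A f p"
  shows "smooth_at B A (\<lambda>x. inv (f x)) p"
proof -
  have "f p \<in> points A" "smooth_map A A (\<lambda>x. inv x)"
    using assms lie_group by (auto simp: smooth_at_def lie_group_def)
  then have "smooth_at A A (\<lambda>x. inv x) (f p)"
    by (intro smooth_map_on_imp_smooth_at[OF atlas])
  from smooth_at_compose(1)[OF assms(1) atlas assms(2) this] show ?thesis .
qed

lemmas smooth_at_group = smooth_at_mult smooth_at_inv smooth_at_id(1)[OF atlas] smooth_at_const[OF atlas]
  smooth_at_fst[OF atlas atlas] smooth_at_const[OF smooth_atlas_prod[OF atlas atlas]] smooth_atlas_prod[OF atlas atlas] atlas

lemma smooth_at_left: "g \<in> carrier G \<Longrightarrow> x \<in> carrier G \<Longrightarrow> smooth_at A A (left_transl G g) x"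
  unfolding left_transl_def[abs_def] by (intro smooth_at_group) auto

lemma smooth_at_right: "g \<in> carrier G \<Longrightarrow> x \<in> carrier G \<Longrightarrow> smooth_at A A (right_transl G g) x"
  unfolding right_transl_def[abs_def] by (intro smooth_at_group) auto

abbreviation dL :: "'g \<Rightarrow> 'g \<Rightarrow> 'e \<Rightarrow> 'e" where
  "dL g \<equiv> tangent_map A A (left_transl G g)"

abbreviation dR :: "'g \<Rightarrow> 'g \<Rightarrow> 'e \<Rightarrow> 'e" where
  "dR g \<equiv> tangent_map A A (right_transl G g)"

lemma dL_linear: "g \<in> carrier G \<Longrightarrow> x \<in> carrier G \<Longrightarrow> linear (dL g x)"
  by (rule tangent_map_linear[OF atlas smooth_at_left])

lemma dR_linear: "g \<in> carrier G \<Longrightarrow> x \<in> carrier G \<Longrightarrow> linear (dR g x)"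
  by (rule tangent_map_linear[OF atlas smooth_at_right])

text \<open>The chain rule for identities between group operations, which hold on the carrier
  only.\<close>

lemma tangent_map_compose_eq:
  assumes "smooth_at A A f p" "smooth_at A A g (f p)" "\<And>x. x \<in> carrier G \<Longrightarrow> g (f x) = h x"
  shows "tangent_map A A g (f p) (tangent_map A A f p v) = tangent_map A A h p v"
  using smooth_at_compose[OF atlas atlas assms(1,2)] smooth_at_cong(2)[OF atlas, of "\<lambda>x. g (f x)" h A p] assms(3)
  by simp

lemma dL_mult:
  assumes "g \<in> carrier G" "h \<in> carrier G" "x \<in> carrier G"
  shows "dL h (g \<otimes> x) (dL g x v) = dL (h \<otimes> g) x v"
proof -
  have "tangent_map A A (left_transl G h) (left_transl G g x) (dL g x v) = dL (h \<otimes> g) x v"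
    using assms by (intro tangent_map_compose_eq smooth_at_left) (auto simp: left_transl_def m_assoc)
  then show ?thesis
    by (simp add: left_transl_def[of G g x])
qed

lemma dL_one: "x \<in> carrier G \<Longrightarrow> dL \<one> x v = v"
  using smooth_at_cong(2)[OF atlas _ smooth_at_left[of \<one> x], of "\<lambda>x. x"] smooth_at_id(2)[OF atlas]
  by (simp add: left_transl_def)

lemma dL_inv:
  assumes "g \<in> carrier G" "x \<in> carrier G"
  shows "dL (inv g) (g \<otimes> x) (dL g x v) = v" "dL g x (dL (inv g) (g \<otimes> x) v) = v"
  using dL_mult[of g "inv g" x] dL_mult[of "inv g" g "g \<otimes> x"] dL_one assms
  by (simp_all add: m_assoc[symmetric])

lemma cotangent_transpose_eq:
  assumes "bij_betw f (carrier G) (carrier G)" "x \<in> carrier G" "f x = fst \<xi>"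
  shows "cotangent_transpose A f \<xi> = (x, snd \<xi> \<circ> tangent_map A A f x)"
  using assms by (simp add: cotangent_transpose_def Let_def bij_betw_def assms(3)[symmetric])

lemma bij_left: "g \<in> carrier G \<Longrightarrow> bij_betw (left_transl G g) (carrier G) (carrier G)"
  by (rule bij_betw_byWitness[where f' = "left_transl G (inv g)"]) (auto simp: left_transl_def m_assoc[symmetric])

lemma bij_right: "g \<in> carrier G \<Longrightarrow> bij_betw (right_transl G g) (carrier G) (carrier G)"
  by (rule bij_betw_byWitness[where f' = "right_transl G (inv g)"]) (auto simp: right_transl_def m_assoc)

lemma momentum_right_eq:
  assumes "fst \<xi> \<in> carrier G"
  shows "momentum_right G A \<xi> = snd \<xi> \<circ> dL (fst \<xi>) \<one>"
  unfolding momentum_right_def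
  by (subst cotangent_transpose_eq[OF bij_left, of _ \<one>]) (use assms in \<open>auto simp: left_transl_def\<close>)

lemma momentum_left_eq:
  assumes "fst \<xi> \<in> carrier G"
  shows "momentum_left G A \<xi> = snd \<xi> \<circ> dR (fst \<xi>) \<one>"
  unfolding momentum_left_def
  by (subst cotangent_transpose_eq[OF bij_right, of _ \<one>]) (use assms in \<open>auto simp: right_transl_def\<close>)

lemma lift_left_eq:
  assumes "g \<in> carrier G" "fst \<xi> \<in> carrier G"
  shows "lift_left G A g \<xi> = (g \<otimes> fst \<xi>, snd \<xi> \<circ> dL (inv g) (g \<otimes> fst \<xi>))"
  unfolding lift_left_def
  by (rule cotangent_transpose_eq[OF bij_left]) (use assms in \<open>auto simp: left_transl_def m_assoc[symmetric]\<close>)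

subsection \<open>Left-invariant 1-forms and the fibres of the right momentum map\<close>

text \<open>The left-invariant 1-form with value \<open>\<mu>\<close> at the unit, as a section of
  the cotangent bundle.\<close>

definition inv_form :: "('e \<Rightarrow> real) \<Rightarrow> 'g \<Rightarrow> 'g \<times> ('e \<Rightarrow> real)" where
  "inv_form \<mu> g = (g, \<mu> \<circ> dL (inv g) g)"

lemma fst_inv_form [simp]: "fst (inv_form \<mu> g) = g"
  by (simp add: inv_form_def)

lemma inv_form_mem: "linear \<mu> \<Longrightarrow> g \<in> carrier G \<Longrightarrow> inv_form \<mu> g \<in> cotangent_bundle A"
  by (simp add: inv_form_def cotangent_bundle_iff linear_compose[OF dL_linear])

lemma momentum_right_linear: "\<xi> \<in> cotangent_bundle A \<Longrightarrow> linear (momentum_right G A \<xi>)"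
  by (simp add: cotangent_bundle_iff momentum_right_eq linear_compose[OF dL_linear])

lemma momentum_left_linear: "\<xi> \<in> cotangent_bundle A \<Longrightarrow> linear (momentum_left G A \<xi>)"
  by (simp add: cotangent_bundle_iff momentum_left_eq linear_compose[OF dR_linear])

lemma momentum_right_inv_form: "g \<in> carrier G \<Longrightarrow> momentum_right G A (inv_form \<mu> g) = \<mu>"
  using dL_inv(1)[of g \<one>] by (auto simp: momentum_right_eq inv_form_def)

lemma inv_form_momentum_right: "\<xi> \<in> cotangent_bundle A \<Longrightarrow> inv_form (momentum_right G A \<xi>) (fst \<xi>) = \<xi>"
  using dL_inv(2)[of "fst \<xi>" \<one>] by (auto simp: momentum_right_eq inv_form_def cotangent_bundle_iff prod_eq_iff)

lemma momentum_right_fibre: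
  assumes "linear \<mu>"
  shows "{\<xi> \<in> cotangent_bundle A. momentum_right G A \<xi> = \<mu>} = inv_form \<mu> ` carrier G"
proof (intro equalityI subsetI)
  fix \<xi> assume "\<xi> \<in> {\<xi> \<in> cotangent_bundle A. momentum_right G A \<xi> = \<mu>}"
  then have "\<xi> = inv_form \<mu> (fst \<xi>)" "fst \<xi> \<in> carrier G"
    using inv_form_momentum_right[of \<xi>] by (auto simp: cotangent_bundle_iff)
  then show "\<xi> \<in> inv_form \<mu> ` carrier G"
    by blast
qed (use assms inv_form_mem momentum_right_inv_form in auto)

lemma lift_left_inv_form:
  assumes "g \<in> carrier G" "x \<in> carrier G"
  shows "lift_left G A g (inv_form \<mu> x) = inv_form \<mu> (g \<otimes> x)"
  using dL_mult[of "inv g" "inv x" "g \<otimes> x"] assms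
  by (auto simp: lift_left_eq inv_form_def inv_mult_group m_assoc[symmetric])

text \<open>On the values of one left-invariant form the lifted left translations act as left
  multiplication on base points, which is transitive.\<close>

lemma momentum_right_fibre_orbit:
  assumes "\<zeta> \<in> cotangent_bundle A"
  shows "{\<xi> \<in> cotangent_bundle A. momentum_right G A \<xi> = momentum_right G A \<zeta>} =
    orbit G (\<lambda>g \<xi>. lift_left G A g \<xi>) \<zeta>"
proof -
  define x where "x = fst \<zeta>"
  define \<mu> where "\<mu> = momentum_right G A \<zeta>"
  have x: "x \<in> carrier G" and \<zeta>: "\<zeta> = inv_form \<mu> x"
    using assms inv_form_momentum_right[OF assms] by (auto simp: x_def \<mu>_def cotangent_bundle_iff)
  have "inv_form \<mu> y \<in> orbit G (\<lambda>g \<xi>. lift_left G A g \<xi>) \<zeta>" if y: "y \<in> carrier G" for y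
  proof -
    have "inv_form \<mu> y = lift_left G A (y \<otimes> inv x) \<zeta>"
      using x y by (simp add: \<zeta> lift_left_inv_form m_assoc)
    then show ?thesis
      using x y by (auto simp: orbit_def)
  qed
  moreover have "\<xi> \<in> inv_form \<mu> ` carrier G" if "\<xi> \<in> orbit G (\<lambda>g \<xi>. lift_left G A g \<xi>) \<zeta>" for \<xi>
    using that x by (auto simp: orbit_def \<zeta> lift_left_inv_form)
  ultimately show ?thesis
    using momentum_right_fibre[OF momentum_right_linear[OF assms]] by (auto simp: \<mu>_def)
qed

section \<open>Coadjoint equivariance of the left momentum map\<close>

lemma Ad_linear: "g \<in> carrier G \<Longrightarrow> linear (Ad G A g)"
  unfolding Ad_def by (intro tangent_map_linear[OF atlas] smooth_at_group) auto

text \<open>The map \<open>z \<mapsto> inv h \<otimes> z \<otimes> h \<otimes> x\<close> has two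
  factorisations: right translation by \<open>h \<otimes> x\<close> followed by left translation by
  \<open>inv h\<close>, and conjugation followed by right translation by \<open>x\<close>. Its
  derivative at the unit, computed both ways, is the claim.\<close>

lemma momentum_left_lift:
  assumes h: "h \<in> carrier G" and \<xi>: "\<xi> \<in> cotangent_bundle A"
  shows "momentum_left G A (lift_left G A h \<xi>) = coadjoint G A h (momentum_left G A \<xi>)"
proof
  fix v
  define x where "x = fst \<xi>"
  have x: "x \<in> carrier G"
    using \<xi> by (simp add: x_def cotangent_bundle_iff)
  let ?C = "\<lambda>z. inv h \<otimes> z \<otimes> inv (inv h)"
  have C: "smooth_at A A ?C \<one>"
    using h by (intro smooth_at_group) auto
  have "dL (inv h) (right_transl G (h \<otimes> x) \<one>) (dR (h \<otimes> x) \<one> v) = tangent_map A A (\<lambda>z. inv h \<otimes> z \<otimes> (h \<otimes> x)) \<one> v"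
    using h x by (intro tangent_map_compose_eq smooth_at_left smooth_at_right)
      (auto simp: left_transl_def right_transl_def m_assoc)
  also have "\<dots> = dR x (?C \<one>) (tangent_map A A ?C \<one> v)"
    using h x by (intro tangent_map_compose_eq[symmetric] C smooth_at_right) (auto simp: right_transl_def m_assoc)
  finally have "dL (inv h) (h \<otimes> x) (dR (h \<otimes> x) \<one> v) = dR x \<one> (Ad G A (inv h) v)"
    using h x by (simp add: Ad_def right_transl_def)
  then show "momentum_left G A (lift_left G A h \<xi>) v = coadjoint G A h (momentum_left G A \<xi>) v"
    using h x by (simp add: momentum_left_eq lift_left_eq coadjoint_def flip: x_def)
qed

lemma Ad_inv:
  assumes g: "g \<in> carrier G"
  shows "Ad G A g (Ad G A (inv g) v) = v"
proof -
  let ?C = "\<lambda>g x. g \<otimes> x \<otimes> inv g"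
  have C: "smooth_at A A (?C g) x" if "g \<in> carrier G" "x \<in> carrier G" for g x
    using that by (intro smooth_at_group) auto
  have "tangent_map A A (?C g) (?C (inv g) \<one>) (tangent_map A A (?C (inv g)) \<one> v) = tangent_map A A (\<lambda>x. x) \<one> v"
    using g by (intro tangent_map_compose_eq C) (auto simp: m_assoc, simp add: m_assoc[symmetric])
  then show ?thesis
    using g smooth_at_id(2)[OF atlas] by (simp add: Ad_def)
qed

text \<open>Points of the first fibre are left translates of \<open>\<zeta>\<close>; by equivariance
  the left momentum of such a translate is unchanged exactly when the translating element fixes
  it.\<close>

lemma momentum_fibres_inter:
  assumes \<zeta>: "\<zeta> \<in> cotangent_bundle A"
  shows "{\<xi> \<in> cotangent_bundle A. momentum_right G A \<xi> = momentum_right G A \<zeta>} \<inter>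
     {\<xi> \<in> cotangent_bundle A. momentum_left G A \<xi> = momentum_left G A \<zeta>} =
     {cotangent_transpose A (left_transl G (inv g)) \<zeta> | g. g \<in> stabilizer G (coadjoint G A) (momentum_left G A \<zeta>)}"
proof -
  have mem: "lift_left G A g \<zeta> \<in> cotangent_bundle A" if "g \<in> carrier G" for g
  proof -
    have "lift_left G A g \<zeta> \<in> orbit G (\<lambda>g \<xi>. lift_left G A g \<xi>) \<zeta>"
      using that by (auto simp: orbit_def)
    then show ?thesis
      using momentum_right_fibre_orbit[OF \<zeta>] by blast
  qed
  show ?thesis
    unfolding momentum_right_fibre_orbit[OF \<zeta>] lift_left_def[symmetric] stabilizer_def orbit_def
    using momentum_left_lift[OF _ \<zeta>] mem by auto
qed

end

subsection \<open>The opposite group\<close>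

text \<open>Passing to the opposite group exchanges left and right, and the two momentum maps.\<close>

definition opposite :: "('g, 'z) monoid_scheme \<Rightarrow> ('g, 'z) monoid_scheme" where
  "opposite G = G\<lparr>mult := \<lambda>x y. y \<otimes>\<^bsub>G\<^esub> x\<rparr>"

lemma opposite_simps [simp]:
  "carrier (opposite G) = carrier G" "x \<otimes>\<^bsub>opposite G\<^esub> y = y \<otimes>\<^bsub>G\<^esub> x" "\<one>\<^bsub>opposite G\<^esub> = \<one>\<^bsub>G\<^esub>"
  "inv\<^bsub>opposite G\<^esub> x = inv\<^bsub>G\<^esub> x"
  by (simp_all add: opposite_def m_inv_def conj_commute)

lemma opposite_opposite [simp]: "opposite (opposite G) = G"
  by (simp add: opposite_def)

lemma left_transl_opposite [simp]: "left_transl (opposite G) = right_transl G"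
  and right_transl_opposite [simp]: "right_transl (opposite G) = left_transl G"
  by (auto simp: left_transl_def right_transl_def fun_eq_iff)

lemma momentum_opposite [simp]:
  "momentum_right (opposite G) A = momentum_left G A" "momentum_left (opposite G) A = momentum_right G A"
  by (auto simp: momentum_right_def momentum_left_def fun_eq_iff)

lemma lift_left_opposite [simp]: "lift_left (opposite G) A g \<xi> = lift_right G A \<xi> g"
  by (simp add: lift_left_def lift_right_def)

context lie begin

lemma lie_opposite: "lie (opposite G) A"
proof
  have "group (opposite G)"
    by (rule groupI) (auto simp: m_assoc intro: r_inv l_inv exI[of _ "inv _"] bexI[of _ "inv _"])
  moreover have "smooth_map (prod_atlas A A) A (\<lambda>(x, y). y \<otimes> x)"
  proof (rule smooth_mapI[OF smooth_atlas_prod[OF atlas atlas] atlas])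
    fix p assume "p \<in> points (prod_atlas A A)"
    then have "smooth_at (prod_atlas A A) A (\<lambda>p. snd p \<otimes> fst p) p"
      by (intro smooth_at_group) auto
    then show "smooth_at (prod_atlas A A) A (\<lambda>(x, y). y \<otimes> x) p"
      by (simp add: case_prod_unfold)
  qed
  ultimately show "lie_group (opposite G) A"
    using lie_group by (simp add: lie_group_def)
qed

lemma Ad_opposite: "g \<in> carrier G \<Longrightarrow> Ad (opposite G) A g = Ad G A (inv g)"
proof -
  assume g: "g \<in> carrier G"
  have "smooth_at A A (\<lambda>x. inv g \<otimes> (x \<otimes> g)) \<one>"
    using g by (intro smooth_at_group) auto
  then show ?thesis
    using smooth_at_cong(2)[OF atlas, of "\<lambda>x. inv g \<otimes> (x \<otimes> g)" "\<lambda>x. inv g \<otimes> x \<otimes> g" A \<one>] g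
    by (simp add: Ad_def m_assoc)
qed

text \<open>The opposite group turns the coadjoint action of \<open>g\<close> into that of
  \<open>inv g\<close>, and a group element and its inverse fix the same linear forms.\<close>

lemma stabilizer_opposite:
  "stabilizer (opposite G) (coadjoint (opposite G) A) \<xi> = stabilizer G (coadjoint G A) \<xi>"
proof -
  have 1: "\<xi> \<circ> Ad (opposite G) A (inv g) = \<xi> \<circ> Ad G A g" if "g \<in> carrier G" for g
    using that by (simp add: Ad_opposite)
  have 2: "\<xi> \<circ> Ad G A g = \<xi> \<longleftrightarrow> \<xi> \<circ> Ad G A (inv g) = \<xi>" if "g \<in> carrier G" for g
    using Ad_inv[OF that] Ad_inv[of "inv g"] that by (auto simp: fun_eq_iff) metis+
  have eq: "\<xi> \<circ> Ad (opposite G) A (inv g) = \<xi> \<longleftrightarrow> \<xi> \<circ> Ad G A (inv g) = \<xi>" if g: "g \<in> carrier G" for g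
    unfolding 1[OF g] by (rule 2[OF g])
  show ?thesis
    unfolding stabilizer_def coadjoint_def opposite_simps by (rule Collect_cong, rule conj_cong[OF refl eq])
qed

end

subsection \<open>Coordinate expressions of invariant 1-forms\<close>

context lie begin

text \<open>The left-invariant form \<open>\<mu>\<close> is the graph of this function over the
  coordinates of \<open>c\<close>: the \<open>s\<close> of the overview. Taken over the opposite
  group it is the \<open>t\<close> of a right-invariant form.\<close>

definition coord :: "('g, 'e) chart \<Rightarrow> ('e \<Rightarrow> real) \<Rightarrow> 'e \<Rightarrow> 'e" where
  "coord c \<mu> x = snd (snd (cotangent_chart A c) (inv_form \<mu> (chart_inv c x)))"

lemma chart_carrier: "c \<in> A \<Longrightarrow> g \<in> fst c \<Longrightarrow> g \<in> carrier G"
  using maximal_points[OF atlas_subset_maximal[OF atlas]] by simp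

lemma inv_form_chart:
  assumes "linear \<mu>" "c \<in> A" "g \<in> fst c"
  shows "inv_form \<mu> g \<in> fst (cotangent_chart A c)"
    "snd (cotangent_chart A c) (inv_form \<mu> g) = (snd c g, coord c \<mu> (snd c g))"
    "w \<bullet> coord c \<mu> (snd c g) = snd (inv_form \<mu> g) (from_chart A c g w)"
proof -
  have "is_chart c"
    using atlas assms(2) by (simp add: smooth_atlas_def)
  then have inv: "chart_inv c (snd c g) = g"
    using assms(3) by (rule chart_inv_chart)
  show mem: "inv_form \<mu> g \<in> fst (cotangent_chart A c)"
    using assms inv_form_mem[OF assms(1) chart_carrier[OF assms(2,3)]] by (simp add: cotangent_chart_simps)
  show "snd (cotangent_chart A c) (inv_form \<mu> g) = (snd c g, coord c \<mu> (snd c g))"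
    by (simp add: coord_def inv cotangent_chart_simps)
  show "w \<bullet> coord c \<mu> (snd c g) = snd (inv_form \<mu> g) (from_chart A c g w)"
    using inner_cotangent_chart[OF atlas assms(2) mem] by (simp add: coord_def inv)
qed

lemma left_transl_fun: "left_transl G g = (\<lambda>x. g \<otimes> x)"
  and right_transl_fun: "right_transl G g = (\<lambda>x. x \<otimes> g)"
  by (auto simp: left_transl_def right_transl_def)

lemma left_transl_charts:
  assumes "c \<in> A" "g \<in> fst c" "d \<in> A" "k \<in> carrier G" "k \<otimes> g \<in> fst d"
  shows "smooth_in_charts c d (left_transl G k) g"
    "from_chart A d (k \<otimes> g) (chart_deriv c d (left_transl G k) g v) = dL k g (from_chart A c g v)"
  using smooth_at_charts[OF atlas atlas smooth_at_left[OF assms(4) chart_carrier[OF assms(1,2)]]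
      atlas_subset_maximal[OF atlas assms(1)] assms(2) atlas_subset_maximal[OF atlas assms(3)]] assms(5)
  by (simp_all add: left_transl_def[of G k g])

text \<open>The value of the form at \<open>g\<close> is \<open>\<mu>\<close> applied to the
  derivative of \<open>q \<mapsto> inv p \<otimes> q\<close> at \<open>q = g\<close> with
  \<open>p = g\<close>. The two-variable map is smooth near \<open>(g0, g0)\<close>, and its partial
  derivative is evaluated along the diagonal.\<close>

lemma coord_smooth:
  assumes \<mu>: "linear \<mu>" and c: "c \<in> A"
  shows "smooth_on (snd c ` fst c) (coord c \<mu>)"
proof (rule smooth_on_local)
  fix x assume "x \<in> snd c ` fst c"
  then obtain g0 where g0: "g0 \<in> fst c" "x = snd c g0"
    by auto
  have ch: "is_chart c"
    using atlas c by (simp add: smooth_atlas_def)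
  have G0: "g0 \<in> carrier G"
    by (rule chart_carrier[OF c g0(1)])
  let ?d = "chart_at A \<one>"
  have d: "?d \<in> A" "\<one> \<in> fst ?d"
    using chart_at[of \<one> A] by simp_all
  have f: "smooth_at (prod_atlas A A) A (\<lambda>z. inv (fst z) \<otimes> snd z) (g0, g0)"
    using G0 by (intro smooth_at_group) auto
  have "inv g0 \<otimes> g0 \<in> fst ?d"
    using G0 d by simp
  from two_variable_chart[OF atlas atlas f c g0(1) c g0(1) atlas_subset_maximal[OF atlas d(1)] this]
  obtain U H where U: "open U" "(snd c g0, snd c g0) \<in> U" "smooth_on U H"
    and H: "\<And>p q. p \<in> fst c \<Longrightarrow> q \<in> fst c \<Longrightarrow> (snd c p, snd c q) \<in> U \<Longrightarrow>
       (\<forall>v. chart_deriv c ?d (\<lambda>q. inv p \<otimes> q) q v = frechet_derivative H (at (snd c p, snd c q)) (0, v))"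
    by metis
  define V where "V = (\<lambda>x. (x, x)) -` U \<inter> snd c ` fst c"
  have oV: "open V"
    using U(1) is_chart_open[OF ch] unfolding V_def by (intro open_Int open_vimage continuous_intros)
  have sm: "smooth_on V (\<lambda>x. \<Sum>b\<in>onb. \<mu> (frechet_derivative H (at (x, x)) (0, b)) *\<^sub>R b)"
    using U by (intro smooth_on_sum smooth_on_scaleR smooth_on_linear_compose[OF \<mu>]
        smooth_on_frechet_apply[OF oV U(1) _ U(3)] smooth_on_Pair smooth_on_ident smooth_on_const oV)
      (auto simp: V_def)
  have "(\<Sum>b\<in>onb. \<mu> (frechet_derivative H (at (x, x)) (0, b)) *\<^sub>R b) = coord c \<mu> x" if x: "x \<in> V" for x
  proof -
    obtain g where g: "g \<in> fst c" "x = snd c g" "(snd c g, snd c g) \<in> U"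
      using x by (auto simp: V_def)
    have gG: "g \<in> carrier G"
      by (rule chart_carrier[OF c g(1)])
    have "\<mu> (frechet_derivative H (at (x, x)) (0, b)) = b \<bullet> coord c \<mu> x" for b
    proof -
      have "dL (inv g) g (from_chart A c g b) = frechet_derivative H (at (x, x)) (0, b)"
        using left_transl_charts(2)[OF c g(1) d(1), of "inv g" b] d(2) gG H[OF g(1,1,3)]
          from_chart_chart_at[OF atlas, of \<one>] by (simp add: left_transl_fun g(2))
      then show ?thesis
        using inv_form_chart(3)[OF \<mu> c g(1), of b] by (simp add: inv_form_def g(2))
    qed
    then show ?thesis
      using onb_expand[of "coord c \<mu> x"] by (simp add: inner_commute)
  qed
  then have "smooth_on V (coord c \<mu>)"
    by (rule smooth_on_cong[OF oV _ sm])
  then show "\<exists>U. open U \<and> x \<in> U \<and> smooth_on U (coord c \<mu>)"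
    using oV U(2) g0 by (intro exI[of _ V]) (auto simp: V_def)
qed

text \<open>Translation by \<open>g \<otimes> inv g0\<close> carries the value of the form at
  \<open>g0\<close> to its value at \<open>g\<close>. The right-hand side does not involve
  \<open>g\<close>, so the identity can be differentiated in \<open>g\<close>.\<close>

lemma coord_invariant:
  assumes \<mu>: "linear \<mu>" and c: "c \<in> A" and g: "g0 \<in> fst c" "g \<in> fst c"
  shows "chart_deriv c c (left_transl G (g \<otimes> inv g0)) g0 b \<bullet> coord c \<mu> (snd c g) = b \<bullet> coord c \<mu> (snd c g0)"
proof -
  have G: "g0 \<in> carrier G" "g \<in> carrier G"
    using chart_carrier[OF c] g by auto
  let ?k = "g \<otimes> inv g0"
  have kg: "?k \<otimes> g0 = g"
    using G by (simp add: m_assoc)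
  have "from_chart A c g (chart_deriv c c (left_transl G ?k) g0 b) = dL ?k g0 (from_chart A c g0 b)"
    using left_transl_charts(2)[OF c g(1) c, of ?k b] G g kg by simp
  moreover have "dL (inv g) g (dL ?k g0 v) = dL (inv g0) g0 v" for v
    using dL_mult[of ?k "inv g" g0 v] G kg by (simp add: m_assoc[symmetric])
  ultimately show ?thesis
    by (simp add: inv_form_chart(3)[OF \<mu> c] g inv_form_def)
qed

end

lemma (in lie) chart_deriv_eq_id:
  assumes "c \<in> A" "g \<in> fst c" "\<And>x. x \<in> carrier G \<Longrightarrow> f x = x"
  shows "chart_deriv c c f g v = v"
  using chart_deriv_cong[of c g f "\<lambda>x. x" c] chart_deriv_self(2)[of c g v] assms chart_carrier atlas
  by (simp add: smooth_atlas_def)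

text \<open>Both sides are mixed second derivatives of \<open>(g, h) \<mapsto> g \<otimes> inv g0 \<otimes> h\<close>; in terms of the canonical
  2-form, the graphs of the two 1-forms are symplectically orthogonal where they meet.\<close>

lemma (in lie) coord_reciprocity:
  assumes \<mu>: "linear \<mu>" and \<nu>: "linear \<nu>" and c: "c \<in> A" and g0: "g0 \<in> fst c"
    and eq: "coord c \<mu> (snd c g0) = lie.coord (opposite G) A c \<nu> (snd c g0)"
  shows "frechet_derivative (coord c \<mu>) (at (snd c g0)) a \<bullet> b =
    frechet_derivative (lie.coord (opposite G) A c \<nu>) (at (snd c g0)) b \<bullet> a"
proof -
  interpret op: lie "opposite G" A
    by (rule lie_opposite)
  let ?x0 = "snd c g0"
  have ch: "is_chart c"
    using atlas c by (simp add: smooth_atlas_def)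
  have G0: "g0 \<in> carrier G"
    by (rule chart_carrier[OF c g0(1)])
  have f: "smooth_at (prod_atlas A A) A (\<lambda>z. fst z \<otimes> inv g0 \<otimes> snd z) (g0, g0)"
    using G0 by (intro smooth_at_group) auto
  have "g0 \<otimes> inv g0 \<otimes> g0 \<in> fst c"
    using G0 g0 by simp
  from two_variable_chart[OF atlas atlas f c g0(1) c g0(1) atlas_subset_maximal[OF atlas c(1)] this]
  obtain U H where U: "open U" "(?x0, ?x0) \<in> U" "smooth_on U H"
    and H: "\<And>p q. p \<in> fst c \<Longrightarrow> q \<in> fst c \<Longrightarrow> (snd c p, snd c q) \<in> U \<Longrightarrow>
       (\<forall>v. chart_deriv c c (\<lambda>q. p \<otimes> inv g0 \<otimes> q) q v = frechet_derivative H (at (snd c p, snd c q)) (0, v)) \<and>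
       (\<forall>v. chart_deriv c c (\<lambda>p. p \<otimes> inv g0 \<otimes> q) p v = frechet_derivative H (at (snd c p, snd c q)) (v, 0))"
    by metis
  let ?D2 = "\<lambda>u v. frechet_derivative (\<lambda>z. frechet_derivative H (at z) u) (at (?x0, ?x0)) v"
  \<comment> \<open>Fixing either variable of \<open>p \<otimes> inv g0 \<otimes> q\<close> at
    \<open>g0\<close> leaves the identity map in the other.\<close>
  have id: "frechet_derivative H (at (?x0, ?x0)) (0, v) = v" "frechet_derivative H (at (?x0, ?x0)) (v, 0) = v" for v
    using H[OF g0 g0 U(2)] chart_deriv_eq_id[OF c g0, of "\<lambda>q. g0 \<otimes> inv g0 \<otimes> q" v]
      chart_deriv_eq_id[OF c g0, of "\<lambda>p. p \<otimes> inv g0 \<otimes> g0" v] G0 by (simp_all add: m_assoc)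
  \<comment> \<open>Shared by both invariance identities. The direction \<open>i b\<close> is fixed
    in one variable; \<open>j\<close> inserts the moving direction into the other, and
    \<open>l\<close> is the corresponding affine embedding through the base point. The pairing is
    constant along \<open>l\<close>, so the two terms of its product rule add up to 0.\<close>
  have der: "frechet_derivative s (at ?x0) a \<bullet> b + s ?x0 \<bullet> ?D2 (i b) (j a) = 0"
    if s: "smooth_on (snd c ` fst c) s" and ij: "linear j" "j = (\<lambda>v. (v, 0)) \<or> j = (\<lambda>v. (0, v))"
      and ib: "frechet_derivative H (at (?x0, ?x0)) (i b) = b"
      and const: "\<And>x. x \<in> snd c ` fst c \<Longrightarrow> l x \<in> U \<Longrightarrow> frechet_derivative H (at (l x)) (i b) \<bullet> s x = b \<bullet> s ?x0"
      and l: "l = (\<lambda>x. (?x0, ?x0) + j (x - ?x0))"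
    for s :: "'e \<Rightarrow> 'e" and i j l :: "'e \<Rightarrow> 'e \<times> 'e" and a b
  proof -
    have j: "bounded_linear j"
      by (rule linear_imp_bounded_linear[OF ij(1)])
    have l0: "l ?x0 = (?x0, ?x0)"
      by (simp add: l linear_0[OF ij(1)])
    have "((\<lambda>x. x - ?x0) has_derivative (\<lambda>v. v)) (at ?x0)"
      by (auto intro!: derivative_eq_intros)
    from has_derivative_add[OF has_derivative_const bounded_linear.has_derivative[OF j this]]
    have dl: "(l has_derivative j) (at ?x0)"
      by (simp add: l)
    have sm: "smooth_on U (\<lambda>z. frechet_derivative H (at z) (i b))"
      by (rule smooth_on_frechet_derivative[OF U(3)])
    have d1: "((\<lambda>x. frechet_derivative H (at (l x)) (i b)) has_derivative (\<lambda>v. ?D2 (i b) (j v))) (at ?x0)"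
      using has_derivative_compose[OF dl, of "\<lambda>z. frechet_derivative H (at z) (i b)"]
        smooth_on_has_derivative[OF sm U(2)] by (simp add: l0)
    have d2: "(s has_derivative frechet_derivative s (at ?x0)) (at ?x0)"
      using smooth_on_has_derivative[OF s] g0 by blast
    have D: "((\<lambda>x. frechet_derivative H (at (l x)) (i b) \<bullet> s x) has_derivative
        (\<lambda>v. b \<bullet> frechet_derivative s (at ?x0) v + ?D2 (i b) (j v) \<bullet> s ?x0)) (at ?x0)"
      using has_derivative_inner[OF d1 d2] by (simp add: l0 ib)
    have cont: "continuous_on UNIV l"
      unfolding l
      by (intro continuous_on_add continuous_on_const bounded_linear.continuous_on[OF j] continuous_on_diff continuous_on_id)
    have o: "open (l -` U \<inter> snd c ` fst c)"
      using open_vimage[OF U(1) cont] is_chart_open[OF ch] by (rule open_Int)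
    have m: "?x0 \<in> l -` U \<inter> snd c ` fst c"
      using l0 U(2) g0 by auto
    have "((\<lambda>x. b \<bullet> s ?x0) has_derivative
        (\<lambda>v. b \<bullet> frechet_derivative s (at ?x0) v + ?D2 (i b) (j v) \<bullet> s ?x0)) (at ?x0)"
      by (rule has_derivative_transform_within_open[OF D o m]) (elim IntE vimageE, rule const, simp_all)
    then have "(\<lambda>v. b \<bullet> frechet_derivative s (at ?x0) v + ?D2 (i b) (j v) \<bullet> s ?x0) = (\<lambda>v. 0)"
      by (rule has_derivative_unique[OF _ has_derivative_const])
    from fun_cong[OF this, of a] show ?thesis
      by (simp add: inner_commute)
  qed
  have 1: "frechet_derivative (coord c \<mu>) (at ?x0) a \<bullet> b + coord c \<mu> ?x0 \<bullet> ?D2 (0, b) (a, 0) = 0"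
  proof (rule der[where i = "\<lambda>v. (0, v)" and j = "\<lambda>v. (v, 0)" and l = "\<lambda>x. (x, ?x0)", OF coord_smooth[OF \<mu> c] _ _ id(1)])
    fix x assume "x \<in> snd c ` fst c" "(x, ?x0) \<in> U"
    then obtain g where g: "g \<in> fst c" "x = snd c g" "(snd c g, ?x0) \<in> U"
      by auto
    show "frechet_derivative H (at (x, ?x0)) (0, b) \<bullet> coord c \<mu> x = b \<bullet> coord c \<mu> ?x0"
      using coord_invariant[OF \<mu> c g0 g(1), of b] H[OF g(1) g0 g(3)] by (simp add: left_transl_fun g(2))
  qed (auto simp: linear_iff)
  have 2: "frechet_derivative (op.coord c \<nu>) (at ?x0) b \<bullet> a + op.coord c \<nu> ?x0 \<bullet> ?D2 (a, 0) (0, b) = 0"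
  proof (rule der[where i = "\<lambda>v. (v, 0)" and j = "\<lambda>v. (0, v)" and l = "\<lambda>x. (?x0, x)", OF op.coord_smooth[OF \<nu> c] _ _ id(2)])
    fix x assume "x \<in> snd c ` fst c" "(?x0, x) \<in> U"
    then obtain g where g: "g \<in> fst c" "x = snd c g" "(?x0, snd c g) \<in> U"
      by auto
    have gG: "g \<in> carrier G"
      by (rule chart_carrier[OF c g(1)])
    \<comment> \<open>Left translation in the opposite group by its product of \<open>g\<close> and
      \<open>inv g0\<close> is right translation by \<open>inv g0 \<otimes> g\<close>.\<close>
    have "chart_deriv c c (\<lambda>p. p \<otimes> (inv g0 \<otimes> g)) g0 a = chart_deriv c c (\<lambda>p. p \<otimes> inv g0 \<otimes> g) g0 a"
      using chart_deriv_cong[OF ch g0, of "\<lambda>p. p \<otimes> (inv g0 \<otimes> g)" "\<lambda>p. p \<otimes> inv g0 \<otimes> g" c] gG G0 chart_carrier[OF c]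
      by (simp add: m_assoc)
    then show "frechet_derivative H (at (?x0, x)) (a, 0) \<bullet> op.coord c \<nu> x = a \<bullet> op.coord c \<nu> ?x0"
      using op.coord_invariant[OF \<nu> c g0 g(1), of a] H[OF g0 g(1,3)] by (simp add: right_transl_fun g(2))
  qed (auto simp: linear_iff)
  show ?thesis
    using 1 2 eq second_derivative_symmetric[OF U(1,2,3), of "(0, b)" "(a, 0)"] by simp
qed

subsection \<open>The left momentum map along a left-invariant 1-form\<close>

context lie begin

text \<open>\<open>E\<close> collects the coordinate expressions of the right-invariant vector
  fields, on which the left momentum map evaluates a covector.\<close>

lemma right_frame:
  assumes c: "c \<in> A" and g0: "g0 \<in> fst c"
  obtains V E where "open V" "snd c g0 \<in> V" "\<And>b. smooth_on V (\<lambda>x. E x b)"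
    "\<And>g b. g \<in> fst c \<Longrightarrow> snd c g \<in> V \<Longrightarrow> dR g \<one> b = from_chart A c g (E (snd c g) b)"
proof -
  have G0: "g0 \<in> carrier G"
    by (rule chart_carrier[OF c g0(1)])
  let ?d = "chart_at A \<one>"
  have d: "?d \<in> A" "\<one> \<in> fst ?d"
    using chart_at[of \<one> A] by simp_all
  have f: "smooth_at (prod_atlas A A) A (\<lambda>z. fst z \<otimes> snd z) (\<one>, g0)"
    using G0 by (intro smooth_at_group) auto
  have "\<one> \<otimes> g0 \<in> fst c"
    using G0 g0 by simp
  from two_variable_chart[OF atlas atlas f d c g0 atlas_subset_maximal[OF atlas c] this]
  obtain U H where U: "open U" "(snd ?d \<one>, snd c g0) \<in> U" "smooth_on U H"
    and H: "\<And>p q. p \<in> fst ?d \<Longrightarrow> q \<in> fst c \<Longrightarrow> (snd ?d p, snd c q) \<in> U \<Longrightarrow>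
       (\<forall>v. chart_deriv ?d c (\<lambda>p. p \<otimes> q) p v = frechet_derivative H (at (snd ?d p, snd c q)) (v, 0))"
    by metis
  define V where "V = (\<lambda>x. (snd ?d \<one>, x)) -` U"
  define E where "E x b = frechet_derivative H (at (snd ?d \<one>, x)) (b, 0)" for x b
  have oV: "open V"
    using U(1) unfolding V_def by (intro open_vimage continuous_intros)
  show ?thesis
  proof (rule that[OF oV])
    show "snd c g0 \<in> V"
      using U(2) by (simp add: V_def)
    show "smooth_on V (\<lambda>x. E x b)" for b
      unfolding E_def using U
      by (intro smooth_on_frechet_apply[OF oV U(1) _ U(3)] smooth_on_Pair smooth_on_ident smooth_on_const oV)
        (auto simp: V_def)
    fix g b assume g: "g \<in> fst c" "snd c g \<in> V"
    have gG: "g \<in> carrier G"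
      by (rule chart_carrier[OF c g(1)])
    have "chart_deriv ?d c (right_transl G g) \<one> b = E (snd c g) b"
      using H[OF d(2) g(1)] g(2) by (simp add: right_transl_fun V_def E_def)
    moreover have "from_chart A c (right_transl G g \<one>) (chart_deriv ?d c (right_transl G g) \<one> b) =
        dR g \<one> (from_chart A ?d \<one> b)"
      using g gG d by (intro smooth_at_charts(2)[OF atlas atlas smooth_at_right] atlas_subset_maximal[OF atlas] c)
        (auto simp: right_transl_def)
    ultimately show "dR g \<one> b = from_chart A c g (E (snd c g) b)"
      using gG from_chart_chart_at[OF atlas, of \<one>] by (simp add: right_transl_def[of G g])
  qed
qed

text \<open>The left momentum along the left-invariant form, represented by a vector through
  \<open>covec\<close> so that the constant rank argument applies; its level sets describe the
  intersections of the fibres.\<close>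

definition left_coord :: "('g, 'e) chart \<Rightarrow> ('e \<Rightarrow> real) \<Rightarrow> 'e \<Rightarrow> 'e" where
  "left_coord c \<mu> x = covec (momentum_left G A (inv_form \<mu> (chart_inv c x)))"

lemma left_coord_chart: "c \<in> A \<Longrightarrow> g \<in> fst c \<Longrightarrow> left_coord c \<mu> (snd c g) = covec (momentum_left G A (inv_form \<mu> g))"
  using atlas by (simp add: left_coord_def smooth_atlas_def chart_inv_chart)

text \<open>On the right-invariant frame a right-invariant form has constant components, whereas
  those of the left-invariant form make up the left momentum. Comparing the two isolates the
  difference of the forms.\<close>

lemma left_coord_local:
  assumes \<mu>: "linear \<mu>" and c: "c \<in> A" and g0: "g0 \<in> fst c"
  obtains V E where "open V" "snd c g0 \<in> V" "V \<subseteq> snd c ` fst c" "\<And>b. smooth_on V (\<lambda>x. E x b)"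
    "\<And>x. x \<in> V \<Longrightarrow> left_coord c \<mu> x = (\<Sum>b\<in>onb. (E x b \<bullet> coord c \<mu> x) *\<^sub>R b)"
    "\<And>\<nu> x b. linear \<nu> \<Longrightarrow> x \<in> V \<Longrightarrow> E x b \<bullet> lie.coord (opposite G) A c \<nu> x = \<nu> b"
proof -
  interpret op: lie "opposite G" A
    by (rule lie_opposite)
  have ch: "is_chart c"
    using atlas c by (simp add: smooth_atlas_def)
  obtain V E where V: "open V" "snd c g0 \<in> V" "\<And>b. smooth_on V (\<lambda>x. E x b)"
    and E: "\<And>g b. g \<in> fst c \<Longrightarrow> snd c g \<in> V \<Longrightarrow> dR g \<one> b = from_chart A c g (E (snd c g) b)"
    by (rule right_frame[OF c g0]) blast
  let ?V = "V \<inter> snd c ` fst c"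
  show ?thesis
  proof (rule that)
    show "open ?V" "snd c g0 \<in> ?V" "?V \<subseteq> snd c ` fst c" "\<And>b. smooth_on ?V (\<lambda>x. E x b)"
      using V is_chart_open[OF ch] g0 smooth_on_subset[OF V(3)] by auto
    fix x assume x: "x \<in> ?V"
    then obtain g where g: "g \<in> fst c" "x = snd c g" "snd c g \<in> V"
      by auto
    have gG: "g \<in> carrier G"
      by (rule chart_carrier[OF c g(1)])
    show "left_coord c \<mu> x = (\<Sum>b\<in>onb. (E x b \<bullet> coord c \<mu> x) *\<^sub>R b)"
      using covec_onb[OF momentum_left_linear[OF inv_form_mem[OF \<mu> gG]]] gG
      by (simp add: g(2) left_coord_chart[OF c g(1)] inv_form_chart(3)[OF \<mu> c g(1)] momentum_left_eq E[OF g(1,3)])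
    fix \<nu> b assume \<nu>: "linear (\<nu> :: 'e \<Rightarrow> real)"
    have "snd (op.inv_form \<nu> g) (dR g \<one> b) = \<nu> b"
      using op.momentum_right_inv_form[of g \<nu>] momentum_left_eq[of "op.inv_form \<nu> g"] gG by (simp add: fun_eq_iff)
    then show "E x b \<bullet> op.coord c \<nu> x = \<nu> b"
      by (simp add: g(2) op.inv_form_chart(3)[OF \<nu> c g(1)] E[OF g(1,3)])
  qed
qed

lemma left_coord_smooth:
  assumes \<mu>: "linear \<mu>" and c: "c \<in> A"
  shows "smooth_on (snd c ` fst c) (left_coord c \<mu>)"
proof (rule smooth_on_local)
  fix x assume "x \<in> snd c ` fst c"
  then obtain g0 where g0: "g0 \<in> fst c" "x = snd c g0"
    by auto
  obtain V E where V: "open V" "snd c g0 \<in> V" "V \<subseteq> snd c ` fst c" "\<And>b. smooth_on V (\<lambda>x. E x b)"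
    and E: "\<And>x. x \<in> V \<Longrightarrow> left_coord c \<mu> x = (\<Sum>b\<in>onb. (E x b \<bullet> coord c \<mu> x) *\<^sub>R b)"
    by (rule left_coord_local[OF \<mu> c g0(1)]) blast
  have "smooth_on V (\<lambda>x. \<Sum>b\<in>onb. (E x b \<bullet> coord c \<mu> x) *\<^sub>R b)"
    by (intro smooth_on_sum smooth_on_scaleR smooth_on_inner V(1,4) smooth_on_const smooth_on_subset[OF coord_smooth[OF \<mu> c] V(3)])
  then have "smooth_on V (left_coord c \<mu>)"
    by (rule smooth_on_cong[OF V(1), rotated]) (simp add: E)
  then show "\<exists>U. open U \<and> x \<in> U \<and> smooth_on U (left_coord c \<mu>)"
    using V g0 by blast
qed

text \<open>Up to a constant, \<open>left_coord\<close> consists of the pairings of the frame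
  \<open>E\<close> with the difference of the two forms. That difference vanishes at the meeting
  point, so the derivative of the frame drops out and only the derivative of the difference
  remains.\<close>

lemma left_coord_kernel:
  assumes \<mu>: "linear \<mu>" and \<nu>: "linear \<nu>" and c: "c \<in> A" and g0: "g0 \<in> fst c"
    and eq: "coord c \<mu> (snd c g0) = lie.coord (opposite G) A c \<nu> (snd c g0)"
    and deq: "frechet_derivative (coord c \<mu>) (at (snd c g0)) a =
      frechet_derivative (lie.coord (opposite G) A c \<nu>) (at (snd c g0)) a"
  shows "frechet_derivative (left_coord c \<mu>) (at (snd c g0)) a = 0"
proof -
  interpret op: lie "opposite G" A
    by (rule lie_opposite)
  let ?x0 = "snd c g0"
  obtain V E where V: "open V" "?x0 \<in> V" "V \<subseteq> snd c ` fst c" "\<And>b. smooth_on V (\<lambda>x. E x b)"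
    and E: "\<And>x. x \<in> V \<Longrightarrow> left_coord c \<mu> x = (\<Sum>b\<in>onb. (E x b \<bullet> coord c \<mu> x) *\<^sub>R b)"
    and E': "\<And>\<nu> x b. linear \<nu> \<Longrightarrow> x \<in> V \<Longrightarrow> E x b \<bullet> op.coord c \<nu> x = \<nu> b"
    by (rule left_coord_local[OF \<mu> c g0(1)]) blast
  let ?s = "\<lambda>x. coord c \<mu> x - op.coord c \<nu> x"
  let ?Ds = "\<lambda>v. frechet_derivative (coord c \<mu>) (at ?x0) v - frechet_derivative (op.coord c \<nu>) (at ?x0) v"
  have x0: "?x0 \<in> snd c ` fst c"
    using g0 by blast
  have ds: "(?s has_derivative ?Ds) (at ?x0)"
    by (intro has_derivative_diff smooth_on_has_derivative[OF coord_smooth[OF \<mu> c] x0]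
        smooth_on_has_derivative[OF op.coord_smooth[OF \<nu> c] x0])
  have "((\<lambda>x. E x b \<bullet> ?s x) has_derivative (\<lambda>v. E ?x0 b \<bullet> ?Ds v)) (at ?x0)" for b
    using has_derivative_inner[OF smooth_on_has_derivative[OF V(4,2)] ds] by (simp add: eq)
  then have "((\<lambda>x. (\<Sum>b\<in>onb. \<nu> b *\<^sub>R b) + (\<Sum>b\<in>onb. (E x b \<bullet> ?s x) *\<^sub>R b)) has_derivative
      (\<lambda>v. 0 + (\<Sum>b\<in>onb. (E ?x0 b \<bullet> ?Ds v) *\<^sub>R b))) (at ?x0)"
    by (intro has_derivative_add has_derivative_const has_derivative_sum has_derivative_scaleR_left)
  then have "(left_coord c \<mu> has_derivative (\<lambda>v. 0 + (\<Sum>b\<in>onb. (E ?x0 b \<bullet> ?Ds v) *\<^sub>R b))) (at ?x0)"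
  proof (rule has_derivative_transform_within_open[OF _ V(1,2)])
    fix x assume x: "x \<in> V"
    show "(\<Sum>b\<in>onb. \<nu> b *\<^sub>R b) + (\<Sum>b\<in>onb. (E x b \<bullet> ?s x) *\<^sub>R b) = left_coord c \<mu> x"
      unfolding E[OF x] sum.distrib[symmetric] by (simp add: inner_diff_right E'[OF \<nu> x] algebra_simps)
  qed
  then have "frechet_derivative (left_coord c \<mu>) (at ?x0) = (\<lambda>v. 0 + (\<Sum>b\<in>onb. (E ?x0 b \<bullet> ?Ds v) *\<^sub>R b))"
    by (rule frechet_derivative_at[symmetric])
  then show ?thesis
    by (simp add: deq)
qed

text \<open>Equivariance under left translations is what makes the rank of \<open>left_coord\<close> constant.\<close>

lemma left_coord_transport:
  assumes \<mu>: "linear \<mu>" and c0: "c0 \<in> A" "g0 \<in> fst c0" and c1: "c1 \<in> A" "g1 \<in> fst c1"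
  defines "P \<equiv> chart_deriv c0 c1 (left_transl G (g1 \<otimes> inv g0)) g0"
  shows "linear P" "inj P"
    "frechet_derivative (left_coord c0 \<mu>) (at (snd c0 g0)) n = 0 \<Longrightarrow>
     frechet_derivative (left_coord c1 \<mu>) (at (snd c1 g1)) (P n) = 0"
proof -
  have ch: "is_chart c0" "is_chart c1"
    using atlas c0 c1 by (auto simp: smooth_atlas_def)
  have G: "g0 \<in> carrier G" "g1 \<in> carrier G"
    using chart_carrier c0 c1 by auto
  define k where "k = g1 \<otimes> inv g0"
  have k: "k \<in> carrier G" "k \<otimes> g0 = g1" "inv k \<otimes> g1 = g0"
    using G by (auto simp: k_def m_assoc inv_mult_group)
  have L: "smooth_in_charts c0 c1 (left_transl G k) g0"
    using left_transl_charts(1)[OF c0 c1(1) k(1)] k c1 by simp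
  have L': "smooth_in_charts c1 c0 (left_transl G (inv k)) g1"
    using left_transl_charts(1)[OF c1 c0(1), of "inv k"] k c0 by simp
  have P: "P = chart_deriv c0 c1 (left_transl G k) g0"
    by (simp add: P_def k_def)
  show "linear P"
    unfolding P by (rule chart_deriv_linear[OF L ch(1)])
  have "chart_deriv c1 c0 (left_transl G (inv k)) g1 (P v) = v" for v
  proof -
    have L'': "smooth_in_charts c1 c0 (left_transl G (inv k)) (left_transl G k g0)"
      using L' k by (simp add: left_transl_def[of G k g0])
    have "chart_deriv c0 c0 (\<lambda>x. left_transl G (inv k) (left_transl G k x)) g0 v = v"
      by (rule chart_deriv_eq_id[OF c0]) (use k(1) in \<open>simp add: left_transl_def m_assoc[symmetric]\<close>)
    then show ?thesis
      using smooth_in_charts_compose(2)[OF ch L L'', of v] k by (simp add: P left_transl_def[of G k g0])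
  qed
  then show "inj P"
    by (metis injI)
  assume n: "frechet_derivative (left_coord c0 \<mu>) (at (snd c0 g0)) n = 0"
  obtain U where U: "open U" "snd c0 g0 \<in> U" "U \<subseteq> snd c0 ` fst c0"
    "\<And>x. x \<in> U \<Longrightarrow> left_transl G k (chart_inv c0 x) \<in> fst c1" "smooth_on U (snd c1 \<circ> left_transl G k \<circ> chart_inv c0)"
    using smooth_in_chartsE[OF L ch(1)] by metis
  let ?\<phi> = "snd c1 \<circ> left_transl G k \<circ> chart_inv c0"
  \<comment> \<open>The coadjoint action of \<open>k\<close> on the vectors that represent
    covectors. Equivariance says that translation by \<open>k\<close>, in coordinates, intertwines
    \<open>left_coord\<close> with this linear map.\<close>
  define C where "C y = covec (\<lambda>v. Ad G A (inv k) v \<bullet> y)" for y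
  have linAd: "linear (\<lambda>v. Ad G A (inv k) v \<bullet> y)" for y
    using linear_compose[OF Ad_linear, of "inv k" "\<lambda>v. v \<bullet> y"] k(1)
    by (simp add: o_def bounded_linear.linear bounded_linear_inner_left)
  have "C y = (\<Sum>b\<in>onb. (Ad G A (inv k) b \<bullet> y) *\<^sub>R b)" for y
    unfolding C_def by (rule covec_onb[OF linAd])
  then have linC: "linear C"
    by (simp add: linear_iff inner_add_right scaleR_add_left sum.distrib scaleR_sum_right)
  have equivariant: "left_coord c1 \<mu> (?\<phi> x) = C (left_coord c0 \<mu> x)" if x: "x \<in> U" for x
  proof -
    obtain g where g: "g \<in> fst c0" "x = snd c0 g"
      using x U(3) by auto
    have gG: "g \<in> carrier G"
      by (rule chart_carrier[OF c0(1) g(1)])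
    have inv: "chart_inv c0 x = g"
      using chart_inv_chart[OF ch(1) g(1)] by (simp add: g(2))
    have kg: "k \<otimes> g \<in> fst c1"
      using U(4)[OF x] by (simp add: inv left_transl_def[of G k g])
    have lin: "linear (momentum_left G A (inv_form \<mu> g))"
      by (rule momentum_left_linear[OF inv_form_mem[OF \<mu> gG]])
    have "momentum_left G A (inv_form \<mu> (k \<otimes> g)) = momentum_left G A (inv_form \<mu> g) \<circ> Ad G A (inv k)"
      using momentum_left_lift[OF k(1) inv_form_mem[OF \<mu> gG]] lift_left_inv_form[OF k(1) gG]
      by (simp add: coadjoint_def)
    also have "\<dots> = (\<lambda>v. Ad G A (inv k) v \<bullet> covec (momentum_left G A (inv_form \<mu> g)))"
      by (simp add: inner_covec[OF lin] o_def)
    finally have "covec (momentum_left G A (inv_form \<mu> (k \<otimes> g))) = C (covec (momentum_left G A (inv_form \<mu> g)))"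
      by (simp add: C_def)
    then show ?thesis
      using left_coord_chart[OF c1(1) kg] left_coord_chart[OF c0(1) g(1)]
      by (simp add: inv left_transl_def[of G k g] g(2)[symmetric])
  qed
  have \<phi>0: "?\<phi> (snd c0 g0) = snd c1 g1"
    using chart_inv_chart[OF ch(1) c0(2)] k by (simp add: left_transl_def[of G k g0])
  have "frechet_derivative (\<lambda>x. left_coord c1 \<mu> (?\<phi> x)) (at (snd c0 g0)) n =
      frechet_derivative (\<lambda>x. C (left_coord c0 \<mu> x)) (at (snd c0 g0)) n"
    using frechet_derivative_cong_open[OF U(1,2), of "\<lambda>x. left_coord c1 \<mu> (?\<phi> x)" "\<lambda>x. C (left_coord c0 \<mu> x)"]
      equivariant by simp
  also have "\<dots> = C (frechet_derivative (left_coord c0 \<mu>) (at (snd c0 g0)) n)"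
    using c0 by (intro frechet_derivative_linear_compose[OF linC left_coord_smooth[OF \<mu> c0(1)]]) auto
  also have "\<dots> = 0"
    using n linear_0[OF linC] by simp
  finally have "frechet_derivative (\<lambda>x. left_coord c1 \<mu> (?\<phi> x)) (at (snd c0 g0)) n = 0" .
  moreover have "frechet_derivative (\<lambda>x. left_coord c1 \<mu> (?\<phi> x)) (at (snd c0 g0)) n =
      frechet_derivative (left_coord c1 \<mu>) (at (snd c1 g1)) (P n)"
  proof -
    have "?\<phi> (snd c0 g0) \<in> snd c1 ` fst c1"
      using \<phi>0 c1 by simp
    from frechet_derivative_compose[OF U(5) left_coord_smooth[OF \<mu> c1(1)] U(2) this, of n] \<phi>0
    show ?thesis
      by (simp only: P chart_deriv_def)
  qed
  ultimately show "frechet_derivative (left_coord c1 \<mu>) (at (snd c1 g1)) (P n) = 0"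
    by simp
qed

end

text \<open>Makes the whole manifold an admissible neighbourhood in
  \<open>smooth_map_submanifold\<close>. Since the topology is given through
  \<open>topology\<close>, its family of sets has to be shown to be one; injectivity of charts
  handles intersections.\<close>

lemma openin_manifold_topology:
  assumes A: "smooth_atlas A"
  shows "openin (manifold_topology A) (points A)"
proof -
  let ?P = "\<lambda>U. U \<subseteq> points A \<and> (\<forall>c\<in>A. open (snd c ` (U \<inter> fst c)))"
  have ch: "is_chart c" if "c \<in> A" for c
    using A that by (simp add: smooth_atlas_def)
  have "istopology ?P"
    unfolding istopology_def
  proof (intro conjI allI impI ballI)
    fix S T c assume *: "?P S" "?P T"
    then show "S \<inter> T \<subseteq> points A"
      by auto
    assume c: "c \<in> A"
    have "snd c ` (S \<inter> T \<inter> fst c) = snd c ` (S \<inter> fst c) \<inter> snd c ` (T \<inter> fst c)"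
      using is_chart_inj[OF ch[OF c]] by (auto simp: inj_on_def)
    then show "open (snd c ` (S \<inter> T \<inter> fst c))"
      using * c by (simp add: open_Int)
  next
    fix K c assume K: "\<forall>S\<in>K. ?P S"
    then show "\<Union>K \<subseteq> points A"
      by auto
    assume c: "c \<in> A"
    have "snd c ` (\<Union>K \<inter> fst c) = (\<Union>S\<in>K. snd c ` (S \<inter> fst c))"
      by auto
    then show "open (snd c ` (\<Union>K \<inter> fst c))"
      using K c by auto
  qed
  then have "openin (manifold_topology A) U \<longleftrightarrow> ?P U" for U
    unfolding manifold_topology_def by (simp add: topology_inverse')
  moreover have "open (snd c ` (points A \<inter> fst c))" if "c \<in> A" for c
  proof -
    have "points A \<inter> fst c = fst c"
      using that by (auto simp: points_def)
    then show ?thesis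
      using is_chart_open[OF ch[OF that]] by simp
  qed
  ultimately show ?thesis
    by blast
qed

subsection \<open>The fibres and their intersection as submanifolds\<close>

context lie begin

lemma inv_form_iff:
  assumes \<mu>: "linear \<mu>" and c: "c \<in> A" and \<xi>: "\<xi> \<in> fst (cotangent_chart A c)"
  shows "\<xi> \<in> inv_form \<mu> ` carrier G \<longleftrightarrow> snd (snd (cotangent_chart A c) \<xi>) = coord c \<mu> (snd c (fst \<xi>))"
    "\<xi> \<in> inv_form \<mu> ` carrier G \<longleftrightarrow> \<xi> = inv_form \<mu> (fst \<xi>)"
proof -
  have g: "fst \<xi> \<in> fst c"
    using \<xi> by (simp add: cotangent_chart_simps)
  show *: "\<xi> \<in> inv_form \<mu> ` carrier G \<longleftrightarrow> \<xi> = inv_form \<mu> (fst \<xi>)"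
    using chart_carrier[OF c g] by auto
  have "inj_on (snd (cotangent_chart A c)) (fst (cotangent_chart A c))"
    by (rule is_chart_inj[OF is_chart_cotangent[OF atlas c]])
  then have "\<xi> = inv_form \<mu> (fst \<xi>) \<longleftrightarrow> snd (cotangent_chart A c) \<xi> = snd (cotangent_chart A c) (inv_form \<mu> (fst \<xi>))"
    using \<xi> inv_form_chart(1)[OF \<mu> c g] by (auto simp: inj_on_def)
  also have "\<dots> \<longleftrightarrow> snd (snd (cotangent_chart A c) \<xi>) = coord c \<mu> (snd c (fst \<xi>))"
    using inv_form_chart(2)[OF \<mu> c g] by (simp add: prod_eq_iff cotangent_chart_simps(2)[of A c \<xi>])
  finally show "\<xi> \<in> inv_form \<mu> ` carrier G \<longleftrightarrow> snd (snd (cotangent_chart A c) \<xi>) = coord c \<mu> (snd c (fst \<xi>))"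
    using * by simp
qed

lemma slice_chartI:
  assumes "c' \<in> maximal_atlas T" "subspace V" "\<And>\<xi>. \<xi> \<in> fst c' \<Longrightarrow> \<xi> \<in> S \<longleftrightarrow> snd c' \<xi> \<in> V"
  shows "slice_chart T S c' V"
  unfolding slice_chart_def using assms by auto

lemma subspace_Times_zero: "subspace N \<Longrightarrow> subspace (N \<times> {0 :: 'e})"
  by (auto simp: subspace_def zero_prod_def)

text \<open>\<open>graph_chart\<close> with the identity as straightening map: the fibre lies over
  all of the base, so only the shear is needed.\<close>

lemma fibre_slice:
  assumes \<mu>: "linear \<mu>" and c: "c \<in> A" and g0: "g0 \<in> fst c"
  obtains c' where "slice_chart (cotangent_atlas A) (inv_form \<mu> ` carrier G) c' (UNIV \<times> {0})" "inv_form \<mu> g0 \<in> fst c'"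
    "\<And>a. from_chart (cotangent_atlas A) c' (inv_form \<mu> g0) (a, 0) =
      from_chart (cotangent_atlas A) (cotangent_chart A c) (inv_form \<mu> g0) (a, frechet_derivative (coord c \<mu>) (at (snd c g0)) a)"
proof -
  have ch: "is_chart c"
    using atlas c by (simp add: smooth_atlas_def)
  let ?X = "snd c ` fst c"
  have id: "frechet_derivative (\<lambda>x::'e. x) (at x) = (\<lambda>v. v)" for x
    by (rule frechet_derivative_at[OF has_derivative_ident, symmetric])
  obtain c' where c': "c' \<in> maximal_atlas (cotangent_atlas A)"
    and dom: "fst c' = {\<xi> \<in> fst (cotangent_chart A c). snd c (fst \<xi>) \<in> ?X}"
    and snd: "\<And>\<xi>. snd c' \<xi> = (fst (snd (cotangent_chart A c) \<xi>),
        snd (snd (cotangent_chart A c) \<xi>) - coord c \<mu> (fst (snd (cotangent_chart A c) \<xi>)))"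
    and der: "\<And>\<xi> u. \<xi> \<in> fst c' \<Longrightarrow> from_chart (cotangent_atlas A) c' \<xi> (u, 0) =
       from_chart (cotangent_atlas A) (cotangent_chart A c) \<xi> (u, frechet_derivative (coord c \<mu>) (at (snd c (fst \<xi>))) u)"
    by (rule graph_chart[OF atlas c is_chart_open[OF ch] order_refl is_chart_open[OF ch] image_ident
          smooth_on_ident smooth_on_ident refl coord_smooth[OF \<mu> c], unfolded id]) blast
  have mem: "inv_form \<mu> g0 \<in> fst c'"
    using inv_form_chart(1)[OF \<mu> c g0] g0 by (simp add: dom)
  have slice: "slice_chart (cotangent_atlas A) (inv_form \<mu> ` carrier G) c' (UNIV \<times> {0})"
  proof (rule slice_chartI[OF c' subspace_Times_zero[OF subspace_UNIV]])
    fix \<xi> assume "\<xi> \<in> fst c'"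
    then have \<xi>: "\<xi> \<in> fst (cotangent_chart A c)"
      by (simp add: dom)
    show "\<xi> \<in> inv_form \<mu> ` carrier G \<longleftrightarrow> snd c' \<xi> \<in> UNIV \<times> {0}"
      unfolding inv_form_iff(1)[OF \<mu> c \<xi>] snd by (simp add: cotangent_chart_simps)
  qed
  show ?thesis
    by (rule that[OF slice mem]) (use der[OF mem] in simp)
qed

text \<open>A covector is determined by its base point and its left momentum, being the value there
  of the right-invariant form with that momentum.\<close>

lemma momentum_left_eq_iff:
  assumes \<mu>: "linear \<mu>" and \<nu>: "linear \<nu>" and g: "g \<in> carrier G"
  shows "inv_form \<mu> g = lie.inv_form (opposite G) A \<nu> g \<longleftrightarrow> momentum_left G A (inv_form \<mu> g) = \<nu>"
proof -
  interpret op: lie "opposite G" A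
    by (rule lie_opposite)
  show ?thesis
    using op.inv_form_momentum_right[OF inv_form_mem[OF \<mu> g]] op.momentum_right_inv_form[of g \<nu>] g by auto
qed

definition inter_kernel :: "('g, 'e) chart \<Rightarrow> ('e \<Rightarrow> real) \<Rightarrow> 'g \<Rightarrow> 'e set" where
  "inter_kernel c \<mu> g = {n. frechet_derivative (left_coord c \<mu>) (at (snd c g)) n = 0}"

text \<open>Within the graph of the left-invariant form the intersection lies over a level set of
  \<open>left_coord\<close>. The constant rank theorem straightens this set in the base, and the
  shear of \<open>graph_chart\<close> flattens the graph over it.\<close>

lemma inter_slice:
  assumes \<mu>: "linear \<mu>" and \<nu>: "linear \<nu>" and c: "c \<in> A" and g0: "g0 \<in> fst c"
    and meet: "inv_form \<mu> g0 = lie.inv_form (opposite G) A \<nu> g0"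
  obtains c' where
    "slice_chart (cotangent_atlas A) (inv_form \<mu> ` carrier G \<inter> lie.inv_form (opposite G) A \<nu> ` carrier G) c'
      (inter_kernel c \<mu> g0 \<times> {0})"
    "inv_form \<mu> g0 \<in> fst c'"
    "\<And>a. from_chart (cotangent_atlas A) c' (inv_form \<mu> g0) (a, 0) =
      from_chart (cotangent_atlas A) (cotangent_chart A c) (inv_form \<mu> g0) (a, frechet_derivative (coord c \<mu>) (at (snd c g0)) a)"
proof -
  interpret op: lie "opposite G" A
    by (rule lie_opposite)
  have ch: "is_chart c"
    using atlas c by (simp add: smooth_atlas_def)
  let ?X = "snd c ` fst c" and ?x0 = "snd c g0" and ?F = "left_coord c \<mu>"
  let ?N = "inter_kernel c \<mu> g0"
  \<comment> \<open>The transport required by the constant rank theorem: the derivative of the left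
    translation that carries \<open>g0\<close> to the point with coordinates
    \<open>x\<close>.\<close>
  define P where "P x = chart_deriv c c (left_transl G (chart_inv c x \<otimes> inv g0)) g0" for x
  have x0: "?x0 \<in> ?X"
    using g0 by simp
  have P: "linear (P x)" "inj (P x)"
    "frechet_derivative ?F (at ?x0) n = 0 \<Longrightarrow> frechet_derivative ?F (at x) (P x n) = 0" if "x \<in> ?X" for x n
    using left_coord_transport(1,2)[OF \<mu> c g0 c inv_into_into[OF that]]
      left_coord_transport(3)[OF \<mu> c g0 c inv_into_into[OF that], of n] f_inv_into_f[OF that]
    by (simp_all add: P_def)
  obtain U V \<Phi> \<Psi> where U: "open U" "U \<subseteq> ?X" "?x0 \<in> U" and V: "open V" "\<Phi> ` U = V"
    and \<Phi>: "smooth_on U \<Phi>" and \<Psi>: "smooth_on V \<Psi>" "\<And>x. x \<in> U \<Longrightarrow> \<Psi> (\<Phi> x) = x"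
    and D\<Phi>: "\<And>v. frechet_derivative \<Phi> (at ?x0) v = v"
    and level: "\<And>x. x \<in> U \<Longrightarrow> ?F x = ?F ?x0 \<longleftrightarrow> \<Phi> x \<in> ?N"
    unfolding inter_kernel_def
    by (rule constant_rank_level_set[OF is_chart_open[OF ch] x0 left_coord_smooth[OF \<mu> c] P]) blast+
  obtain c' where c': "c' \<in> maximal_atlas (cotangent_atlas A)"
    and dom: "fst c' = {\<xi> \<in> fst (cotangent_chart A c). snd c (fst \<xi>) \<in> U}"
    and snd: "\<And>\<xi>. snd c' \<xi> = (\<Phi> (fst (snd (cotangent_chart A c) \<xi>)),
        snd (snd (cotangent_chart A c) \<xi>) - coord c \<mu> (fst (snd (cotangent_chart A c) \<xi>)))"
    and der: "\<And>\<xi> u. \<xi> \<in> fst c' \<Longrightarrow> from_chart (cotangent_atlas A) c' \<xi> (u, 0) =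
       from_chart (cotangent_atlas A) (cotangent_chart A c) \<xi>
         (frechet_derivative \<Psi> (at (\<Phi> (snd c (fst \<xi>)))) u,
          frechet_derivative (coord c \<mu>) (at (snd c (fst \<xi>))) (frechet_derivative \<Psi> (at (\<Phi> (snd c (fst \<xi>)))) u))"
    by (rule graph_chart[OF atlas c U(1,2) V \<Phi> \<Psi> smooth_on_subset[OF coord_smooth[OF \<mu> c] U(2)]]) blast+
  have mem: "inv_form \<mu> g0 \<in> fst c'"
    using inv_form_chart(1)[OF \<mu> c g0] U(3) by (simp add: dom)
  have "linear (frechet_derivative ?F (at ?x0))"
    by (rule smooth_on_frechet_linear[OF left_coord_smooth[OF \<mu> c] x0])
  then have subN: "subspace ?N"
    unfolding inter_kernel_def by (rule linear_subspace_kernel)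
  have slice: "slice_chart (cotangent_atlas A) (inv_form \<mu> ` carrier G \<inter> op.inv_form \<nu> ` carrier G) c' (?N \<times> {0})"
  proof (rule slice_chartI[OF c' subspace_Times_zero[OF subN]])
    fix \<xi> assume \<xi>': "\<xi> \<in> fst c'"
    then have \<xi>: "\<xi> \<in> fst (cotangent_chart A c)" and xU: "snd c (fst \<xi>) \<in> U"
      by (simp_all add: dom)
    have g: "fst \<xi> \<in> fst c"
      using \<xi> by (simp add: cotangent_chart_simps)
    note gG = chart_carrier[OF c g] and gG0 = chart_carrier[OF c g0]
    have "\<xi> \<in> inv_form \<mu> ` carrier G \<inter> op.inv_form \<nu> ` carrier G \<longleftrightarrow>
        \<xi> = inv_form \<mu> (fst \<xi>) \<and> inv_form \<mu> (fst \<xi>) = op.inv_form \<nu> (fst \<xi>)"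
      using inv_form_iff(2)[OF \<mu> c \<xi>] op.inv_form_iff(2)[OF \<nu> c \<xi>] by auto
    also have "inv_form \<mu> (fst \<xi>) = op.inv_form \<nu> (fst \<xi>) \<longleftrightarrow> ?F (snd c (fst \<xi>)) = ?F ?x0"
    proof -
      have \<nu>_eq: "momentum_left G A (inv_form \<mu> g0) = \<nu>"
        using momentum_left_eq_iff[OF \<mu> \<nu> gG0] meet by simp
      have lin: "linear (momentum_left G A (inv_form \<mu> (fst \<xi>)))"
        by (rule momentum_left_linear[OF inv_form_mem[OF \<mu> gG]])
      have "covec (momentum_left G A (inv_form \<mu> (fst \<xi>))) = covec \<nu> \<longleftrightarrow> momentum_left G A (inv_form \<mu> (fst \<xi>)) = \<nu>"
        using inner_covec[OF lin] inner_covec[OF \<nu>] by (metis ext)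
      then show ?thesis
        unfolding momentum_left_eq_iff[OF \<mu> \<nu> gG] left_coord_chart[OF c g] left_coord_chart[OF c g0] \<nu>_eq by simp
    qed
    also have "\<xi> = inv_form \<mu> (fst \<xi>) \<longleftrightarrow> snd (snd (cotangent_chart A c) \<xi>) = coord c \<mu> (snd c (fst \<xi>))"
      using inv_form_iff[OF \<mu> c \<xi>] by blast
    finally show "\<xi> \<in> inv_form \<mu> ` carrier G \<inter> op.inv_form \<nu> ` carrier G \<longleftrightarrow> snd c' \<xi> \<in> ?N \<times> {0}"
      unfolding level[OF xU] snd by (auto simp: cotangent_chart_simps)
  qed
  \<comment> \<open>The straightening map has identity derivative at the base point, hence so has
    its inverse; a direction \<open>a\<close> therefore keeps its name in the slice chart.\<close>
  have D\<Psi>: "frechet_derivative \<Psi> (at (\<Phi> ?x0)) v = v" for v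
  proof -
    have "frechet_derivative (\<lambda>x. \<Psi> (\<Phi> x)) (at ?x0) v = frechet_derivative (\<lambda>x. x) (at ?x0) v"
      using frechet_derivative_cong_open[OF U(1,3), of "\<lambda>x. \<Psi> (\<Phi> x)" "\<lambda>x. x"] \<Psi>(2) by simp
    also have "\<dots> = v"
      using frechet_derivative_at[OF has_derivative_ident, symmetric] by metis
    finally have "frechet_derivative (\<lambda>x. \<Psi> (\<Phi> x)) (at ?x0) v = v" .
    moreover have "\<Phi> ?x0 \<in> V"
      using V(2) U(3) by blast
    ultimately show ?thesis
      using frechet_derivative_compose[OF \<Phi> \<Psi>(1) U(3), of v] by (simp add: D\<Phi>)
  qed
  show ?thesis
    by (rule that[OF slice mem]) (use der[OF mem] in \<open>simp add: D\<Psi>\<close>)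
qed

text \<open>Slice charts provide enough tangent vectors; conversely, the equation of the graph is
  differentiated along a curve in it.\<close>

lemma tangent_space_fibre:
  assumes \<mu>: "linear \<mu>" and c: "c \<in> A" and g0: "g0 \<in> fst c"
  shows "tangent_space (cotangent_atlas A) (inv_form \<mu> ` carrier G) (inv_form \<mu> g0) =
    {from_chart (cotangent_atlas A) (cotangent_chart A c) (inv_form \<mu> g0) (a, frechet_derivative (coord c \<mu>) (at (snd c g0)) a) | a. True}"
    (is "?T = ?R")
proof (intro equalityI subsetI)
  fix u assume "u \<in> ?R"
  then obtain a where a: "u = from_chart (cotangent_atlas A) (cotangent_chart A c) (inv_form \<mu> g0)
      (a, frechet_derivative (coord c \<mu>) (at (snd c g0)) a)"
    by auto
  obtain c' where c': "slice_chart (cotangent_atlas A) (inv_form \<mu> ` carrier G) c' (UNIV \<times> {0})" "inv_form \<mu> g0 \<in> fst c'"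
    "\<And>a. from_chart (cotangent_atlas A) c' (inv_form \<mu> g0) (a, 0) =
      from_chart (cotangent_atlas A) (cotangent_chart A c) (inv_form \<mu> g0) (a, frechet_derivative (coord c \<mu>) (at (snd c g0)) a)"
    by (rule fibre_slice[OF \<mu> c g0]) blast
  have "inv_form \<mu> g0 \<in> inv_form \<mu> ` carrier G"
    using chart_carrier[OF c g0] by simp
  from slice_chart_tangent[OF smooth_atlas_cotangent[OF atlas] c'(1,2) this, of "(a, 0)"]
  show "u \<in> ?T"
    by (simp add: a c'(3))
next
  fix u assume u: "u \<in> ?T"
  let ?c = "cotangent_chart A c" and ?D = "frechet_derivative (coord c \<mu>) (at (snd c g0))"
  have x0: "snd c g0 \<in> snd c ` fst c"
    using g0 by simp
  obtain z z' \<epsilon> where z: "(z has_derivative (\<lambda>t. t *\<^sub>R z')) (at 0)" "z 0 = snd ?c (inv_form \<mu> g0)"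
    "u = from_chart (cotangent_atlas A) ?c (inv_form \<mu> g0) z'" "\<epsilon> > 0"
    "\<And>t. \<bar>t\<bar> < \<epsilon> \<Longrightarrow> z t \<in> snd ?c ` (fst ?c \<inter> inv_form \<mu> ` carrier G)"
    by (rule tangent_spaceE[OF smooth_atlas_cotangent[OF atlas] u cotangent_chart_maximal[OF atlas c]
          inv_form_chart(1)[OF \<mu> c g0]]) blast
  have graph: "snd (z t) = coord c \<mu> (fst (z t))" if "\<bar>t\<bar> < \<epsilon>" for t
  proof -
    obtain \<xi> where "\<xi> \<in> fst ?c" "\<xi> \<in> inv_form \<mu> ` carrier G" "z t = snd ?c \<xi>"
      using z(5)[OF \<open>\<bar>t\<bar> < \<epsilon>\<close>] by blast
    then show ?thesis
      using inv_form_iff(1)[OF \<mu> c, of \<xi>] by (simp add: cotangent_chart_simps)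
  qed
  have z0: "fst (z 0) = snd c g0"
    by (simp add: z(2) inv_form_chart(2)[OF \<mu> c g0])
  have D: "(coord c \<mu> has_derivative ?D) (at (snd c g0))"
    by (rule smooth_on_has_derivative[OF coord_smooth[OF \<mu> c] x0])
  have "((\<lambda>t. coord c \<mu> (fst (z t))) has_derivative (\<lambda>t. ?D (fst (t *\<^sub>R z')))) (at 0)"
    using has_derivative_compose[OF has_derivative_fst[OF z(1)], of "coord c \<mu>" ?D] D z0 by simp
  then have "((\<lambda>t. snd (z t)) has_derivative (\<lambda>t. ?D (fst (t *\<^sub>R z')))) (at 0)"
    by (rule has_derivative_transform_within_open[of _ _ _ _ "{-\<epsilon><..<\<epsilon>}"])
      (use z(4) graph in \<open>auto simp: abs_less_iff\<close>)
  then have "(\<lambda>t. ?D (fst (t *\<^sub>R z'))) = (\<lambda>t. snd (t *\<^sub>R z'))"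
    by (rule has_derivative_unique[OF _ has_derivative_snd[OF z(1)]])
  from fun_cong[OF this, of 1] have "z' = (fst z', ?D (fst z'))"
    by (simp add: prod_eq_iff)
  then have "u = from_chart (cotangent_atlas A) ?c (inv_form \<mu> g0) (fst z', ?D (fst z'))"
    using z(3) by simp
  then show "u \<in> ?R"
    by blast
qed

lemma tangent_space_inter_subset:
  assumes \<mu>: "linear \<mu>" and \<nu>: "linear \<nu>" and c: "c \<in> A" and g0: "g0 \<in> fst c"
    and meet: "inv_form \<mu> g0 = lie.inv_form (opposite G) A \<nu> g0" and a: "a \<in> inter_kernel c \<mu> g0"
  shows "from_chart (cotangent_atlas A) (cotangent_chart A c) (inv_form \<mu> g0) (a, frechet_derivative (coord c \<mu>) (at (snd c g0)) a)
    \<in> tangent_space (cotangent_atlas A) (inv_form \<mu> ` carrier G \<inter> lie.inv_form (opposite G) A \<nu> ` carrier G) (inv_form \<mu> g0)"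
proof -
  obtain c' where c': "slice_chart (cotangent_atlas A) (inv_form \<mu> ` carrier G \<inter> lie.inv_form (opposite G) A \<nu> ` carrier G) c'
      (inter_kernel c \<mu> g0 \<times> {0})" "inv_form \<mu> g0 \<in> fst c'"
    "\<And>a. from_chart (cotangent_atlas A) c' (inv_form \<mu> g0) (a, 0) =
      from_chart (cotangent_atlas A) (cotangent_chart A c) (inv_form \<mu> g0) (a, frechet_derivative (coord c \<mu>) (at (snd c g0)) a)"
    by (rule inter_slice[OF \<mu> \<nu> c g0 meet]) blast
  have "inv_form \<mu> g0 \<in> inv_form \<mu> ` carrier G \<inter> lie.inv_form (opposite G) A \<nu> ` carrier G"
    using imageI[OF chart_carrier[OF c g0], of "inv_form \<mu>"]
      imageI[OF chart_carrier[OF c g0], of "lie.inv_form (opposite G) A \<nu>"] meet by simp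
  from slice_chart_tangent[OF smooth_atlas_cotangent[OF atlas] c'(1,2) this, of "(a, 0)"]
  show ?thesis
    using a by (simp add: c'(3))
qed

lemma canonical_form_fibres:
  assumes \<mu>: "linear \<mu>" and \<nu>: "linear \<nu>" and c: "c \<in> A" and g0: "g0 \<in> fst c"
    and meet: "inv_form \<mu> g0 = lie.inv_form (opposite G) A \<nu> g0"
  defines "T \<equiv> cotangent_atlas A"
  assumes u: "u \<in> tangent_space T (inv_form \<mu> ` carrier G) (inv_form \<mu> g0)"
    and v: "v \<in> tangent_space T (lie.inv_form (opposite G) A \<nu> ` carrier G) (inv_form \<mu> g0)"
  shows "canonical_form A (inv_form \<mu> g0) u v = 0" "canonical_form A (inv_form \<mu> g0) v u = 0"
proof -
  interpret op: lie "opposite G" A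
    by (rule lie_opposite)
  let ?p = "inv_form \<mu> g0" and ?c = "cotangent_chart A c"
  have eq: "coord c \<mu> (snd c g0) = op.coord c \<nu> (snd c g0)"
    using inv_form_chart(2)[OF \<mu> c g0] op.inv_form_chart(2)[OF \<nu> c g0] meet by simp
  obtain a where a: "u = from_chart T ?c ?p (a, frechet_derivative (coord c \<mu>) (at (snd c g0)) a)"
    using u unfolding T_def tangent_space_fibre[OF \<mu> c g0] by auto
  obtain b where b: "v = from_chart T ?c ?p (b, frechet_derivative (op.coord c \<nu>) (at (snd c g0)) b)"
    using v unfolding T_def meet op.tangent_space_fibre[OF \<nu> c g0, unfolded opposite_simps] by auto
  have p: "?p \<in> fst ?c"
    by (rule inv_form_chart(1)[OF \<mu> c g0])
  show "canonical_form A ?p u v = 0" "canonical_form A ?p v u = 0"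
    using coord_reciprocity[OF \<mu> \<nu> c g0 eq, of a b]
    unfolding a b T_def canonical_form_chart[OF atlas c p] standard_form_def by simp_all
qed

text \<open>A vector tangent to the intersection is tangent to \<open>S'\<close>, hence orthogonal
  to everything tangent to \<open>S\<close>; this places it in the kernel. Conversely, a kernel
  vector has a base direction killed by the derivative of \<open>left_coord\<close>, and the slice
  chart of the intersection realises that direction.\<close>

lemma kernel_fibre:
  assumes \<mu>: "linear \<mu>" and \<nu>: "linear \<nu>" and g0: "g0 \<in> carrier G"
    and meet: "inv_form \<mu> g0 = lie.inv_form (opposite G) A \<nu> g0"
  defines "T \<equiv> cotangent_atlas A" and "S \<equiv> inv_form \<mu> ` carrier G" and "S' \<equiv> lie.inv_form (opposite G) A \<nu> ` carrier G"
  shows "tangent_space T (S \<inter> S') (inv_form \<mu> g0) =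
    kernel_form T S (induced_form T S (canonical_form A)) (inv_form \<mu> g0)"
proof (intro equalityI subsetI)
  interpret op: lie "opposite G" A
    by (rule lie_opposite)
  let ?p = "inv_form \<mu> g0"
  define c where "c = chart_at A g0"
  have c: "c \<in> A" "g0 \<in> fst c"
    using chart_at[of g0 A] g0 by (simp_all add: c_def)
  let ?c = "cotangent_chart A c"
  have p: "?p \<in> fst ?c"
    by (rule inv_form_chart(1)[OF \<mu> c])
  have pS: "?p \<in> S"
    using g0 by (simp add: S_def)
  fix u
  {
    assume u: "u \<in> tangent_space T (S \<inter> S') ?p"
    then have "u \<in> tangent_space T S ?p" "u \<in> tangent_space T S' ?p"
      using tangent_space_mono[of "S \<inter> S'" S T ?p] tangent_space_mono[of "S \<inter> S'" S' T ?p] by auto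
    then show "u \<in> kernel_form T S (induced_form T S (canonical_form A)) ?p"
      using canonical_form_fibres(2)[OF \<mu> \<nu> c meet] unfolding kernel_form_def induced_form_def S_def S'_def T_def by auto
  next
    assume "u \<in> kernel_form T S (induced_form T S (canonical_form A)) ?p"
    then have u: "u \<in> tangent_space T S ?p"
      and ker: "\<And>v. v \<in> tangent_space T S ?p \<Longrightarrow> canonical_form A ?p u v = 0"
      using pS by (auto simp: kernel_form_def induced_form_def)
    let ?D = "frechet_derivative (coord c \<mu>) (at (snd c g0))" and ?D' = "frechet_derivative (op.coord c \<nu>) (at (snd c g0))"
    have eq: "coord c \<mu> (snd c g0) = op.coord c \<nu> (snd c g0)"
      using inv_form_chart(2)[OF \<mu> c] op.inv_form_chart(2)[OF \<nu> c] meet by simp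
    obtain a where a: "u = from_chart T ?c ?p (a, ?D a)"
      using u unfolding T_def S_def tangent_space_fibre[OF \<mu> c] by auto
    \<comment> \<open>Vanishing against \<open>(b, ?D b)\<close> equates this with the pairing of
      \<open>?D b\<close> and \<open>a\<close>, which reciprocity turns into the right-hand
      side.\<close>
    have "?D a \<bullet> b = ?D' a \<bullet> b" for b
    proof -
      have "from_chart T ?c ?p (b, ?D b) \<in> tangent_space T S ?p"
        unfolding T_def S_def tangent_space_fibre[OF \<mu> c] by auto
      from ker[OF this] show ?thesis
        using coord_reciprocity[OF \<mu> \<nu> c eq, of b a]
        unfolding a T_def canonical_form_chart[OF atlas c(1) p] standard_form_def by simp
    qed
    then have "?D a = ?D' a"
      by (metis vector_eq_rdot)
    then have "a \<in> inter_kernel c \<mu> g0"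
      unfolding inter_kernel_def using left_coord_kernel[OF \<mu> \<nu> c eq] by simp
    then show "u \<in> tangent_space T (S \<inter> S') ?p"
      unfolding a T_def S_def S'_def by (rule tangent_space_inter_subset[OF \<mu> \<nu> c meet])
  }
qed

lemma dim_Times_zero: "dim (N \<times> {0 :: 'e}) = dim (N :: 'e set)"
proof -
  have "N \<times> {0 :: 'e} = (\<lambda>n. (n, 0)) ` N"
    by auto
  then show ?thesis
    using dim_image_eq_fd[of "\<lambda>n::'e. (n, 0::'e)" N] by (simp add: linear_iff inj_def)
qed

lemma fibre_submanifold:
  assumes \<mu>: "linear \<mu>"
  shows "smooth_submanifold (cotangent_atlas A) (inv_form \<mu> ` carrier G)"
  unfolding smooth_submanifold_def
proof (intro conjI exI[of _ "dim (UNIV \<times> {0} :: ('e \<times> 'e) set)"] ballI)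
  show "inv_form \<mu> ` carrier G \<subseteq> points (cotangent_atlas A)"
    using inv_form_mem[OF \<mu>] by auto
  fix p assume "p \<in> inv_form \<mu> ` carrier G"
  then obtain g where g: "g \<in> carrier G" "p = inv_form \<mu> g"
    by auto
  obtain c' where "slice_chart (cotangent_atlas A) (inv_form \<mu> ` carrier G) c' (UNIV \<times> {0})" "inv_form \<mu> g \<in> fst c'"
    by (rule fibre_slice[OF \<mu>, of "chart_at A g" g]) (use chart_at[of g A] g in auto)
  then show "\<exists>c V. slice_chart (cotangent_atlas A) (inv_form \<mu> ` carrier G) c V \<and> p \<in> fst c \<and> dim V = dim (UNIV \<times> {0} :: ('e \<times> 'e) set)"
    using g by blast
qed

lemma inter_submanifold:
  assumes \<mu>: "linear \<mu>" and \<nu>: "linear \<nu>"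
  defines "S \<equiv> inv_form \<mu> ` carrier G \<inter> lie.inv_form (opposite G) A \<nu> ` carrier G"
  shows "smooth_submanifold (cotangent_atlas A) S"
  unfolding smooth_submanifold_def
proof (intro conjI exI[of _ "dim (inter_kernel (chart_at A \<one>) \<mu> \<one>)"] ballI)
  interpret op: lie "opposite G" A
    by (rule lie_opposite)
  let ?d = "chart_at A \<one>"
  have d: "?d \<in> A" "\<one> \<in> fst ?d"
    using chart_at[of \<one> A] by simp_all
  show "S \<subseteq> points (cotangent_atlas A)"
    using inv_form_mem[OF \<mu>] by (auto simp: S_def)
  fix p assume "p \<in> S"
  then obtain g where g: "g \<in> carrier G" "p = inv_form \<mu> g" "inv_form \<mu> g = op.inv_form \<nu> g"
    by (auto simp: S_def) (metis fst_inv_form op.fst_inv_form)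
  let ?c = "chart_at A g"
  have c: "?c \<in> A" "g \<in> fst ?c"
    using chart_at[of g A] g by simp_all
  obtain c' where c': "slice_chart (cotangent_atlas A) S c' (inter_kernel ?c \<mu> g \<times> {0})" "inv_form \<mu> g \<in> fst c'"
    unfolding S_def by (rule inter_slice[OF \<mu> \<nu> c g(3)]) blast
  \<comment> \<open>A submanifold has one dimension for all its points. Kernels at \<open>g\<close>
    and at the unit are embedded into each other by the transport maps; the unit is a mere reference
    and need not lie under the intersection.\<close>
  have "dim (inter_kernel ?c \<mu> g) = dim (inter_kernel ?d \<mu> \<one>)"
  proof -
    note t = left_coord_transport[OF \<mu> d c] and t' = left_coord_transport[OF \<mu> c d]
    have le: "dim (X :: 'e set) \<le> dim Y" if "linear f" "inj f" "f ` X \<subseteq> Y" for f :: "'e \<Rightarrow> 'e" and X Y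
    proof -
      interpret finite_dimensional_vector_space "(*\<^sub>R)" "onb::'e set"
        by (rule fd_space)
      show ?thesis
        using dim_subset[OF that(3)] dim_image_eq_fd[OF that(1,2), of X] by (simp add: dim_raw_def)
    qed
    show ?thesis
      by (rule antisym, rule le[OF t'(1,2)], use t'(3) in \<open>auto simp: inter_kernel_def\<close>,
          rule le[OF t(1,2)], use t(3) in \<open>auto simp: inter_kernel_def\<close>)
  qed
  then show "\<exists>c V. slice_chart (cotangent_atlas A) S c V \<and> p \<in> fst c \<and> dim V = dim (inter_kernel ?d \<mu> \<one>)"
    using c' g(2) dim_Times_zero[of "inter_kernel ?c \<mu> g"] by (metis (no_types))
qed

text \<open>Of two vectors tangent to the intersection, one is regarded as tangent to the
  left-invariant graph and the other to the right-invariant one; these are orthogonal.\<close>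

lemma inter_isotropic:
  assumes \<mu>: "linear \<mu>" and \<nu>: "linear \<nu>"
  shows "isotropic_submanifold (cotangent_atlas A) (canonical_form A)
    (inv_form \<mu> ` carrier G \<inter> lie.inv_form (opposite G) A \<nu> ` carrier G)"
  unfolding isotropic_submanifold_def
proof (intro conjI ballI)
  interpret op: lie "opposite G" A
    by (rule lie_opposite)
  let ?S = "inv_form \<mu> ` carrier G" and ?S' = "op.inv_form \<nu> ` carrier G" and ?T = "cotangent_atlas A"
  show "smooth_submanifold ?T (?S \<inter> ?S')"
    by (rule inter_submanifold[OF \<mu> \<nu>])
  fix p u v assume p: "p \<in> ?S \<inter> ?S'" and uv: "u \<in> tangent_space ?T (?S \<inter> ?S') p" "v \<in> tangent_space ?T (?S \<inter> ?S') p"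
  then obtain g where g: "g \<in> carrier G" "p = inv_form \<mu> g" "inv_form \<mu> g = op.inv_form \<nu> g"
    by auto (metis fst_inv_form op.fst_inv_form)
  have c: "chart_at A g \<in> A" "g \<in> fst (chart_at A g)"
    using chart_at[of g A] g by simp_all
  have "u \<in> tangent_space ?T ?S p" "v \<in> tangent_space ?T ?S' p"
    using uv tangent_space_mono[of "?S \<inter> ?S'" ?S ?T p] tangent_space_mono[of "?S \<inter> ?S'" ?S' ?T p] by auto
  then show "canonical_form A p u v = 0"
    using canonical_form_fibres(1)[OF \<mu> \<nu> c g(3)] g(2) by simp
qed

text \<open>The section \<open>inv_form \<mu>\<close> is the diffeomorphism. Its inverse is the
  restriction of the bundle projection, which is a smooth extension to the whole cotangent
  bundle.\<close>

lemma fibre_diffeomorphic: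
  assumes \<mu>: "linear \<mu>"
  shows "diffeomorphic_to_submanifold A (cotangent_atlas A) (inv_form \<mu> ` carrier G)"
  unfolding diffeomorphic_to_submanifold_def points_carrier
proof (intro exI conjI)
  let ?T = "cotangent_atlas A"
  have T: "smooth_atlas ?T"
    by (rule smooth_atlas_cotangent[OF atlas])
  have inj: "inj_on (inv_form \<mu>) (carrier G)"
    by (rule inj_on_inverseI[of _ fst]) simp
  then show "bij_betw (inv_form \<mu>) (carrier G) (inv_form \<mu> ` carrier G)"
    by (simp add: bij_betw_def)
  have "smooth_at A ?T (inv_form \<mu>) g" if g: "g \<in> carrier G" for g
  proof -
    define c where "c = chart_at A g"
    have c: "c \<in> A" "g \<in> fst c"
      using chart_at[of g A] g by (simp_all add: c_def)
    have ch: "is_chart c"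
      using atlas c by (simp add: smooth_atlas_def)
    have inv: "inv_form \<mu> (chart_inv c x) \<in> fst (cotangent_chart A c)"
      "snd (cotangent_chart A c) (inv_form \<mu> (chart_inv c x)) = (x, coord c \<mu> x)" if "x \<in> snd c ` fst c" for x
      using inv_form_chart(1,2)[OF \<mu> c(1) inv_into_into[OF that]] f_inv_into_f[OF that] by simp_all
    have "smooth_in_charts c (cotangent_chart A c) (inv_form \<mu>) g"
      by (rule smooth_in_chartsI(1)[OF c(2) is_chart_open[OF ch], where h = "\<lambda>x. (x, coord c \<mu> x)"])
        (use c inv in \<open>auto intro!: smooth_on_Pair smooth_on_ident coord_smooth[OF \<mu>] is_chart_open[OF ch]\<close>)
    then show ?thesis
      by (rule smooth_atI[OF atlas T atlas_subset_maximal[OF atlas c(1)] cotangent_chart_maximal[OF atlas c(1)]])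
  qed
  then show "smooth_map_on A ?T (carrier G) (inv_form \<mu>)"
    using smooth_mapI[OF atlas T, of "inv_form \<mu>"] by simp
  have "smooth_map ?T A fst"
    by (rule smooth_mapI[OF T atlas]) (use smooth_at_proj[OF atlas] in simp)
  moreover have "openin (manifold_topology ?T) (points ?T)"
    by (rule openin_manifold_topology[OF T])
  ultimately show "smooth_map_submanifold ?T A (inv_form \<mu> ` carrier G) (inv_into (carrier G) (inv_form \<mu>))"
    unfolding smooth_map_submanifold_def using inj inv_form_mem[OF \<mu>]
    by (intro ballI exI[of _ "points ?T"] exI[of _ fst]) auto
qed

end

theorem proposition4:
  fixes G :: "('g, 'z) monoid_scheme"
    and A :: "('g, 'e::finite_dim_inner) atlas"
    and \<zeta> :: "'g \<times> ('e \<Rightarrow> real)"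
  assumes "lie_group G A"
    and "connected_space (manifold_topology A)"
    and "\<zeta> \<in> cotangent_bundle A"
  shows "let T = cotangent_atlas A;
             \<omega> = canonical_form A;
             SR = {\<xi> \<in> cotangent_bundle A. momentum_right G A \<xi> = momentum_right G A \<zeta>};
             SL = {\<xi> \<in> cotangent_bundle A. momentum_left G A \<xi> = momentum_left G A \<zeta>}
         in
           smooth_submanifold T SR \<and> diffeomorphic_to_submanifold A T SR \<and>
           SR = orbit G (\<lambda>g \<xi>. lift_left G A g \<xi>) \<zeta> \<and>
           smooth_submanifold T SL \<and> diffeomorphic_to_submanifold A T SL \<and>
           SL = orbit G (\<lambda>g \<xi>. lift_right G A \<xi> g) \<zeta> \<and>
           isotropic_submanifold T \<omega> (SR \<inter> SL) \<and>
           SR \<inter> SL = {cotangent_transpose A (left_transl G (inv\<^bsub>G\<^esub> g)) \<zeta> | g.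
             g \<in> stabilizer G (coadjoint G A) (momentum_left G A \<zeta>)} \<and>
           SR \<inter> SL = {cotangent_transpose A (right_transl G (inv\<^bsub>G\<^esub> \<gamma>)) \<zeta> | \<gamma>.
             \<gamma> \<in> stabilizer G (coadjoint G A) (momentum_right G A \<zeta>)} \<and>
           closed_form_on T SR (induced_form T SR \<omega>) \<and>
           closed_form_on T SL (induced_form T SL \<omega>) \<and>
           tangent_space T (SR \<inter> SL) \<zeta> = kernel_form T SR (induced_form T SR \<omega>) \<zeta> \<and>
           tangent_space T (SR \<inter> SL) \<zeta> = kernel_form T SL (induced_form T SL \<omega>) \<zeta>"
proof -
  interpret lie G A
    by (rule lie.intro[OF assms(1)])
  interpret op: lie "opposite G" A
    by (rule lie_opposite)
  define \<mu> where "\<mu> = momentum_right G A \<zeta>"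
  define \<nu> where "\<nu> = momentum_left G A \<zeta>"
  define g0 where "g0 = fst \<zeta>"
  let ?T = "cotangent_atlas A" and ?\<omega> = "canonical_form A"
  let ?SR = "{\<xi> \<in> cotangent_bundle A. momentum_right G A \<xi> = momentum_right G A \<zeta>}"
  let ?SL = "{\<xi> \<in> cotangent_bundle A. momentum_left G A \<xi> = momentum_left G A \<zeta>}"
  have \<mu>: "linear \<mu>" and \<nu>: "linear \<nu>"
    using momentum_right_linear[OF assms(3)] momentum_left_linear[OF assms(3)] by (simp_all add: \<mu>_def \<nu>_def)
  have g0: "g0 \<in> carrier G"
    using assms(3) by (simp add: g0_def cotangent_bundle_iff)
  have SR: "?SR = inv_form \<mu> ` carrier G"
    using momentum_right_fibre[OF \<mu>] by (simp add: \<mu>_def)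
  have SL: "?SL = op.inv_form \<nu> ` carrier G"
    using op.momentum_right_fibre[OF \<nu>] by (simp add: \<nu>_def)
  have \<zeta>: "inv_form \<mu> g0 = \<zeta>" "op.inv_form \<nu> g0 = \<zeta>"
    using inv_form_momentum_right[OF assms(3)] op.inv_form_momentum_right[OF assms(3)]
    by (simp_all add: \<mu>_def \<nu>_def g0_def)
  have orbit_L: "?SL = orbit G (\<lambda>g \<xi>. lift_right G A \<xi> g) \<zeta>"
    using op.momentum_right_fibre_orbit[OF assms(3)] by (simp add: orbit_def)
  have inter_R: "?SR \<inter> ?SL = {cotangent_transpose A (right_transl G (inv\<^bsub>G\<^esub> \<gamma>)) \<zeta> | \<gamma>.
      \<gamma> \<in> stabilizer G (coadjoint G A) (momentum_right G A \<zeta>)}"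
    using op.momentum_fibres_inter[OF assms(3)] by (simp add: stabilizer_opposite Int_commute)
  have ker_R: "tangent_space ?T (?SR \<inter> ?SL) \<zeta> = kernel_form ?T ?SR (induced_form ?T ?SR ?\<omega>) \<zeta>"
    using kernel_fibre[OF \<mu> \<nu> g0] unfolding SR SL \<zeta> by simp
  have ker_L: "tangent_space ?T (?SR \<inter> ?SL) \<zeta> = kernel_form ?T ?SL (induced_form ?T ?SL ?\<omega>) \<zeta>"
    using op.kernel_fibre[OF \<nu> \<mu>, of g0] g0 unfolding SR SL \<zeta> by (simp add: \<zeta> Int_commute)
  show ?thesis
    unfolding Let_def
  proof (intro conjI)
    show "smooth_submanifold ?T ?SR" "diffeomorphic_to_submanifold A ?T ?SR"
      unfolding SR by (rule fibre_submanifold[OF \<mu>], rule fibre_diffeomorphic[OF \<mu>])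
    show "smooth_submanifold ?T ?SL" "diffeomorphic_to_submanifold A ?T ?SL"
      unfolding SL using op.fibre_submanifold[OF \<nu>] op.fibre_diffeomorphic[OF \<nu>] by simp_all
    show "isotropic_submanifold ?T ?\<omega> (?SR \<inter> ?SL)"
      unfolding SR SL by (rule inter_isotropic[OF \<mu> \<nu>])
    show "?SR = orbit G (\<lambda>g \<xi>. lift_left G A g \<xi>) \<zeta>"
      by (rule momentum_right_fibre_orbit[OF assms(3)])
    show "?SR \<inter> ?SL = {cotangent_transpose A (left_transl G (inv\<^bsub>G\<^esub> g)) \<zeta> | g.
        g \<in> stabilizer G (coadjoint G A) (momentum_left G A \<zeta>)}"
      by (rule momentum_fibres_inter[OF assms(3)])
    show "closed_form_on ?T ?SR (induced_form ?T ?SR ?\<omega>)" "closed_form_on ?T ?SL (induced_form ?T ?SL ?\<omega>)"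
      by (rule induced_canonical_form_closed[OF atlas])+
  qed (fact orbit_L inter_R ker_R ker_L)+
qed

end
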